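(* Let $P\colon(\mathcal X,F)\to(\mathcal M,G)$ be a fiberwise opfibration in $\mathbf{Fib}(\mathcal A)$ whose codomain $G\colon\mathcal M\to\mathcal A$ is a split fibration. Then $P$ can be factorized in $\mathbf{Fib}(\mathcal A)$ as $P=\bar P\cdot Q$, $$(\mathcal X,F)\xrightarrow{\;Q\;}(\bar{\mathcal X},\bar F)\xrightarrow{\;\bar P\;}(\mathcal M,G),$$ where $\bar P$ is a discrete opfibration in $\mathbf{Fib}(\mathcal A)$ and, for every object $m$ of $\mathcal M$, the fiber $\bar{\mathcal X}_m$ of $\bar P$ over $m$ consists of the connected components of the fiber $\mathcal X_m$ of $P$ over $m$.
   Context: (Op)cartesian arrows, (op)cartesian liftings and Grothendieck (op)fibrations are as usual; an arrow $f$ is $F$-vertical if $F(f)$ is an identity. All (op)fibrations are assumed to admit a cleavage. A fibration $G$ is split if it admits a functorial cleavage, i.e. a choice of cartesian liftings such that $\alpha^*\cdot\alpha'^*=(\alpha'\cdot\alpha)^*$ and $(1_a)^*=1_{\mathcal M_a}$ for the change of base functors, the chosen liftings being compatible with composition and identities. $\mathbf{Fib}(\mathcal A)$ is the 2-category whose objects are fibrations $(\mathcal X,F)$, $F\colon\mathcal X\to\mathcal A$; 1-cells $P\colon(\mathcal X,F)\to(\mathcal M,G)$ are functors with $G\cdot P=F$ sending $F$-cartesian arrows to $G$-cartesian arrows; 2-cells are natural transformations with $G$-vertical components. The fiber of a functor over an object $c$ consists of the objects sent to $c$ and the arrows sent to $1_c$. $P$ is a fiberwise opfibration if for every object $a$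 of $\mathcal A$ the restriction to fibers over $a$, $P_a\colon\mathcal X_a\to\mathcal M_a$, is an opfibration. Two objects of $\mathcal X_m$ are in the same connected component if they are joined by a zig-zag of arrows of $\mathcal X_m$ (i.e. of arrows sent by $P$ to $1_m$). Discrete opfibration in a 2-category with comma objects: a 1-cell $p\colon E\to B$ is a discrete opfibration if the canonical 1-cell $r\colon E\downarrow E\to p\downarrow B$ between comma objects has a left adjoint with identity unit and identity counit (so $r$ is an isomorphism). In $\mathbf{Fib}(\mathcal A)$, for $P\colon(\mathcal X,F)\to(\mathcal M,G)$: the objects of $P\downarrow(\mathcal M,G)$ are triples $(x,\beta\colon Px\to m,m)$ with $G\beta=1_{Fx}$, with arrows pairs $(\xi,\mu)$ forming commutative squares. The objects of $(\mathcal X,F)\downarrow(\mathcal X,F)$ are triples $(x_0,\nu\colon x_0\to x_1,x_1)$ with $F\nu=1$, with arrows the commutative squares, and $r(x_0,\nu,x_1)=(x_0,P\nu,Px_1)$. *)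

theory Defs
  imports Main
begin

text \<open>
  Categories, functors and natural transformations are carrier-based: the operations are
  unspecified outside the carriers \<^term>\<open>Obj C\<close> and \<^term>\<open>Arr C\<close>, so equality of functors is
  equality on the carriers of the source (\<open>func_eq\<close>).
\<close>

record ('o, 'a) cat =
  Obj :: "'o set"
  Arr :: "'a set"
  Dom :: "'a \<Rightarrow> 'o"
  Cod :: "'a \<Rightarrow> 'o"
  Ide :: "'o \<Rightarrow> 'a"
  Comp :: "'a \<Rightarrow> 'a \<Rightarrow> 'a" (infixl \<open>\<cdot>\<index>\<close> 70)

definition hom :: "('o, 'a) cat \<Rightarrow> 'o \<Rightarrow> 'o \<Rightarrow> 'a set" where
  "hom C x y = {f \<in> Arr C. Dom C f = x \<and> Cod C f = y}"

definition category :: "('o, 'a) cat \<Rightarrow> bool" where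
  "category C \<longleftrightarrow>
     (\<forall>f\<in>Arr C. Dom C f \<in> Obj C \<and> Cod C f \<in> Obj C) \<and>
     (\<forall>x\<in>Obj C. Ide C x \<in> hom C x x) \<and>
     (\<forall>f\<in>Arr C. \<forall>g\<in>Arr C. Cod C f = Dom C g \<longrightarrow> g \<cdot>\<^bsub>C\<^esub> f \<in> hom C (Dom C f) (Cod C g)) \<and>
     (\<forall>f\<in>Arr C. f \<cdot>\<^bsub>C\<^esub> Ide C (Dom C f) = f \<and> Ide C (Cod C f) \<cdot>\<^bsub>C\<^esub> f = f) \<and>
     (\<forall>f\<in>Arr C. \<forall>g\<in>Arr C. \<forall>h\<in>Arr C. Cod C f = Dom C g \<longrightarrow> Cod C g = Dom C h \<longrightarrow>
        h \<cdot>\<^bsub>C\<^esub> (g \<cdot>\<^bsub>C\<^esub> f) = (h \<cdot>\<^bsub>C\<^esub> g) \<cdot>\<^bsub>C\<^esub> f)"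

record ('o, 'a, 'p, 'b) func =
  FO :: "'o \<Rightarrow> 'p"
  FA :: "'a \<Rightarrow> 'b"

definition is_functor :: "('o, 'a) cat \<Rightarrow> ('p, 'b) cat \<Rightarrow> ('o, 'a, 'p, 'b) func \<Rightarrow> bool" where
  "is_functor C D F \<longleftrightarrow> category C \<and> category D \<and>
     (\<forall>x\<in>Obj C. FO F x \<in> Obj D) \<and>
     (\<forall>f\<in>Arr C. FA F f \<in> hom D (FO F (Dom C f)) (FO F (Cod C f))) \<and>
     (\<forall>x\<in>Obj C. FA F (Ide C x) = Ide D (FO F x)) \<and>
     (\<forall>f\<in>Arr C. \<forall>g\<in>Arr C. Cod C f = Dom C g \<longrightarrow> FA F (g \<cdot>\<^bsub>C\<^esub> f) = FA F g \<cdot>\<^bsub>D\<^esub> FA F f)"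

definition id_func :: "('o, 'a, 'o, 'a) func" where
  "id_func = \<lparr>FO = (\<lambda>x. x), FA = (\<lambda>f. f)\<rparr>"

definition comp_func ::
  "('p, 'b, 'q, 'c) func \<Rightarrow> ('o, 'a, 'p, 'b) func \<Rightarrow> ('o, 'a, 'q, 'c) func" (infixl \<open>\<bullet>\<close> 70) where
  "G \<bullet> F = \<lparr>FO = (\<lambda>x. FO G (FO F x)), FA = (\<lambda>f. FA G (FA F f))\<rparr>"

definition func_eq ::
  "('o, 'a) cat \<Rightarrow> ('o, 'a, 'p, 'b) func \<Rightarrow> ('o, 'a, 'p, 'b) func \<Rightarrow> bool" where
  "func_eq C S T \<longleftrightarrow> (\<forall>x\<in>Obj C. FO S x = FO T x) \<and> (\<forall>f\<in>Arr C. FA S f = FA T f)"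

definition vertical ::
  "('o, 'a) cat \<Rightarrow> ('p, 'b) cat \<Rightarrow> ('o, 'a, 'p, 'b) func \<Rightarrow> 'a \<Rightarrow> bool" where
  "vertical C A F f \<longleftrightarrow> f \<in> Arr C \<and> (\<exists>a\<in>Obj A. FA F f = Ide A a)"

definition fiber ::
  "('o, 'a) cat \<Rightarrow> ('p, 'b) cat \<Rightarrow> ('o, 'a, 'p, 'b) func \<Rightarrow> 'p \<Rightarrow> ('o, 'a) cat" where
  "fiber C A F a =
     C\<lparr>Obj := {x \<in> Obj C. FO F x = a}, Arr := {f \<in> Arr C. FA F f = Ide A a}\<rparr>"


subsection \<open>Fibrations and opfibrations\<close>

definition cartesian ::
  "('o, 'a) cat \<Rightarrow> ('p, 'b) cat \<Rightarrow> ('o, 'a, 'p, 'b) func \<Rightarrow> 'a \<Rightarrow> bool" where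
  "cartesian C A F f \<longleftrightarrow> f \<in> Arr C \<and>
     (\<forall>g\<in>Arr C. \<forall>\<alpha>\<in>hom A (FO F (Dom C g)) (FO F (Dom C f)).
        Cod C g = Cod C f \<longrightarrow> FA F f \<cdot>\<^bsub>A\<^esub> \<alpha> = FA F g \<longrightarrow>
        (\<exists>!h. h \<in> hom C (Dom C g) (Dom C f) \<and> f \<cdot>\<^bsub>C\<^esub> h = g \<and> FA F h = \<alpha>))"

definition opcartesian ::
  "('o, 'a) cat \<Rightarrow> ('p, 'b) cat \<Rightarrow> ('o, 'a, 'p, 'b) func \<Rightarrow> 'a \<Rightarrow> bool" where
  "opcartesian C A F f \<longleftrightarrow> f \<in> Arr C \<and>
     (\<forall>g\<in>Arr C. \<forall>\<alpha>\<in>hom A (FO F (Cod C f)) (FO F (Cod C g)).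
        Dom C g = Dom C f \<longrightarrow> \<alpha> \<cdot>\<^bsub>A\<^esub> FA F f = FA F g \<longrightarrow>
        (\<exists>!h. h \<in> hom C (Cod C f) (Cod C g) \<and> h \<cdot>\<^bsub>C\<^esub> f = g \<and> FA F h = \<alpha>))"

text \<open>\<open>\<kappa> x \<alpha>\<close> is the chosen cartesian lifting \<open>\<alpha>\<^sup>* x \<rightarrow> x\<close> of \<open>\<alpha> : a \<rightarrow> F x\<close>.\<close>

definition cleavage ::
  "('o, 'a) cat \<Rightarrow> ('p, 'b) cat \<Rightarrow> ('o, 'a, 'p, 'b) func \<Rightarrow> ('o \<Rightarrow> 'b \<Rightarrow> 'a) \<Rightarrow> bool" where
  "cleavage C A F \<kappa> \<longleftrightarrow>
     (\<forall>x\<in>Obj C. \<forall>\<alpha>\<in>Arr A. Cod A \<alpha> = FO F x \<longrightarrow>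
        cartesian C A F (\<kappa> x \<alpha>) \<and> Cod C (\<kappa> x \<alpha>) = x \<and> FA F (\<kappa> x \<alpha>) = \<alpha>)"

definition opcleavage ::
  "('o, 'a) cat \<Rightarrow> ('p, 'b) cat \<Rightarrow> ('o, 'a, 'p, 'b) func \<Rightarrow> ('o \<Rightarrow> 'b \<Rightarrow> 'a) \<Rightarrow> bool" where
  "opcleavage C A F \<kappa> \<longleftrightarrow>
     (\<forall>x\<in>Obj C. \<forall>\<alpha>\<in>Arr A. Dom A \<alpha> = FO F x \<longrightarrow>
        opcartesian C A F (\<kappa> x \<alpha>) \<and> Dom C (\<kappa> x \<alpha>) = x \<and> FA F (\<kappa> x \<alpha>) = \<alpha>)"

definition fibration ::
  "('o, 'a) cat \<Rightarrow> ('p, 'b) cat \<Rightarrow> ('o, 'a, 'p, 'b) func \<Rightarrow> bool" where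
  "fibration C A F \<longleftrightarrow> is_functor C A F \<and> (\<exists>\<kappa>. cleavage C A F \<kappa>)"

definition opfibration ::
  "('o, 'a) cat \<Rightarrow> ('p, 'b) cat \<Rightarrow> ('o, 'a, 'p, 'b) func \<Rightarrow> bool" where
  "opfibration C A F \<longleftrightarrow> is_functor C A F \<and> (\<exists>\<kappa>. opcleavage C A F \<kappa>)"

text \<open>
  The conditions are on the liftings themselves; since a change of base functor is determined
  on arrows by the universal property of the chosen liftings, they yield the strict equalities
  \<open>\<alpha>\<^sup>* \<cdot> \<alpha>'\<^sup>* = (\<alpha>' \<cdot> \<alpha>)\<^sup>*\<close> and \<open>1\<^sup>* = 1\<close> of functors between fibers.
\<close>

definition split_cleavage ::
  "('o, 'a) cat \<Rightarrow> ('p, 'b) cat \<Rightarrow> ('o, 'a, 'p, 'b) func \<Rightarrow> ('o \<Rightarrow> 'b \<Rightarrow> 'a) \<Rightarrow> bool" where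
  "split_cleavage C A F \<kappa> \<longleftrightarrow> cleavage C A F \<kappa> \<and>
     (\<forall>x\<in>Obj C. \<kappa> x (Ide A (FO F x)) = Ide C x) \<and>
     (\<forall>x\<in>Obj C. \<forall>\<alpha>'\<in>Arr A. \<forall>\<alpha>\<in>Arr A. Cod A \<alpha>' = FO F x \<longrightarrow> Cod A \<alpha> = Dom A \<alpha>' \<longrightarrow>
        \<kappa> x (\<alpha>' \<cdot>\<^bsub>A\<^esub> \<alpha>) = \<kappa> x \<alpha>' \<cdot>\<^bsub>C\<^esub> \<kappa> (Dom C (\<kappa> x \<alpha>')) \<alpha>)"

definition split_fibration ::
  "('o, 'a) cat \<Rightarrow> ('p, 'b) cat \<Rightarrow> ('o, 'a, 'p, 'b) func \<Rightarrow> bool" where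
  "split_fibration C A F \<longleftrightarrow> is_functor C A F \<and> (\<exists>\<kappa>. split_cleavage C A F \<kappa>)"


subsection \<open>The 2-category of fibrations over a category\<close>

definition fib_1cell ::
  "('c, 'd) cat \<Rightarrow> ('o, 'a) cat \<Rightarrow> ('o, 'a, 'c, 'd) func \<Rightarrow> ('p, 'b) cat \<Rightarrow> ('p, 'b, 'c, 'd) func \<Rightarrow>
   ('o, 'a, 'p, 'b) func \<Rightarrow> bool" where
  "fib_1cell A X F M G P \<longleftrightarrow>
     fibration X A F \<and> fibration M A G \<and> is_functor X M P \<and> func_eq X (G \<bullet> P) F \<and>
     (\<forall>f. cartesian X A F f \<longrightarrow> cartesian M A G (FA P f))"

definition fib_2cell ::
  "('c, 'd) cat \<Rightarrow> ('o, 'a) cat \<Rightarrow> ('o, 'a, 'c, 'd) func \<Rightarrow> ('p, 'b) cat \<Rightarrow> ('p, 'b, 'c, 'd) func \<Rightarrow>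
   ('o, 'a, 'p, 'b) func \<Rightarrow> ('o, 'a, 'p, 'b) func \<Rightarrow> ('o \<Rightarrow> 'b) \<Rightarrow> bool" where
  "fib_2cell A X F M G S T \<tau> \<longleftrightarrow>
     fib_1cell A X F M G S \<and> fib_1cell A X F M G T \<and>
     (\<forall>x\<in>Obj X. \<tau> x \<in> hom M (FO S x) (FO T x) \<and> vertical M A G (\<tau> x)) \<and>
     (\<forall>f\<in>Arr X. FA T f \<cdot>\<^bsub>M\<^esub> \<tau> (Dom X f) = \<tau> (Cod X f) \<cdot>\<^bsub>M\<^esub> FA S f)"

text \<open>\<open>l : (Y, K) \<rightarrow> (X, F)\<close> is left adjoint to \<open>r : (X, F) \<rightarrow> (Y, K)\<close> with unit \<open>\<eta>\<close> and counit \<open>\<epsilon>\<close>.\<close>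

definition fib_adjunction ::
  "('c, 'd) cat \<Rightarrow> ('o, 'a) cat \<Rightarrow> ('o, 'a, 'c, 'd) func \<Rightarrow> ('p, 'b) cat \<Rightarrow> ('p, 'b, 'c, 'd) func \<Rightarrow>
   ('p, 'b, 'o, 'a) func \<Rightarrow> ('o, 'a, 'p, 'b) func \<Rightarrow> ('p \<Rightarrow> 'b) \<Rightarrow> ('o \<Rightarrow> 'a) \<Rightarrow> bool" where
  "fib_adjunction A X F Y K l r \<eta> \<epsilon> \<longleftrightarrow>
     fib_1cell A Y K X F l \<and> fib_1cell A X F Y K r \<and>
     fib_2cell A Y K Y K id_func (r \<bullet> l) \<eta> \<and>
     fib_2cell A X F X F (l \<bullet> r) id_func \<epsilon> \<and>
     (\<forall>y\<in>Obj Y. \<epsilon> (FO l y) \<cdot>\<^bsub>X\<^esub> FA l (\<eta> y) = Ide X (FO l y)) \<and>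
     (\<forall>x\<in>Obj X. FA r (\<epsilon> x) \<cdot>\<^bsub>Y\<^esub> \<eta> (FO r x) = Ide Y (FO r x))"

text \<open>
  The comma object \<open>S \<down> T\<close> in fibrations over \<open>A\<close> of \<open>S : (X, F) \<rightarrow> (M, G)\<close> and
  \<open>T : (Y, K) \<rightarrow> (M, G)\<close>. An arrow is a pair \<open>(\<xi>, \<mu>)\<close> tagged with its source and target objects.
  The equality \<open>F \<xi> = K \<mu>\<close> need not be imposed: it follows by applying \<open>G\<close> to the square.
\<close>

definition fib_comma ::
  "('c, 'd) cat \<Rightarrow> ('o, 'a) cat \<Rightarrow> ('o, 'a, 'c, 'd) func \<Rightarrow> ('q, 'e) cat \<Rightarrow>
   ('p, 'b) cat \<Rightarrow> ('p, 'b, 'c, 'd) func \<Rightarrow> ('o, 'a, 'p, 'b) func \<Rightarrow> ('q, 'e, 'p, 'b) func \<Rightarrow>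
   ('o \<times> 'b \<times> 'q, ('o \<times> 'b \<times> 'q) \<times> ('a \<times> 'e) \<times> ('o \<times> 'b \<times> 'q)) cat" where
  "fib_comma A X F Y M G S T =
     (let Ob = {(x, \<beta>, y). x \<in> Obj X \<and> y \<in> Obj Y \<and> \<beta> \<in> hom M (FO S x) (FO T y) \<and>
                  FA G \<beta> = Ide A (FO F x)}
      in \<lparr>Obj = Ob,
          Arr = {((x, \<beta>, y), (\<xi>, \<mu>), (x', \<beta>', y')).
                   (x, \<beta>, y) \<in> Ob \<and> (x', \<beta>', y') \<in> Ob \<and> \<xi> \<in> hom X x x' \<and> \<mu> \<in> hom Y y y' \<and>
                   \<beta>' \<cdot>\<^bsub>M\<^esub> FA S \<xi> = FA T \<mu> \<cdot>\<^bsub>M\<^esub> \<beta>},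
          Dom = (\<lambda>(s, _, _). s),
          Cod = (\<lambda>(_, _, t). t),
          Ide = (\<lambda>(x, \<beta>, y). ((x, \<beta>, y), (Ide X x, Ide Y y), (x, \<beta>, y))),
          Comp = (\<lambda>(_, (\<xi>', \<mu>'), t) (s, (\<xi>, \<mu>), _). (s, (\<xi>' \<cdot>\<^bsub>X\<^esub> \<xi>, \<mu>' \<cdot>\<^bsub>Y\<^esub> \<mu>), t))\<rparr>)"

definition fib_comma_proj ::
  "('o, 'a, 'c, 'd) func \<Rightarrow>
   ('o \<times> 'b \<times> 'q, ('o \<times> 'b \<times> 'q) \<times> ('a \<times> 'e) \<times> ('o \<times> 'b \<times> 'q), 'c, 'd) func" where
  "fib_comma_proj F = \<lparr>FO = (\<lambda>(x, _, _). FO F x), FA = (\<lambda>(_, (\<xi>, _), _). FA F \<xi>)\<rparr>"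

definition comma_canonical ::
  "('o, 'a, 'p, 'b) func \<Rightarrow>
   ('o \<times> 'a \<times> 'o, ('o \<times> 'a \<times> 'o) \<times> ('a \<times> 'a) \<times> ('o \<times> 'a \<times> 'o),
    'o \<times> 'b \<times> 'p, ('o \<times> 'b \<times> 'p) \<times> ('a \<times> 'b) \<times> ('o \<times> 'b \<times> 'p)) func" where
  "comma_canonical P =
     (let rob = (\<lambda>(x\<^sub>0, \<nu>, x\<^sub>1). (x\<^sub>0, FA P \<nu>, FO P x\<^sub>1))
      in \<lparr>FO = rob, FA = (\<lambda>(s, (\<xi>\<^sub>0, \<xi>\<^sub>1), t). (rob s, (\<xi>\<^sub>0, FA P \<xi>\<^sub>1), rob t))\<rparr>)"

definition fib_discrete_opfibration ::
  "('c, 'd) cat \<Rightarrow> ('o, 'a) cat \<Rightarrow> ('o, 'a, 'c, 'd) func \<Rightarrow> ('p, 'b) cat \<Rightarrow> ('p, 'b, 'c, 'd) func \<Rightarrow>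
   ('o, 'a, 'p, 'b) func \<Rightarrow> bool" where
  "fib_discrete_opfibration A X F M G P \<longleftrightarrow> fib_1cell A X F M G P \<and>
     (let XX = fib_comma A X F X X F id_func id_func;
          PM = fib_comma A X F M M G P id_func
      in \<exists>l \<eta> \<epsilon>.
           fib_adjunction A XX (fib_comma_proj F) PM (fib_comma_proj F) l (comma_canonical P) \<eta> \<epsilon> \<and>
           (\<forall>y\<in>Obj PM. \<eta> y = Ide PM y) \<and> (\<forall>x\<in>Obj XX. \<epsilon> x = Ide XX x))"


subsection \<open>Fiberwise opfibrations and connected components\<close>

definition fiberwise_opfibration ::
  "('c, 'd) cat \<Rightarrow> ('o, 'a) cat \<Rightarrow> ('o, 'a, 'c, 'd) func \<Rightarrow> ('p, 'b) cat \<Rightarrow> ('p, 'b, 'c, 'd) func \<Rightarrow>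
   ('o, 'a, 'p, 'b) func \<Rightarrow> bool" where
  "fiberwise_opfibration A X F M G P \<longleftrightarrow>
     (\<forall>a\<in>Obj A. opfibration (fiber X A F a) (fiber M A G a) P)"

definition zigzag :: "('o, 'a) cat \<Rightarrow> ('o \<times> 'o) set" where
  "zigzag C = {(x, y). x \<in> Obj C \<and> y \<in> Obj C \<and> equivclp (\<lambda>u v. hom C u v \<noteq> {}) x y}"

definition component :: "('o, 'a) cat \<Rightarrow> 'o \<Rightarrow> 'o set" where
  "component C x = zigzag C `` {x}"

definition components :: "('o, 'a) cat \<Rightarrow> 'o set set" where
  "components C = Obj C // zigzag C"

end

theory Submission
  imports Defs
begin

text \<open>
  The liftings that \<open>P\<close> has are only unique up to zig-zags in the fibers of \<open>P\<close>, and passing to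
  connected components makes them unique. Let \<open>v : m \<rightarrow> n\<close> be a vertical arrow of \<open>M\<close>. As \<open>P\<close> is an
  opfibration on fibers, \<open>v\<close> lifts to an arrow out of any object over \<open>m\<close>, and liftings out of objects
  of one component end in one component; this gives a function \<open>push v\<close> from the components over
  \<open>m\<close> to those over \<open>n\<close> (\<open>push_cls\<close>). Let \<open>k : m \<rightarrow> n\<close> be a cartesian arrow. Then \<open>k\<close> lifts to a cartesian
  arrow into any object over \<open>n\<close> (\<open>cartesian_lift_over\<close>), which gives a function \<open>pull k\<close> in the opposite
  direction (\<open>pull_cls\<close>). Both are functorial, and they commute with each other along squares
  \<open>k' \<cdot> v' = v \<cdot> k\<close> (\<open>beck_chevalley\<close>).

  Every arrow \<open>\<beta>\<close> of \<open>M\<close> is uniquely \<open>k \<cdot> v\<close> with \<open>v\<close> vertical and \<open>k\<close> a lifting of the split cleavage. The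
  middle term of the factorization has the components as objects, and an arrow over \<open>\<beta>\<close> from \<open>C\<close> to \<open>D\<close>
  is the fact that \<open>push v C = pull k D\<close>. Arrows compose by the Beck-Chevalley condition together with
  the splitting, which says that the chosen liftings are closed under composition (\<open>link_comp\<close>). The
  splitting also yields a cancellation property (\<open>link_cancel\<close>), by which \<open>k\<close> is cartesian as an arrow
  from \<open>pull k D\<close> to \<open>D\<close>. So there is a fibration over \<open>A\<close>, and the functors from \<open>X\<close> and to \<open>M\<close> preserve
  cartesian arrows, since they do so for these liftings.

  If \<open>\<beta>\<close> is vertical then its cartesian part is an identity and the condition becomes \<open>push \<beta> C = D\<close>.
  Hence the projection to \<open>M\<close> has unique liftings of vertical arrows. That such a 1-cell is a
  discrete opfibration holds in general (\<open>discrete_opfibration\<close>): it is faithful, and together with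
  cartesian liftings this allows whole commutative squares to be lifted (\<open>square_lift\<close>), so the canonical
  comparison of comma objects is an isomorphism over \<open>A\<close>.
\<close>

section \<open>Categories, functors and cartesian arrows\<close>

lemma homD: "f \<in> hom C x y \<Longrightarrow> f \<in> Arr C \<and> Dom C f = x \<and> Cod C f = y"
  by (simp add: hom_def)

lemma homI: "f \<in> Arr C \<Longrightarrow> f \<in> hom C (Dom C f) (Cod C f)"
  by (simp add: hom_def)

lemma hom_dom: "category C \<Longrightarrow> f \<in> hom C x y \<Longrightarrow> x \<in> Obj C"
  by (auto simp: category_def hom_def)

lemma hom_cod: "category C \<Longrightarrow> f \<in> hom C x y \<Longrightarrow> y \<in> Obj C"
  by (auto simp: category_def hom_def)

lemma ide_hom: "category C \<Longrightarrow> x \<in> Obj C \<Longrightarrow> Ide C x \<in> hom C x x"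
  by (auto simp: category_def)

lemma comp_hom: "category C \<Longrightarrow> f \<in> hom C x y \<Longrightarrow> g \<in> hom C y z \<Longrightarrow> g \<cdot>\<^bsub>C\<^esub> f \<in> hom C x z"
  by (auto simp: category_def hom_def)

lemma comp_ide: "category C \<Longrightarrow> f \<in> hom C x y \<Longrightarrow> f \<cdot>\<^bsub>C\<^esub> Ide C x = f"
  by (auto simp: category_def hom_def)

lemma ide_comp: "category C \<Longrightarrow> f \<in> hom C x y \<Longrightarrow> Ide C y \<cdot>\<^bsub>C\<^esub> f = f"
  by (auto simp: category_def hom_def)

lemma comp_assoc:
  "category C \<Longrightarrow> f \<in> hom C x y \<Longrightarrow> g \<in> hom C y z \<Longrightarrow> h \<in> hom C z w \<Longrightarrow>
    h \<cdot>\<^bsub>C\<^esub> (g \<cdot>\<^bsub>C\<^esub> f) = (h \<cdot>\<^bsub>C\<^esub> g) \<cdot>\<^bsub>C\<^esub> f"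
  by (auto simp: category_def hom_def)

lemma categoryI:
  assumes "\<And>f. f \<in> Arr C \<Longrightarrow> Dom C f \<in> Obj C \<and> Cod C f \<in> Obj C"
    and "\<And>x. x \<in> Obj C \<Longrightarrow> Ide C x \<in> hom C x x"
    and "\<And>f g x y z. f \<in> hom C x y \<Longrightarrow> g \<in> hom C y z \<Longrightarrow> g \<cdot>\<^bsub>C\<^esub> f \<in> hom C x z"
    and "\<And>f x y. f \<in> hom C x y \<Longrightarrow> f \<cdot>\<^bsub>C\<^esub> Ide C x = f \<and> Ide C y \<cdot>\<^bsub>C\<^esub> f = f"
    and "\<And>f g h x y z w. f \<in> hom C x y \<Longrightarrow> g \<in> hom C y z \<Longrightarrow> h \<in> hom C z w \<Longrightarrow>
      h \<cdot>\<^bsub>C\<^esub> (g \<cdot>\<^bsub>C\<^esub> f) = (h \<cdot>\<^bsub>C\<^esub> g) \<cdot>\<^bsub>C\<^esub> f"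
  shows "category C"
  unfolding category_def using assms by (auto simp: hom_def)

lemma functor_cat: "is_functor C D F \<Longrightarrow> category C \<and> category D"
  by (simp add: is_functor_def)

lemma functor_obj: "is_functor C D F \<Longrightarrow> x \<in> Obj C \<Longrightarrow> FO F x \<in> Obj D"
  by (simp add: is_functor_def)

lemma functor_hom: "is_functor C D F \<Longrightarrow> f \<in> hom C x y \<Longrightarrow> FA F f \<in> hom D (FO F x) (FO F y)"
  by (auto simp: is_functor_def hom_def)

lemma functor_ide: "is_functor C D F \<Longrightarrow> x \<in> Obj C \<Longrightarrow> FA F (Ide C x) = Ide D (FO F x)"
  by (simp add: is_functor_def)

lemma functor_comp: "is_functor C D F \<Longrightarrow> f \<in> hom C x y \<Longrightarrow> g \<in> hom C y z \<Longrightarrow>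
    FA F (g \<cdot>\<^bsub>C\<^esub> f) = FA F g \<cdot>\<^bsub>D\<^esub> FA F f"
  by (auto simp: is_functor_def hom_def)

lemma functorI:
  assumes "category C" "category D"
    and "\<And>x. x \<in> Obj C \<Longrightarrow> FO F x \<in> Obj D"
    and "\<And>f x y. f \<in> hom C x y \<Longrightarrow> FA F f \<in> hom D (FO F x) (FO F y)"
    and "\<And>x. x \<in> Obj C \<Longrightarrow> FA F (Ide C x) = Ide D (FO F x)"
    and "\<And>f g x y z. f \<in> hom C x y \<Longrightarrow> g \<in> hom C y z \<Longrightarrow>
      FA F (g \<cdot>\<^bsub>C\<^esub> f) = FA F g \<cdot>\<^bsub>D\<^esub> FA F f"
  shows "is_functor C D F"
  unfolding is_functor_def using assms by (auto simp: hom_def)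

lemma is_functor_id: "category C \<Longrightarrow> is_functor C C id_func"
  by (auto simp: is_functor_def id_func_def hom_def category_def)

lemma is_functor_comp:
  assumes F: "is_functor C D F" and G: "is_functor D E G"
  shows "is_functor C E (G \<bullet> F)"
proof (rule functorI)
  show "category C" "category E"
    using F G by (auto dest: functor_cat)
next
  fix f g x y z
  assume f: "f \<in> hom C x y" and g: "g \<in> hom C y z"
  show "FA (G \<bullet> F) (g \<cdot>\<^bsub>C\<^esub> f) = FA (G \<bullet> F) g \<cdot>\<^bsub>E\<^esub> FA (G \<bullet> F) f"
    using functor_comp[OF F f g] functor_comp[OF G functor_hom[OF F f] functor_hom[OF F g]]
    by (simp add: comp_func_def)
next
  fix f x y assume "f \<in> hom C x y"
  then show "FA (G \<bullet> F) f \<in> hom E (FO (G \<bullet> F) x) (FO (G \<bullet> F) y)"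
    using functor_hom[OF G functor_hom[OF F]] by (simp add: comp_func_def)
qed (simp_all add: comp_func_def functor_obj[OF F] functor_obj[OF G] functor_ide[OF F] functor_ide[OF G])

lemma func_eq_obj: "func_eq X (G \<bullet> P) F \<Longrightarrow> x \<in> Obj X \<Longrightarrow> FO G (FO P x) = FO F x"
  by (simp add: func_eq_def comp_func_def)

lemma func_eq_arr: "func_eq X (G \<bullet> P) F \<Longrightarrow> f \<in> hom X x y \<Longrightarrow> FA G (FA P f) = FA F f"
  by (simp add: func_eq_def comp_func_def hom_def)

lemma cartesian_arr: "cartesian C A F f \<Longrightarrow> f \<in> hom C (Dom C f) (Cod C f)"
  by (simp add: cartesian_def hom_def)

lemma cartesianI:
  assumes f: "f \<in> hom C y z"
    and ex: "\<And>x g \<alpha>. g \<in> hom C x z \<Longrightarrow> \<alpha> \<in> hom A (FO F x) (FO F y) \<Longrightarrow>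
      FA F f \<cdot>\<^bsub>A\<^esub> \<alpha> = FA F g \<Longrightarrow> \<exists>h. h \<in> hom C x y \<and> f \<cdot>\<^bsub>C\<^esub> h = g \<and> FA F h = \<alpha>"
    and un: "\<And>x h h'. h \<in> hom C x y \<Longrightarrow> h' \<in> hom C x y \<Longrightarrow>
      f \<cdot>\<^bsub>C\<^esub> h = f \<cdot>\<^bsub>C\<^esub> h' \<Longrightarrow> FA F h = FA F h' \<Longrightarrow> h = h'"
  shows "cartesian C A F f"
  unfolding cartesian_def
proof (intro conjI ballI impI)
  fix g \<alpha>
  assume "g \<in> Arr C" "\<alpha> \<in> hom A (FO F (Dom C g)) (FO F (Dom C f))" "Cod C g = Cod C f"
    "FA F f \<cdot>\<^bsub>A\<^esub> \<alpha> = FA F g"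
  then have "\<exists>h. h \<in> hom C (Dom C g) y \<and> f \<cdot>\<^bsub>C\<^esub> h = g \<and> FA F h = \<alpha>"
    using ex[of g "Dom C g" \<alpha>] homD[OF f] by (simp add: hom_def)
  then obtain h where h: "h \<in> hom C (Dom C g) y" "f \<cdot>\<^bsub>C\<^esub> h = g" "FA F h = \<alpha>" by blast
  have Df: "Dom C f = y" using homD[OF f] by simp
  show "\<exists>!h. h \<in> hom C (Dom C g) (Dom C f) \<and> f \<cdot>\<^bsub>C\<^esub> h = g \<and> FA F h = \<alpha>"
    unfolding Df
  proof (intro ex1I)
    show "h \<in> hom C (Dom C g) y \<and> f \<cdot>\<^bsub>C\<^esub> h = g \<and> FA F h = \<alpha>" using h by blast
    fix k assume "k \<in> hom C (Dom C g) y \<and> f \<cdot>\<^bsub>C\<^esub> k = g \<and> FA F k = \<alpha>"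
    then show "k = h" using un[of k "Dom C g" h] h by simp
  qed
qed (use homD[OF f] in simp)

lemma cartesian_ex1:
  assumes c: "cartesian C A F f" and f: "f \<in> hom C y z" and g: "g \<in> hom C x z"
    and \<alpha>: "\<alpha> \<in> hom A (FO F x) (FO F y)" "FA F f \<cdot>\<^bsub>A\<^esub> \<alpha> = FA F g"
  shows "\<exists>!h. h \<in> hom C x y \<and> f \<cdot>\<^bsub>C\<^esub> h = g \<and> FA F h = \<alpha>"
proof -
  have d: "Dom C f = y" "Cod C f = z" "g \<in> Arr C" "Dom C g = x" "Cod C g = z"
    using homD[OF f] homD[OF g] by simp_all
  from c have "\<forall>g\<in>Arr C. \<forall>\<alpha>\<in>hom A (FO F (Dom C g)) (FO F (Dom C f)).
        Cod C g = Cod C f \<longrightarrow> FA F f \<cdot>\<^bsub>A\<^esub> \<alpha> = FA F g \<longrightarrow>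
        (\<exists>!h. h \<in> hom C (Dom C g) (Dom C f) \<and> f \<cdot>\<^bsub>C\<^esub> h = g \<and> FA F h = \<alpha>)"
    unfolding cartesian_def by (rule conjunct2)
  from bspec[OF this d(3), unfolded d, THEN bspec, OF \<alpha>(1)] \<alpha>(2) show ?thesis by iprover
qed

lemma cartesian_lift:
  assumes "cartesian C A F f" "f \<in> hom C y z" "g \<in> hom C x z"
    "\<alpha> \<in> hom A (FO F x) (FO F y)" "FA F f \<cdot>\<^bsub>A\<^esub> \<alpha> = FA F g"
  obtains h where "h \<in> hom C x y" "f \<cdot>\<^bsub>C\<^esub> h = g" "FA F h = \<alpha>"
  using cartesian_ex1[OF assms] by blast

lemma cartesian_unique:
  assumes F: "is_functor C A F" and c: "cartesian C A F f" and f: "f \<in> hom C y z"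
    and h: "h \<in> hom C x y" and h': "h' \<in> hom C x y"
    and eq: "f \<cdot>\<^bsub>C\<^esub> h = f \<cdot>\<^bsub>C\<^esub> h'" "FA F h = FA F h'"
  shows "h = h'"
proof -
  let ?g = "f \<cdot>\<^bsub>C\<^esub> h" and ?\<alpha> = "FA F h"
  have C: "category C" using F by (simp add: is_functor_def)
  have g: "?g \<in> hom C x z" using comp_hom[OF C h f] .
  have "FA F f \<cdot>\<^bsub>A\<^esub> ?\<alpha> = FA F ?g" using functor_comp[OF F h f] by simp
  then have "\<exists>!k. k \<in> hom C x y \<and> f \<cdot>\<^bsub>C\<^esub> k = ?g \<and> FA F k = ?\<alpha>"
    using cartesian_ex1[OF c f g functor_hom[OF F h]] by simp
  then show ?thesis using h h' eq by metis
qed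

lemma cartesian_comp_iso:
  assumes F: "is_functor C A F" and c: "cartesian C A F f" and f: "f \<in> hom C y z"
    and i: "i \<in> hom C w y" and j: "j \<in> hom C y w"
    and ij: "i \<cdot>\<^bsub>C\<^esub> j = Ide C y" and ji: "j \<cdot>\<^bsub>C\<^esub> i = Ide C w"
  shows "cartesian C A F (f \<cdot>\<^bsub>C\<^esub> i)"
proof (rule cartesianI)
  note C = functor_cat[OF F, THEN conjunct1] and A = functor_cat[OF F, THEN conjunct2]
  show "f \<cdot>\<^bsub>C\<^esub> i \<in> hom C w z" using comp_hom[OF C i f] .
  fix x g \<alpha>
  assume g: "g \<in> hom C x z" and \<alpha>: "\<alpha> \<in> hom A (FO F x) (FO F w)"
    and eq: "FA F (f \<cdot>\<^bsub>C\<^esub> i) \<cdot>\<^bsub>A\<^esub> \<alpha> = FA F g"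
  note Fi = functor_hom[OF F i] and Fj = functor_hom[OF F j] and Ff = functor_hom[OF F f]
  have "FA F f \<cdot>\<^bsub>A\<^esub> (FA F i \<cdot>\<^bsub>A\<^esub> \<alpha>) = FA F g"
    using eq functor_comp[OF F i f] comp_assoc[OF A \<alpha> Fi Ff] by simp
  then obtain h where h: "h \<in> hom C x y" "f \<cdot>\<^bsub>C\<^esub> h = g" "FA F h = FA F i \<cdot>\<^bsub>A\<^esub> \<alpha>"
    using cartesian_lift[OF c f g comp_hom[OF A \<alpha> Fi]] by blast
  have jh: "j \<cdot>\<^bsub>C\<^esub> h \<in> hom C x w" using comp_hom[OF C h(1) j] .
  have "(f \<cdot>\<^bsub>C\<^esub> i) \<cdot>\<^bsub>C\<^esub> (j \<cdot>\<^bsub>C\<^esub> h) = f \<cdot>\<^bsub>C\<^esub> ((i \<cdot>\<^bsub>C\<^esub> j) \<cdot>\<^bsub>C\<^esub> h)"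
    using comp_assoc[OF C jh i f] comp_assoc[OF C h(1) j i] by simp
  then have 1: "(f \<cdot>\<^bsub>C\<^esub> i) \<cdot>\<^bsub>C\<^esub> (j \<cdot>\<^bsub>C\<^esub> h) = g"
    using ij ide_comp[OF C h(1)] h(2) by simp
  have "FA F (j \<cdot>\<^bsub>C\<^esub> h) = FA F (j \<cdot>\<^bsub>C\<^esub> i) \<cdot>\<^bsub>A\<^esub> \<alpha>"
    using functor_comp[OF F h(1) j] functor_comp[OF F i j] h(3) comp_assoc[OF A \<alpha> Fi Fj] by simp
  then have "FA F (j \<cdot>\<^bsub>C\<^esub> h) = \<alpha>"
    using ji functor_ide[OF F hom_dom[OF C i]] ide_comp[OF A \<alpha>] by simp
  with 1 jh show "\<exists>h. h \<in> hom C x w \<and> (f \<cdot>\<^bsub>C\<^esub> i) \<cdot>\<^bsub>C\<^esub> h = g \<and> FA F h = \<alpha>" by blast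
next
  note C = functor_cat[OF F, THEN conjunct1] and A = functor_cat[OF F, THEN conjunct2]
  fix x h h'
  assume h: "h \<in> hom C x w" and h': "h' \<in> hom C x w"
    and eq: "(f \<cdot>\<^bsub>C\<^esub> i) \<cdot>\<^bsub>C\<^esub> h = (f \<cdot>\<^bsub>C\<^esub> i) \<cdot>\<^bsub>C\<^esub> h'" "FA F h = FA F h'"
  have "f \<cdot>\<^bsub>C\<^esub> (i \<cdot>\<^bsub>C\<^esub> h) = f \<cdot>\<^bsub>C\<^esub> (i \<cdot>\<^bsub>C\<^esub> h')"
    using eq comp_assoc[OF C h i f] comp_assoc[OF C h' i f] by simp
  moreover have "FA F (i \<cdot>\<^bsub>C\<^esub> h) = FA F (i \<cdot>\<^bsub>C\<^esub> h')"
    using eq functor_comp[OF F h i] functor_comp[OF F h' i] by simp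
  ultimately have "i \<cdot>\<^bsub>C\<^esub> h = i \<cdot>\<^bsub>C\<^esub> h'"
    using cartesian_unique[OF F c f comp_hom[OF C h i] comp_hom[OF C h' i]] by blast
  then have "j \<cdot>\<^bsub>C\<^esub> (i \<cdot>\<^bsub>C\<^esub> h) = j \<cdot>\<^bsub>C\<^esub> (i \<cdot>\<^bsub>C\<^esub> h')" by simp
  then show "h = h'"
    using comp_assoc[OF C h i j] comp_assoc[OF C h' i j] ji ide_comp[OF C h] ide_comp[OF C h'] by simp
qed

lemma cartesian_comp:
  assumes F: "is_functor C A F" and c: "cartesian C A F f" and f: "f \<in> hom C y z"
    and d: "cartesian C A F k" and k: "k \<in> hom C w y"
  shows "cartesian C A F (f \<cdot>\<^bsub>C\<^esub> k)"
proof (rule cartesianI)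
  note C = functor_cat[OF F, THEN conjunct1] and A = functor_cat[OF F, THEN conjunct2]
  show "f \<cdot>\<^bsub>C\<^esub> k \<in> hom C w z" using comp_hom[OF C k f] .
  fix x g \<alpha>
  assume g: "g \<in> hom C x z" and \<alpha>: "\<alpha> \<in> hom A (FO F x) (FO F w)"
    and eq: "FA F (f \<cdot>\<^bsub>C\<^esub> k) \<cdot>\<^bsub>A\<^esub> \<alpha> = FA F g"
  note Fk = functor_hom[OF F k] and Ff = functor_hom[OF F f]
  have "FA F f \<cdot>\<^bsub>A\<^esub> (FA F k \<cdot>\<^bsub>A\<^esub> \<alpha>) = FA F g"
    using eq functor_comp[OF F k f] comp_assoc[OF A \<alpha> Fk Ff] by simp
  then obtain h where h: "h \<in> hom C x y" "f \<cdot>\<^bsub>C\<^esub> h = g" "FA F k \<cdot>\<^bsub>A\<^esub> \<alpha> = FA F h"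
    using cartesian_lift[OF c f g comp_hom[OF A \<alpha> Fk]] by metis
  obtain h' where h': "h' \<in> hom C x w" "k \<cdot>\<^bsub>C\<^esub> h' = h" "FA F h' = \<alpha>"
    using cartesian_lift[OF d k h(1) \<alpha> h(3)] by blast
  have "(f \<cdot>\<^bsub>C\<^esub> k) \<cdot>\<^bsub>C\<^esub> h' = g"
    using comp_assoc[OF C h'(1) k f] h h' by simp
  with h' show "\<exists>h. h \<in> hom C x w \<and> (f \<cdot>\<^bsub>C\<^esub> k) \<cdot>\<^bsub>C\<^esub> h = g \<and> FA F h = \<alpha>" by blast
next
  note C = functor_cat[OF F, THEN conjunct1]
  fix x h h'
  assume h: "h \<in> hom C x w" and h': "h' \<in> hom C x w"
    and eq: "(f \<cdot>\<^bsub>C\<^esub> k) \<cdot>\<^bsub>C\<^esub> h = (f \<cdot>\<^bsub>C\<^esub> k) \<cdot>\<^bsub>C\<^esub> h'" "FA F h = FA F h'"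
  have "f \<cdot>\<^bsub>C\<^esub> (k \<cdot>\<^bsub>C\<^esub> h) = f \<cdot>\<^bsub>C\<^esub> (k \<cdot>\<^bsub>C\<^esub> h')"
    using eq comp_assoc[OF C h k f] comp_assoc[OF C h' k f] by simp
  moreover have "FA F (k \<cdot>\<^bsub>C\<^esub> h) = FA F (k \<cdot>\<^bsub>C\<^esub> h')"
    using eq functor_comp[OF F h k] functor_comp[OF F h' k] by simp
  ultimately have "k \<cdot>\<^bsub>C\<^esub> h = k \<cdot>\<^bsub>C\<^esub> h'"
    using cartesian_unique[OF F c f comp_hom[OF C h k] comp_hom[OF C h' k]] by blast
  then show "h = h'" using cartesian_unique[OF F d k h h' _ eq(2)] by blast
qed

lemma cartesian_comparison:
  assumes F: "is_functor C A F" and c: "cartesian C A F f" and f: "f \<in> hom C y z"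
    and d: "cartesian C A F k" and k: "k \<in> hom C w z" and eq: "FA F f = FA F k"
  obtains i j where "i \<in> hom C w y" "j \<in> hom C y w" "i \<cdot>\<^bsub>C\<^esub> j = Ide C y" "j \<cdot>\<^bsub>C\<^esub> i = Ide C w"
    "f \<cdot>\<^bsub>C\<^esub> i = k" "k \<cdot>\<^bsub>C\<^esub> j = f" "FA F i = Ide A (FO F y)" "FA F j = Ide A (FO F y)"
proof -
  note C = functor_cat[OF F, THEN conjunct1] and A = functor_cat[OF F, THEN conjunct2]
  note Fk = functor_hom[OF F k] and Ff = functor_hom[OF F f]
  note y = hom_dom[OF C f] and w = hom_dom[OF C k]
  have o: "FO F w = FO F y" using homD[OF Ff] homD[OF Fk] eq by simp
  note I = ide_hom[OF A functor_obj[OF F y]]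
  obtain i where i: "i \<in> hom C w y" "f \<cdot>\<^bsub>C\<^esub> i = k" "FA F i = Ide A (FO F y)"
    using cartesian_lift[OF c f k, of "Ide A (FO F y)"] o I eq comp_ide[OF A Ff] by auto
  obtain j where j: "j \<in> hom C y w" "k \<cdot>\<^bsub>C\<^esub> j = f" "FA F j = Ide A (FO F y)"
    using cartesian_lift[OF d k f, of "Ide A (FO F y)"] o I eq comp_ide[OF A Ff] by auto
  have "i \<cdot>\<^bsub>C\<^esub> j = Ide C y"
  proof (rule cartesian_unique[OF F c f comp_hom[OF C j(1) i(1)] ide_hom[OF C y]])
    show "f \<cdot>\<^bsub>C\<^esub> (i \<cdot>\<^bsub>C\<^esub> j) = f \<cdot>\<^bsub>C\<^esub> Ide C y"
      using comp_assoc[OF C j(1) i(1) f] i j comp_ide[OF C f] by simp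
    show "FA F (i \<cdot>\<^bsub>C\<^esub> j) = FA F (Ide C y)"
      using functor_comp[OF F j(1) i(1)] i j functor_ide[OF F y] comp_ide[OF A I] by simp
  qed
  moreover have "j \<cdot>\<^bsub>C\<^esub> i = Ide C w"
  proof (rule cartesian_unique[OF F d k comp_hom[OF C i(1) j(1)] ide_hom[OF C w]])
    show "k \<cdot>\<^bsub>C\<^esub> (j \<cdot>\<^bsub>C\<^esub> i) = k \<cdot>\<^bsub>C\<^esub> Ide C w"
      using comp_assoc[OF C i(1) j(1) k] i j comp_ide[OF C k] by simp
    show "FA F (j \<cdot>\<^bsub>C\<^esub> i) = FA F (Ide C w)"
      using functor_comp[OF F i(1) j(1)] i j functor_ide[OF F w] comp_ide[OF A I] o by simp
  qed
  ultimately show thesis using that[of i j] i j by blast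
qed

text \<open>
  Every cartesian arrow differs by an isomorphism from any cartesian arrow with the same codomain
  and the same image, and functors preserve isomorphisms. So one suitable lifting of each arrow
  suffices.
\<close>

lemma preserves_cartesian_if_cleavage:
  assumes F: "is_functor X A F" and G: "is_functor M A G" and P: "is_functor X M P"
    and lifts: "\<And>x \<alpha>. x \<in> Obj X \<Longrightarrow> \<alpha> \<in> Arr A \<Longrightarrow> Cod A \<alpha> = FO F x \<Longrightarrow>
      \<exists>y. \<exists>k \<in> hom X y x. cartesian X A F k \<and> FA F k = \<alpha> \<and> cartesian M A G (FA P k)"
    and c: "cartesian X A F f"
  shows "cartesian M A G (FA P f)"
proof -
  note X = functor_cat[OF F, THEN conjunct1]
  obtain y z where f: "f \<in> hom X y z" using cartesian_arr[OF c] by blast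
  note Ff = functor_hom[OF F f]
  obtain w k where k: "k \<in> hom X w z" "cartesian X A F k" "FA F k = FA F f"
    and Pk: "cartesian M A G (FA P k)"
    using lifts[OF hom_cod[OF X f], of "FA F f"] homD[OF Ff] by blast
  obtain i j where i: "i \<in> hom X w y" and j: "j \<in> hom X y w" and ij: "i \<cdot>\<^bsub>X\<^esub> j = Ide X y"
    and ji: "j \<cdot>\<^bsub>X\<^esub> i = Ide X w" and kj: "k \<cdot>\<^bsub>X\<^esub> j = f"
    using cartesian_comparison[OF F c f k(2,1)] k(3) by metis
  have "cartesian M A G (FA P k \<cdot>\<^bsub>M\<^esub> FA P j)"
  proof (rule cartesian_comp_iso[OF G Pk functor_hom[OF P k(1)] functor_hom[OF P j] functor_hom[OF P i]])
    show "FA P j \<cdot>\<^bsub>M\<^esub> FA P i = Ide M (FO P w)"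
      using functor_comp[OF P i j] ji functor_ide[OF P hom_dom[OF X i]] by simp
    show "FA P i \<cdot>\<^bsub>M\<^esub> FA P j = Ide M (FO P y)"
      using functor_comp[OF P j i] ij functor_ide[OF P hom_dom[OF X j]] by simp
  qed
  then show ?thesis using functor_comp[OF P j k(1)] kj by simp
qed

text \<open>
  A lifting problem is carried across by \<open>l\<close> and its solution back by \<open>r\<close>.
\<close>

lemma cartesian_inverse_functor:
  assumes r: "is_functor C D r" and l: "is_functor D C l"
    and lr: "func_eq C (l \<bullet> r) id_func" and rl: "func_eq D (r \<bullet> l) id_func"
    and F: "is_functor C A F" and Kr: "func_eq C (K \<bullet> r) F" and c: "cartesian C A F f"
  shows "cartesian D A K (FA r f)"
proof -
  note C = functor_cat[OF r, THEN conjunct1] and D = functor_cat[OF r, THEN conjunct2]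
  have Fl: "func_eq D (F \<bullet> l) K"
    using Kr rl functor_obj[OF l] functor_hom[OF l, OF homI]
    by (simp add: func_eq_def comp_func_def id_func_def hom_def) metis
  have lrO: "FO l (FO r x) = x" if "x \<in> Obj C" for x
    using lr that by (simp add: func_eq_def comp_func_def id_func_def)
  have lrA: "FA l (FA r g) = g" if "g \<in> hom C x y" for g x y
    using lr that by (simp add: func_eq_def comp_func_def id_func_def hom_def)
  have rlO: "FO r (FO l x) = x" if "x \<in> Obj D" for x
    using rl that by (simp add: func_eq_def comp_func_def id_func_def)
  have rlA: "FA r (FA l g) = g" if "g \<in> hom D x y" for g x y
    using rl that by (simp add: func_eq_def comp_func_def id_func_def hom_def)
  obtain y z where f: "f \<in> hom C y z" using cartesian_arr[OF c] by blast
  note y = hom_dom[OF C f] and z = hom_cod[OF C f]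
  show ?thesis
  proof (rule cartesianI)
    show rf: "FA r f \<in> hom D (FO r y) (FO r z)" using functor_hom[OF r f] .
    fix x g \<alpha>
    assume g: "g \<in> hom D x (FO r z)" and \<alpha>: "\<alpha> \<in> hom A (FO K x) (FO K (FO r y))"
      and eq: "FA K (FA r f) \<cdot>\<^bsub>A\<^esub> \<alpha> = FA K g"
    note x = hom_dom[OF D g]
    have lg: "FA l g \<in> hom C (FO l x) z" using functor_hom[OF l g] lrO[OF z] by simp
    have "\<alpha> \<in> hom A (FO F (FO l x)) (FO F y)"
      using \<alpha> func_eq_obj[OF Kr y] func_eq_obj[OF Fl x] by simp
    moreover have "FA F f \<cdot>\<^bsub>A\<^esub> \<alpha> = FA F (FA l g)"
      using eq func_eq_arr[OF Kr f] func_eq_arr[OF Fl g] by simp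
    ultimately obtain h where h: "h \<in> hom C (FO l x) y" "f \<cdot>\<^bsub>C\<^esub> h = FA l g" "FA F h = \<alpha>"
      using cartesian_lift[OF c f lg] by blast
    have "FA r h \<in> hom D x (FO r y)" using functor_hom[OF r h(1)] rlO[OF x] by simp
    moreover have "FA r f \<cdot>\<^bsub>D\<^esub> FA r h = g" using functor_comp[OF r h(1) f] h(2) rlA[OF g] by simp
    moreover have "FA K (FA r h) = \<alpha>" using func_eq_arr[OF Kr h(1)] h(3) by simp
    ultimately show "\<exists>h. h \<in> hom D x (FO r y) \<and> FA r f \<cdot>\<^bsub>D\<^esub> h = g \<and> FA K h = \<alpha>" by blast
  next
    fix x h h'
    assume h: "h \<in> hom D x (FO r y)" and h': "h' \<in> hom D x (FO r y)"
      and eq: "FA r f \<cdot>\<^bsub>D\<^esub> h = FA r f \<cdot>\<^bsub>D\<^esub> h'" "FA K h = FA K h'"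
    note x = hom_dom[OF D h] and rf = functor_hom[OF r f]
    have lh: "FA l h \<in> hom C (FO l x) y" "FA l h' \<in> hom C (FO l x) y"
      using functor_hom[OF l h] functor_hom[OF l h'] lrO[OF y] by simp_all
    have "f \<cdot>\<^bsub>C\<^esub> FA l h = f \<cdot>\<^bsub>C\<^esub> FA l h'"
      using functor_comp[OF l h rf] functor_comp[OF l h' rf] eq lrA[OF f] by simp
    moreover have "FA F (FA l h) = FA F (FA l h')"
      using func_eq_arr[OF Fl h] func_eq_arr[OF Fl h'] eq by simp
    ultimately have "FA l h = FA l h'" using cartesian_unique[OF F c f lh] by blast
    then show "h = h'" using rlA[OF h] rlA[OF h'] by metis
  qed
qed

section \<open>Fibrations over a base category\<close>

lemma fib_1cellD:
  assumes "fib_1cell A X F M G P"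
  shows "is_functor X A F" "is_functor M A G" "is_functor X M P" "func_eq X (G \<bullet> P) F"
    "cartesian X A F f \<Longrightarrow> cartesian M A G (FA P f)"
  using assms by (auto simp: fib_1cell_def fibration_def)

lemma fib_1cell_id: "fibration X A F \<Longrightarrow> fib_1cell A X F X F id_func"
  unfolding fib_1cell_def fibration_def
  by (auto simp: func_eq_def comp_func_def id_func_def is_functor_id[unfolded id_func_def]
      dest: functor_cat)

lemma fib_1cell_comp:
  assumes P: "fib_1cell A X F M G P" and R: "fib_1cell A M G N H R"
  shows "fib_1cell A X F N H (R \<bullet> P)"
proof -
  have "func_eq X (H \<bullet> (R \<bullet> P)) F"
    using fib_1cellD(4)[OF P] fib_1cellD(4)[OF R] fib_1cellD(3)[OF P]
    by (simp add: func_eq_def comp_func_def is_functor_def hom_def)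
  then show ?thesis
    using P R is_functor_comp[OF fib_1cellD(3)[OF P] fib_1cellD(3)[OF R]]
    by (auto simp: fib_1cell_def comp_func_def)
qed

lemma fibration_lift:
  assumes "fibration X A F" "x \<in> Obj X" "\<alpha> \<in> hom A a (FO F x)"
  obtains y f where "f \<in> hom X y x" "cartesian X A F f" "FA F f = \<alpha>" "FO F y = a"
proof -
  obtain \<kappa> where "cleavage X A F \<kappa>" using assms(1) unfolding fibration_def by blast
  then have k: "cartesian X A F (\<kappa> x \<alpha>)" "Cod X (\<kappa> x \<alpha>) = x" "FA F (\<kappa> x \<alpha>) = \<alpha>"
    using assms(2,3) by (auto simp: cleavage_def hom_def)
  then have h: "\<kappa> x \<alpha> \<in> hom X (Dom X (\<kappa> x \<alpha>)) x" using cartesian_arr by metis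
  have F: "is_functor X A F" using assms(1) by (simp add: fibration_def)
  have "FO F (Dom X (\<kappa> x \<alpha>)) = a" using functor_hom[OF F h] k(3) assms(3) by (simp add: hom_def)
  with that h k show thesis by blast
qed

lemma fibrationI:
  assumes F: "is_functor X A F"
    and "\<And>x \<alpha>. x \<in> Obj X \<Longrightarrow> \<alpha> \<in> Arr A \<Longrightarrow> Cod A \<alpha> = FO F x \<Longrightarrow>
      \<exists>f y. f \<in> hom X y x \<and> cartesian X A F f \<and> FA F f = \<alpha>"
  shows "fibration X A F"
proof -
  have "\<forall>x \<alpha>. \<exists>f. x \<in> Obj X \<longrightarrow> \<alpha> \<in> Arr A \<longrightarrow> Cod A \<alpha> = FO F x \<longrightarrow>
      cartesian X A F f \<and> Cod X f = x \<and> FA F f = \<alpha>"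
    using assms(2) unfolding hom_def by blast
  then obtain \<kappa> where "\<And>x \<alpha>. x \<in> Obj X \<Longrightarrow> \<alpha> \<in> Arr A \<Longrightarrow> Cod A \<alpha> = FO F x \<Longrightarrow>
      cartesian X A F (\<kappa> x \<alpha>) \<and> Cod X (\<kappa> x \<alpha>) = x \<and> FA F (\<kappa> x \<alpha>) = \<alpha>"
    by metis
  then have "cleavage X A F \<kappa>" by (simp add: cleavage_def)
  with F show ?thesis by (auto simp: fibration_def)
qed

lemma ide_vertical:
  assumes F: "is_functor X A F" and x: "x \<in> Obj X"
  shows "vertical X A F (Ide X x)"
  using functor_ide[OF F x] functor_obj[OF F x] ide_hom[OF functor_cat[OF F, THEN conjunct1] x]
  by (auto simp: vertical_def hom_def)

lemma identity_2cell:
  assumes S: "fib_1cell A X F X F S" and T: "fib_1cell A X F X F T"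
    and eS: "func_eq X S id_func" and eT: "func_eq X T id_func"
  shows "fib_2cell A X F X F S T (Ide X)"
  unfolding fib_2cell_def
proof (intro conjI ballI)
  note F = fib_1cellD(1)[OF S] and X = functor_cat[OF fib_1cellD(1)[OF S], THEN conjunct1]
  have eq: "\<And>x. x \<in> Obj X \<Longrightarrow> FO S x = x \<and> FO T x = x" "\<And>f. f \<in> Arr X \<Longrightarrow> FA S f = f \<and> FA T f = f"
    using eS eT by (auto simp: func_eq_def id_func_def)
  show "Ide X x \<in> hom X (FO S x) (FO T x)" if "x \<in> Obj X" for x
    using eq that ide_hom[OF X] by simp
  show "vertical X A F (Ide X x)" if "x \<in> Obj X" for x
    using ide_vertical[OF F that] .
  show "FA T f \<cdot>\<^bsub>X\<^esub> Ide X (Dom X f) = Ide X (Cod X f) \<cdot>\<^bsub>X\<^esub> FA S f" if "f \<in> Arr X" for f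
    using comp_ide[OF X homI[OF that]] ide_comp[OF X homI[OF that]] eq(2)[OF that] by simp
qed (use S T in auto)

text \<open>
  Mutually inverse functors over \<open>A\<close> preserve cartesian arrows automatically. So an
  isomorphism of categories over \<open>A\<close> is already an adjunction between fibrations, with identities
  as unit and counit.
\<close>

lemma isomorphism_adjunction:
  assumes F: "fibration X A F" and K: "fibration Y A K"
    and r: "is_functor X Y r" and l: "is_functor Y X l"
    and lr: "func_eq X (l \<bullet> r) id_func" and rl: "func_eq Y (r \<bullet> l) id_func"
    and Kr: "func_eq X (K \<bullet> r) F"
  shows "fib_adjunction A X F Y K l r (Ide Y) (Ide X)"
proof -
  have fF: "is_functor X A F" and fK: "is_functor Y A K"
    using F K by (simp_all add: fibration_def)
  note X = functor_cat[OF fF, THEN conjunct1] and Y = functor_cat[OF fK, THEN conjunct1]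
  have rlO: "FO r (FO l y) = y" if "y \<in> Obj Y" for y
    using rl that by (simp add: func_eq_def comp_func_def id_func_def)
  have rlA: "FA r (FA l g) = g" if "g \<in> Arr Y" for g
    using rl that by (simp add: func_eq_def comp_func_def id_func_def)
  have Fl: "func_eq Y (F \<bullet> l) K"
    unfolding func_eq_def
  proof (intro conjI ballI)
    fix y assume y: "y \<in> Obj Y"
    show "FO (F \<bullet> l) y = FO K y"
      using func_eq_obj[OF Kr functor_obj[OF l y]] rlO[OF y] by (simp add: comp_func_def)
  next
    fix g assume g: "g \<in> Arr Y"
    show "FA (F \<bullet> l) g = FA K g"
      using func_eq_arr[OF Kr functor_hom[OF l homI[OF g]]] rlA[OF g] by (simp add: comp_func_def)
  qed
  have r1: "fib_1cell A X F Y K r"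
    unfolding fib_1cell_def using F K r Kr cartesian_inverse_functor[OF r l lr rl fF Kr] by blast
  have l1: "fib_1cell A Y K X F l"
    unfolding fib_1cell_def using F K l Fl cartesian_inverse_functor[OF l r rl lr fK Fl] by blast
  have ie: "func_eq C id_func id_func" for C :: "('x, 'y) cat"
    by (simp add: func_eq_def)
  have "fib_2cell A Y K Y K id_func (r \<bullet> l) (Ide Y)"
    by (rule identity_2cell[OF fib_1cell_id[OF K] fib_1cell_comp[OF l1 r1] ie rl])
  moreover have "fib_2cell A X F X F (l \<bullet> r) id_func (Ide X)"
    by (rule identity_2cell[OF fib_1cell_comp[OF r1 l1] fib_1cell_id[OF F] lr ie])
  moreover have "Ide X (FO l y) \<cdot>\<^bsub>X\<^esub> FA l (Ide Y y) = Ide X (FO l y)" if "y \<in> Obj Y" for y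
    using functor_ide[OF l that] comp_ide[OF X ide_hom[OF X functor_obj[OF l that]]] by simp
  moreover have "FA r (Ide X x) \<cdot>\<^bsub>Y\<^esub> Ide Y (FO r x) = Ide Y (FO r x)" if "x \<in> Obj X" for x
    using functor_ide[OF r that] comp_ide[OF Y ide_hom[OF Y functor_obj[OF r that]]] by simp
  ultimately show ?thesis using r1 l1 unfolding fib_adjunction_def by blast
qed

section \<open>Comma objects of fibrations\<close>

locale comma_of_1cells =
  fixes A :: "('c, 'd) cat"
    and X :: "('o, 'a) cat" and F :: "('o, 'a, 'c, 'd) func"
    and Y :: "('q, 'e) cat" and K :: "('q, 'e, 'c, 'd) func"
    and M :: "('p, 'b) cat" and G :: "('p, 'b, 'c, 'd) func"
    and S :: "('o, 'a, 'p, 'b) func" and T :: "('q, 'e, 'p, 'b) func"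
  assumes S: "fib_1cell A X F M G S" and T: "fib_1cell A Y K M G T"
begin

abbreviation "comma \<equiv> fib_comma A X F Y M G S T"

lemma comma_obj:
  "(x, \<beta>, y) \<in> Obj comma \<longleftrightarrow>
    x \<in> Obj X \<and> y \<in> Obj Y \<and> \<beta> \<in> hom M (FO S x) (FO T y) \<and> FA G \<beta> = Ide A (FO F x)"
  by (simp add: fib_comma_def Let_def)

lemma comma_hom:
  "(s, (\<xi>, \<mu>), t) \<in> hom comma (x, \<beta>, y) (x', \<beta>', y') \<longleftrightarrow>
    s = (x, \<beta>, y) \<and> t = (x', \<beta>', y') \<and> (x, \<beta>, y) \<in> Obj comma \<and> (x', \<beta>', y') \<in> Obj comma \<and>
    \<xi> \<in> hom X x x' \<and> \<mu> \<in> hom Y y y' \<and> \<beta>' \<cdot>\<^bsub>M\<^esub> FA S \<xi> = FA T \<mu> \<cdot>\<^bsub>M\<^esub> \<beta>"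
  by (auto simp: fib_comma_def Let_def hom_def)

lemma comma_homE:
  assumes "u \<in> hom comma (x, \<beta>, y) (x', \<beta>', y')"
  obtains \<xi> \<mu> where "u = ((x, \<beta>, y), (\<xi>, \<mu>), (x', \<beta>', y'))"
    "(x, \<beta>, y) \<in> Obj comma" "(x', \<beta>', y') \<in> Obj comma" "\<xi> \<in> hom X x x'" "\<mu> \<in> hom Y y y'"
    "\<beta>' \<cdot>\<^bsub>M\<^esub> FA S \<xi> = FA T \<mu> \<cdot>\<^bsub>M\<^esub> \<beta>"
proof -
  obtain s \<xi> \<mu> t where u: "u = (s, (\<xi>, \<mu>), t)" by (metis prod.exhaust)
  show thesis using that[of \<xi> \<mu>] assms[unfolded u comma_hom] u by simp
qed

lemma comma_comp: "(s', (\<xi>', \<mu>'), t) \<cdot>\<^bsub>comma\<^esub> (s, (\<xi>, \<mu>), t') = (s, (\<xi>' \<cdot>\<^bsub>X\<^esub> \<xi>, \<mu>' \<cdot>\<^bsub>Y\<^esub> \<mu>), t)"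
  by (simp add: fib_comma_def Let_def)

lemma comma_ide: "Ide comma (x, \<beta>, y) = ((x, \<beta>, y), (Ide X x, Ide Y y), (x, \<beta>, y))"
  by (simp add: fib_comma_def Let_def)

lemma comma_proj: "FO (fib_comma_proj F) (x, \<beta>, y) = FO F x"
  "FA (fib_comma_proj F) (s, (\<xi>, \<mu>), t) = FA F \<xi>"
  by (simp_all add: fib_comma_proj_def)

lemmas functor_F = fib_1cellD(1)[OF S] and functor_K = fib_1cellD(1)[OF T] and functor_G = fib_1cellD(2)[OF S]
  and functor_S = fib_1cellD(3)[OF S] and functor_T = fib_1cellD(3)[OF T]
lemmas category_X = functor_cat[OF functor_F, THEN conjunct1] and category_A = functor_cat[OF functor_F, THEN conjunct2]
  and category_Y = functor_cat[OF functor_K, THEN conjunct1] and category_M = functor_cat[OF functor_G, THEN conjunct1]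

lemma category_comma: "category comma"
proof (rule categoryI)
  fix f assume "f \<in> Arr comma"
  then show "Dom comma f \<in> Obj comma \<and> Cod comma f \<in> Obj comma"
    by (auto simp: fib_comma_def Let_def)
next
  fix s assume s: "s \<in> Obj comma"
  obtain x \<beta> y where "s = (x, \<beta>, y)" by (metis prod.exhaust)
  then show "Ide comma s \<in> hom comma s s"
    using s ide_hom[OF category_X] ide_hom[OF category_Y] functor_ide[OF functor_S] functor_ide[OF functor_T]
      comp_ide[OF category_M, of \<beta> "FO S x" "FO T y"] ide_comp[OF category_M, of \<beta> "FO S x" "FO T y"]
    by (simp add: comma_ide comma_hom comma_obj)
next
  fix f g s t w
  assume f: "f \<in> hom comma s t" and g: "g \<in> hom comma t w"
  obtain x \<beta> y where s: "s = (x, \<beta>, y)" by (metis prod.exhaust)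
  obtain x' \<beta>' y' where t: "t = (x', \<beta>', y')" by (metis prod.exhaust)
  obtain x'' \<beta>'' y'' where w: "w = (x'', \<beta>'', y'')" by (metis prod.exhaust)
  obtain \<xi> \<mu> where 1: "f = (s, (\<xi>, \<mu>), t)"
    "(x, \<beta>, y) \<in> Obj comma" "(x', \<beta>', y') \<in> Obj comma" "\<xi> \<in> hom X x x'" "\<mu> \<in> hom Y y y'"
    "\<beta>' \<cdot>\<^bsub>M\<^esub> FA S \<xi> = FA T \<mu> \<cdot>\<^bsub>M\<^esub> \<beta>"
    using comma_homE[OF f[unfolded s t]] unfolding s t by blast
  obtain \<xi>' \<mu>' where 2: "g = (t, (\<xi>', \<mu>'), w)"
    "(x'', \<beta>'', y'') \<in> Obj comma" "\<xi>' \<in> hom X x' x''" "\<mu>' \<in> hom Y y' y''"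
    "\<beta>'' \<cdot>\<^bsub>M\<^esub> FA S \<xi>' = FA T \<mu>' \<cdot>\<^bsub>M\<^esub> \<beta>'"
    using comma_homE[OF g[unfolded t w]] unfolding t w by blast
  have \<beta>: "\<beta> \<in> hom M (FO S x) (FO T y)" "\<beta>' \<in> hom M (FO S x') (FO T y')"
    "\<beta>'' \<in> hom M (FO S x'') (FO T y'')" using 1 2 by (simp_all add: comma_obj)
  have "\<beta>'' \<cdot>\<^bsub>M\<^esub> FA S (\<xi>' \<cdot>\<^bsub>X\<^esub> \<xi>) = (\<beta>'' \<cdot>\<^bsub>M\<^esub> FA S \<xi>') \<cdot>\<^bsub>M\<^esub> FA S \<xi>"
    using functor_comp[OF functor_S 1(4) 2(3)] comp_assoc[OF category_M functor_hom[OF functor_S 1(4)] functor_hom[OF functor_S 2(3)] \<beta>(3)]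
    by simp
  also have "\<dots> = FA T \<mu>' \<cdot>\<^bsub>M\<^esub> (\<beta>' \<cdot>\<^bsub>M\<^esub> FA S \<xi>)"
    using 2(5) comp_assoc[OF category_M functor_hom[OF functor_S 1(4)] \<beta>(2) functor_hom[OF functor_T 2(4)]] by simp
  also have "\<dots> = FA T (\<mu>' \<cdot>\<^bsub>Y\<^esub> \<mu>) \<cdot>\<^bsub>M\<^esub> \<beta>"
    using 1(6) functor_comp[OF functor_T 1(5) 2(4)]
      comp_assoc[OF category_M \<beta>(1) functor_hom[OF functor_T 1(5)] functor_hom[OF functor_T 2(4)]] by simp
  finally show "g \<cdot>\<^bsub>comma\<^esub> f \<in> hom comma s w"
    using 1 2 s t w comp_hom[OF category_X 1(4) 2(3)] comp_hom[OF category_Y 1(5) 2(4)] by (simp add: comma_comp comma_hom)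
next
  fix f s t
  assume f: "f \<in> hom comma s t"
  obtain x \<beta> y where s: "s = (x, \<beta>, y)" by (metis prod.exhaust)
  obtain x' \<beta>' y' where t: "t = (x', \<beta>', y')" by (metis prod.exhaust)
  obtain \<xi> \<mu> where 1: "f = (s, (\<xi>, \<mu>), t)" "\<xi> \<in> hom X x x'" "\<mu> \<in> hom Y y y'"
    using comma_homE[OF f[unfolded s t], folded s t] .
  show "f \<cdot>\<^bsub>comma\<^esub> Ide comma s = f \<and> Ide comma t \<cdot>\<^bsub>comma\<^esub> f = f"
    using comp_ide[OF category_X 1(2)] comp_ide[OF category_Y 1(3)] ide_comp[OF category_X 1(2)] ide_comp[OF category_Y 1(3)]
    by (simp add: 1(1) s t comma_comp comma_ide)
next
  fix f g h s t w v
  assume f: "f \<in> hom comma s t" and g: "g \<in> hom comma t w" and h: "h \<in> hom comma w v"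
  obtain x \<beta> y where s: "s = (x, \<beta>, y)" by (metis prod.exhaust)
  obtain x' \<beta>' y' where t: "t = (x', \<beta>', y')" by (metis prod.exhaust)
  obtain x'' \<beta>'' y'' where w: "w = (x'', \<beta>'', y'')" by (metis prod.exhaust)
  obtain x3 \<beta>3 y3 where v: "v = (x3, \<beta>3, y3)" by (metis prod.exhaust)
  obtain \<xi> \<mu> where 1: "f = (s, (\<xi>, \<mu>), t)" "\<xi> \<in> hom X x x'" "\<mu> \<in> hom Y y y'"
    using comma_homE[OF f[unfolded s t], folded s t] .
  obtain \<xi>' \<mu>' where 2: "g = (t, (\<xi>', \<mu>'), w)" "\<xi>' \<in> hom X x' x''" "\<mu>' \<in> hom Y y' y''"
    using comma_homE[OF g[unfolded t w], folded t w] .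
  obtain \<xi>'' \<mu>'' where 3: "h = (w, (\<xi>'', \<mu>''), v)" "\<xi>'' \<in> hom X x'' x3" "\<mu>'' \<in> hom Y y'' y3"
    using comma_homE[OF h[unfolded w v], folded w v] .
  show "h \<cdot>\<^bsub>comma\<^esub> (g \<cdot>\<^bsub>comma\<^esub> f) = (h \<cdot>\<^bsub>comma\<^esub> g) \<cdot>\<^bsub>comma\<^esub> f"
    using comp_assoc[OF category_X 1(2) 2(2) 3(2)] comp_assoc[OF category_Y 1(3) 2(3) 3(3)]
    by (simp add: comma_comp 1(1) 2(1) 3(1))
qed

lemma functor_comma_proj: "is_functor comma A (fib_comma_proj F)"
proof (rule functorI)
  show "category comma" by (rule category_comma)
  show "category A" by (rule category_A)
next
  fix s assume "s \<in> Obj comma"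
  then show "FO (fib_comma_proj F) s \<in> Obj A" "FA (fib_comma_proj F) (Ide comma s) = Ide A (FO (fib_comma_proj F) s)"
    by (cases s; simp add: comma_obj comma_ide comma_proj functor_obj[OF functor_F] functor_ide[OF functor_F])+
next
  fix f s t assume f: "f \<in> hom comma s t"
  obtain x \<beta> y where s: "s = (x, \<beta>, y)" by (metis prod.exhaust)
  obtain x' \<beta>' y' where t: "t = (x', \<beta>', y')" by (metis prod.exhaust)
  show "FA (fib_comma_proj F) f \<in> hom A (FO (fib_comma_proj F) s) (FO (fib_comma_proj F) t)"
    using comma_homE[OF f[unfolded s t]] functor_hom[OF functor_F] by (metis comma_proj s t)
next
  fix f g s t w
  assume f: "f \<in> hom comma s t" and g: "g \<in> hom comma t w"
  obtain x \<beta> y where s: "s = (x, \<beta>, y)" by (metis prod.exhaust)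
  obtain x' \<beta>' y' where t: "t = (x', \<beta>', y')" by (metis prod.exhaust)
  obtain x'' \<beta>'' y'' where w: "w = (x'', \<beta>'', y'')" by (metis prod.exhaust)
  obtain \<xi> \<mu> where 1: "f = (s, (\<xi>, \<mu>), t)" "\<xi> \<in> hom X x x'" "\<mu> \<in> hom Y y y'"
    using comma_homE[OF f[unfolded s t], folded s t] .
  obtain \<xi>' \<mu>' where 2: "g = (t, (\<xi>', \<mu>'), w)" "\<xi>' \<in> hom X x' x''" "\<mu>' \<in> hom Y y' y''"
    using comma_homE[OF g[unfolded t w], folded t w] .
  show "FA (fib_comma_proj F) (g \<cdot>\<^bsub>comma\<^esub> f) = FA (fib_comma_proj F) g \<cdot>\<^bsub>A\<^esub> FA (fib_comma_proj F) f"
    using functor_comp[OF functor_F 1(2) 2(2)] by (simp add: 1(1) 2(1) comma_comp comma_proj)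
qed

lemma comma_over:
  assumes "(x, \<beta>, y) \<in> Obj comma"
  shows "FO F x = FO K y" "FO G (FO S x) = FO F x" "FO G (FO T y) = FO F x"
proof -
  have x: "x \<in> Obj X" "y \<in> Obj Y" and \<beta>: "\<beta> \<in> hom M (FO S x) (FO T y)" "FA G \<beta> = Ide A (FO F x)"
    using assms by (simp_all add: comma_obj)
  show 1: "FO G (FO S x) = FO F x" using func_eq_obj[OF fib_1cellD(4)[OF S] x(1)] .
  show 2: "FO G (FO T y) = FO F x"
    using functor_hom[OF functor_G \<beta>(1)] ide_hom[OF category_A functor_obj[OF functor_F x(1)]] \<beta>(2) by (simp add: hom_def)
  then show "FO F x = FO K y" using func_eq_obj[OF fib_1cellD(4)[OF T] x(2)] by simp
qed

text \<open>
  Apply \<open>G\<close> to the commuting square: it sends \<open>\<beta>\<close> and \<open>\<beta>'\<close> to identities.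
\<close>

lemma comma_arr_over:
  assumes "(s, (\<xi>, \<mu>), t) \<in> hom comma (x, \<beta>, y) (x', \<beta>', y')"
  shows "FA F \<xi> = FA K \<mu>"
proof -
  have o: "(x, \<beta>, y) \<in> Obj comma" "(x', \<beta>', y') \<in> Obj comma"
    and \<xi>: "\<xi> \<in> hom X x x'" and \<mu>: "\<mu> \<in> hom Y y y'" and sq: "\<beta>' \<cdot>\<^bsub>M\<^esub> FA S \<xi> = FA T \<mu> \<cdot>\<^bsub>M\<^esub> \<beta>"
    using assms by (simp_all add: comma_hom)
  have \<beta>: "\<beta> \<in> hom M (FO S x) (FO T y)" "\<beta>' \<in> hom M (FO S x') (FO T y')"
    "FA G \<beta> = Ide A (FO F x)" "FA G \<beta>' = Ide A (FO F x')" using o by (simp_all add: comma_obj)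
  have "FA G (\<beta>' \<cdot>\<^bsub>M\<^esub> FA S \<xi>) = Ide A (FO F x') \<cdot>\<^bsub>A\<^esub> FA F \<xi>"
    using functor_comp[OF functor_G functor_hom[OF functor_S \<xi>] \<beta>(2)] \<beta>(4) func_eq_arr[OF fib_1cellD(4)[OF S] \<xi>] by simp
  moreover have "FA G (FA T \<mu> \<cdot>\<^bsub>M\<^esub> \<beta>) = FA K \<mu> \<cdot>\<^bsub>A\<^esub> Ide A (FO F x)"
    using functor_comp[OF functor_G \<beta>(1) functor_hom[OF functor_T \<mu>]] \<beta>(3) func_eq_arr[OF fib_1cellD(4)[OF T] \<mu>] by simp
  ultimately show ?thesis
    using sq ide_comp[OF category_A functor_hom[OF functor_F \<xi>]] comp_ide[OF category_A functor_hom[OF functor_K \<mu>]] comma_over(1)[OF o(1)]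
    by simp
qed

text \<open>
  The two components are lifted separately. The square that they should form commutes because its
  sides agree over \<open>A\<close> and after composition with the cartesian arrow \<open>T \<mu>\<close>.
\<close>

lemma comma_cartesian:
  assumes u: "(s, (\<xi>, \<mu>), t) \<in> hom comma (x, \<beta>, y) (x', \<beta>', y')"
    and \<xi>c: "cartesian X A F \<xi>" and \<mu>c: "cartesian Y A K \<mu>"
  shows "cartesian comma A (fib_comma_proj F) (s, (\<xi>, \<mu>), t)"
proof (rule cartesianI[OF u])
  have st: "s = (x, \<beta>, y)" "t = (x', \<beta>', y')" and o: "(x, \<beta>, y) \<in> Obj comma" "(x', \<beta>', y') \<in> Obj comma"
    and \<xi>: "\<xi> \<in> hom X x x'" and \<mu>: "\<mu> \<in> hom Y y y'" and sq: "\<beta>' \<cdot>\<^bsub>M\<^esub> FA S \<xi> = FA T \<mu> \<cdot>\<^bsub>M\<^esub> \<beta>"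
    using u by (simp_all add: comma_hom)
  have \<beta>: "\<beta> \<in> hom M (FO S x) (FO T y)" "\<beta>' \<in> hom M (FO S x') (FO T y')"
    "FA G \<beta> = Ide A (FO F x)" "FA G \<beta>' = Ide A (FO F x')" using o by (simp_all add: comma_obj)
  note S\<xi> = functor_hom[OF functor_S \<xi>] and T\<mu> = functor_hom[OF functor_T \<mu>]
  {
    fix w g \<alpha>
    assume g: "g \<in> hom comma w (x', \<beta>', y')"
      and \<alpha>: "\<alpha> \<in> hom A (FO (fib_comma_proj F) w) (FO (fib_comma_proj F) (x, \<beta>, y))"
      and eq: "FA (fib_comma_proj F) (s, (\<xi>, \<mu>), t) \<cdot>\<^bsub>A\<^esub> \<alpha> = FA (fib_comma_proj F) g"
    obtain x0 \<beta>0 y0 where w: "w = (x0, \<beta>0, y0)" by (metis prod.exhaust)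
    obtain \<xi>0 \<mu>0 where g': "g = (w, (\<xi>0, \<mu>0), (x', \<beta>', y'))"
      and o0: "(x0, \<beta>0, y0) \<in> Obj comma" and \<xi>0: "\<xi>0 \<in> hom X x0 x'" and \<mu>0: "\<mu>0 \<in> hom Y y0 y'"
      and sq0: "\<beta>' \<cdot>\<^bsub>M\<^esub> FA S \<xi>0 = FA T \<mu>0 \<cdot>\<^bsub>M\<^esub> \<beta>0"
      using comma_homE[OF g[unfolded w]] unfolding w by blast
    have \<beta>0: "\<beta>0 \<in> hom M (FO S x0) (FO T y0)" "FA G \<beta>0 = Ide A (FO F x0)"
      using o0 by (simp_all add: comma_obj)
    have F0: "FA F \<xi>0 = FA K \<mu>0" using comma_arr_over[OF g[unfolded g' w]] .
    have \<alpha>1: "\<alpha> \<in> hom A (FO F x0) (FO F x)" "FA F \<xi> \<cdot>\<^bsub>A\<^esub> \<alpha> = FA F \<xi>0"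
      using \<alpha> eq by (simp_all add: w g' comma_proj)
    then have \<alpha>2: "\<alpha> \<in> hom A (FO K y0) (FO K y)" "FA K \<mu> \<cdot>\<^bsub>A\<^esub> \<alpha> = FA K \<mu>0"
      using comma_over(1)[OF o(1)] comma_over(1)[OF o0] comma_arr_over[OF u] F0 by simp_all
    obtain h where h: "h \<in> hom X x0 x" "\<xi> \<cdot>\<^bsub>X\<^esub> h = \<xi>0" "FA F h = \<alpha>"
      using cartesian_lift[OF \<xi>c \<xi> \<xi>0 \<alpha>1] .
    obtain k where k: "k \<in> hom Y y0 y" "\<mu> \<cdot>\<^bsub>Y\<^esub> k = \<mu>0" "FA K k = \<alpha>"
      using cartesian_lift[OF \<mu>c \<mu> \<mu>0 \<alpha>2] .
    note Sh = functor_hom[OF functor_S h(1)] and Tk = functor_hom[OF functor_T k(1)]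
    have "\<beta> \<cdot>\<^bsub>M\<^esub> FA S h = FA T k \<cdot>\<^bsub>M\<^esub> \<beta>0"
    proof (rule cartesian_unique[OF functor_G fib_1cellD(5)[OF T \<mu>c] T\<mu> comp_hom[OF category_M Sh \<beta>(1)] comp_hom[OF category_M \<beta>0(1) Tk]])
      have "FA T \<mu> \<cdot>\<^bsub>M\<^esub> (\<beta> \<cdot>\<^bsub>M\<^esub> FA S h) = \<beta>' \<cdot>\<^bsub>M\<^esub> FA S \<xi>0"
        using sq comp_assoc[OF category_M Sh \<beta>(1) T\<mu>] comp_assoc[OF category_M Sh S\<xi> \<beta>(2)] functor_comp[OF functor_S h(1) \<xi>] h(2) by simp
      also have "\<dots> = FA T \<mu> \<cdot>\<^bsub>M\<^esub> (FA T k \<cdot>\<^bsub>M\<^esub> \<beta>0)"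
        using sq0 comp_assoc[OF category_M \<beta>0(1) Tk T\<mu>] functor_comp[OF functor_T k(1) \<mu>] k(2) by simp
      finally show "FA T \<mu> \<cdot>\<^bsub>M\<^esub> (\<beta> \<cdot>\<^bsub>M\<^esub> FA S h) = FA T \<mu> \<cdot>\<^bsub>M\<^esub> (FA T k \<cdot>\<^bsub>M\<^esub> \<beta>0)" .
      have "FA G (\<beta> \<cdot>\<^bsub>M\<^esub> FA S h) = \<alpha>"
        using functor_comp[OF functor_G Sh \<beta>(1)] \<beta>(3) func_eq_arr[OF fib_1cellD(4)[OF S] h(1)] h(3) ide_comp[OF category_A \<alpha>1(1)] by simp
      moreover have "FA G (FA T k \<cdot>\<^bsub>M\<^esub> \<beta>0) = \<alpha>"
        using functor_comp[OF functor_G \<beta>0(1) Tk] \<beta>0(2) func_eq_arr[OF fib_1cellD(4)[OF T] k(1)] k(3) comp_ide[OF category_A \<alpha>1(1)] by simp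
      ultimately show "FA G (\<beta> \<cdot>\<^bsub>M\<^esub> FA S h) = FA G (FA T k \<cdot>\<^bsub>M\<^esub> \<beta>0)" by simp
    qed
    then have "(w, (h, k), s) \<in> hom comma w (x, \<beta>, y)"
      using w st o o0 h(1) k(1) by (simp add: comma_hom)
    moreover have "(s, (\<xi>, \<mu>), t) \<cdot>\<^bsub>comma\<^esub> (w, (h, k), s) = g"
      using h(2) k(2) st by (simp add: comma_comp g')
    moreover have "FA (fib_comma_proj F) (w, (h, k), s) = \<alpha>" using h(3) by (simp add: comma_proj)
    ultimately show "\<exists>h. h \<in> hom comma w (x, \<beta>, y) \<and> (s, (\<xi>, \<mu>), t) \<cdot>\<^bsub>comma\<^esub> h = g \<and> FA (fib_comma_proj F) h = \<alpha>"
      by blast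
  }
  fix w h h'
  assume h: "h \<in> hom comma w (x, \<beta>, y)" and h': "h' \<in> hom comma w (x, \<beta>, y)"
    and eq: "(s, (\<xi>, \<mu>), t) \<cdot>\<^bsub>comma\<^esub> h = (s, (\<xi>, \<mu>), t) \<cdot>\<^bsub>comma\<^esub> h'"
      "FA (fib_comma_proj F) h = FA (fib_comma_proj F) h'"
  obtain x0 \<beta>0 y0 where w: "w = (x0, \<beta>0, y0)" by (metis prod.exhaust)
  obtain p q where 1: "h = (w, (p, q), (x, \<beta>, y))"
    and p: "p \<in> hom X x0 x" and q: "q \<in> hom Y y0 y" using comma_homE[OF h[unfolded w], folded w] .
  obtain p' q' where 2: "h' = (w, (p', q'), (x, \<beta>, y))"
    and p': "p' \<in> hom X x0 x" and q': "q' \<in> hom Y y0 y" using comma_homE[OF h'[unfolded w], folded w] .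
  have e: "\<xi> \<cdot>\<^bsub>X\<^esub> p = \<xi> \<cdot>\<^bsub>X\<^esub> p'" "\<mu> \<cdot>\<^bsub>Y\<^esub> q = \<mu> \<cdot>\<^bsub>Y\<^esub> q'" "FA F p = FA F p'"
    using eq by (simp_all add: 1 2 comma_comp comma_proj)
  have "FA F p = FA K q" "FA F p' = FA K q'"
    using comma_arr_over[OF h[unfolded 1 w]] comma_arr_over[OF h'[unfolded 2 w]] by simp_all
  then have "FA K q = FA K q'" using e(3) by simp
  then have "q = q'" by (rule cartesian_unique[OF functor_K \<mu>c \<mu> q q' e(2)])
  moreover have "p = p'" by (rule cartesian_unique[OF functor_F \<xi>c \<xi> p p' e(1,3)])
  ultimately show "h = h'" by (simp add: 1 2)
qed

text \<open>
  After lifting \<open>\<alpha>\<close> to \<open>\<xi>\<close> and \<open>\<mu>\<close>, the missing vertical arrow of the new object is the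
  factorization of \<open>\<beta>' \<cdot> S \<xi>\<close> through the cartesian arrow \<open>T \<mu>\<close>.
\<close>

lemma fibration_comma: "fibration comma A (fib_comma_proj F)"
proof (rule fibrationI[OF functor_comma_proj])
  fix t \<alpha>
  assume t0: "t \<in> Obj comma" and \<alpha>0: "\<alpha> \<in> Arr A" "Cod A \<alpha> = FO (fib_comma_proj F) t"
  obtain x' \<beta>' y' where t: "t = (x', \<beta>', y')" by (metis prod.exhaust)
  have o: "(x', \<beta>', y') \<in> Obj comma" using t0 t by simp
  define a where "a = Dom A \<alpha>"
  have \<alpha>: "\<alpha> \<in> hom A a (FO F x')" using \<alpha>0 by (simp add: hom_def t comma_proj a_def)
  have x': "x' \<in> Obj X" "y' \<in> Obj Y" and \<beta>': "\<beta>' \<in> hom M (FO S x') (FO T y')" "FA G \<beta>' = Ide A (FO F x')"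
    using o by (simp_all add: comma_obj)
  have fib: "fibration X A F" "fibration Y A K" using S T by (simp_all add: fib_1cell_def)
  obtain x \<xi> where \<xi>: "\<xi> \<in> hom X x x'" "cartesian X A F \<xi>" "FA F \<xi> = \<alpha>" "FO F x = a"
    using fibration_lift[OF fib(1) x'(1) \<alpha>] .
  obtain y \<mu> where \<mu>: "\<mu> \<in> hom Y y y'" "cartesian Y A K \<mu>" "FA K \<mu> = \<alpha>" "FO K y = a"
    using fibration_lift[OF fib(2) x'(2)] \<alpha> comma_over(1)[OF o] by metis
  note xy = hom_dom[OF category_X \<xi>(1)] hom_dom[OF category_Y \<mu>(1)]
  note S\<xi> = functor_hom[OF functor_S \<xi>(1)] and T\<mu> = functor_hom[OF functor_T \<mu>(1)]
  have a: "FO G (FO S x) = a" "FO G (FO T y) = a"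
    using func_eq_obj[OF fib_1cellD(4)[OF S] xy(1)] func_eq_obj[OF fib_1cellD(4)[OF T] xy(2)] \<xi>(4) \<mu>(4) by simp_all
  have I: "Ide A a \<in> hom A (FO G (FO S x)) (FO G (FO T y))"
    using a ide_hom[OF category_A hom_dom[OF category_A \<alpha>]] by simp
  have "FA G (FA T \<mu>) \<cdot>\<^bsub>A\<^esub> Ide A a = FA G (\<beta>' \<cdot>\<^bsub>M\<^esub> FA S \<xi>)"
    using functor_comp[OF functor_G S\<xi> \<beta>'(1)] \<beta>'(2) func_eq_arr[OF fib_1cellD(4)[OF S] \<xi>(1)] \<xi>(3)
      func_eq_arr[OF fib_1cellD(4)[OF T] \<mu>(1)] \<mu>(3) ide_comp[OF category_A \<alpha>] comp_ide[OF category_A \<alpha>] by simp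
  then obtain \<beta> where \<beta>: "\<beta> \<in> hom M (FO S x) (FO T y)" "FA T \<mu> \<cdot>\<^bsub>M\<^esub> \<beta> = \<beta>' \<cdot>\<^bsub>M\<^esub> FA S \<xi>" "FA G \<beta> = Ide A a"
    using cartesian_lift[OF fib_1cellD(5)[OF T \<mu>(2)] T\<mu> comp_hom[OF category_M S\<xi> \<beta>'(1)] I] by blast
  have u: "((x, \<beta>, y), (\<xi>, \<mu>), t) \<in> hom comma (x, \<beta>, y) (x', \<beta>', y')"
    using \<beta> o xy \<xi> \<mu> by (simp add: comma_hom t) (simp add: comma_obj)
  then show "\<exists>f s. f \<in> hom comma s t \<and> cartesian comma A (fib_comma_proj F) f \<and> FA (fib_comma_proj F) f = \<alpha>"
    using comma_cartesian[OF u \<xi>(2) \<mu>(2)] \<xi>(3) t comma_proj(2) by metis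
qed

end

section \<open>Unique lifting of vertical arrows\<close>

text \<open>
  The elementary form of a discrete opfibration between fibrations over \<open>A\<close>: vertical arrows of the
  codomain lift uniquely once the domain of the lifting is given.
\<close>

locale unique_vertical_lifting =
  fixes A :: "('c, 'd) cat"
    and X :: "('o, 'a) cat" and F :: "('o, 'a, 'c, 'd) func"
    and M :: "('p, 'b) cat" and G :: "('p, 'b, 'c, 'd) func"
    and P :: "('o, 'a, 'p, 'b) func"
  assumes P: "fib_1cell A X F M G P"
    and unique_lift: "\<And>x m \<beta>. x \<in> Obj X \<Longrightarrow> \<beta> \<in> hom M (FO P x) m \<Longrightarrow> FA G \<beta> = Ide A (FO F x) \<Longrightarrow>
      \<exists>!\<xi>. \<xi> \<in> Arr X \<and> Dom X \<xi> = x \<and> FA P \<xi> = \<beta>"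
begin

lemmas functor_F = fib_1cellD(1)[OF P] and functor_G = fib_1cellD(2)[OF P] and functor_P = fib_1cellD(3)[OF P]
  and GP = fib_1cellD(4)[OF P] and P_cartesian = fib_1cellD(5)[OF P]
lemmas category_X = functor_cat[OF functor_F, THEN conjunct1] and category_A = functor_cat[OF functor_F, THEN conjunct2]
  and category_M = functor_cat[OF functor_G, THEN conjunct1]

lemma fibX: "fibration X A F" and fibM: "fibration M A G"
  using P by (simp_all add: fib_1cell_def)

lemma lift_unique:
  assumes \<xi>: "\<xi> \<in> hom X x y" and \<xi>': "\<xi>' \<in> hom X x y'" and eq: "FA P \<xi> = FA P \<xi>'"
    and v: "FA F \<xi> = Ide A (FO F x)"
  shows "\<xi> = \<xi>'"
proof -
  have "FA G (FA P \<xi>) = Ide A (FO F x)" using v func_eq_arr[OF GP \<xi>] by simp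
  from unique_lift[OF hom_dom[OF category_X \<xi>] functor_hom[OF functor_P \<xi>] this]
  show ?thesis using homD[OF \<xi>] homD[OF \<xi>'] eq by metis
qed

text \<open>
  Two arrows with the same image factor through one cartesian arrow, and their vertical factors
  have the same image, so these agree by the uniqueness of liftings.
\<close>

lemma faithful:
  assumes \<zeta>: "\<zeta> \<in> hom X y z" and \<zeta>': "\<zeta>' \<in> hom X y z" and eq: "FA P \<zeta> = FA P \<zeta>'"
  shows "\<zeta> = \<zeta>'"
proof -
  note F\<zeta> = functor_hom[OF functor_F \<zeta>]
  have Feq: "FA F \<zeta> = FA F \<zeta>'" using func_eq_arr[OF GP \<zeta>] func_eq_arr[OF GP \<zeta>'] eq by simp
  obtain w k where k: "k \<in> hom X w z" "cartesian X A F k" "FA F k = FA F \<zeta>" "FO F w = FO F y"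
    using fibration_lift[OF fibX hom_cod[OF category_X \<zeta>] F\<zeta>] by metis
  have I: "Ide A (FO F y) \<in> hom A (FO F y) (FO F w)"
    using ide_hom[OF category_A hom_dom[OF category_A F\<zeta>]] k(4) by simp
  have e: "FA F k \<cdot>\<^bsub>A\<^esub> Ide A (FO F y) = FA F \<zeta>" using comp_ide[OF category_A F\<zeta>] k(3) by simp
  obtain u where u: "u \<in> hom X y w" "k \<cdot>\<^bsub>X\<^esub> u = \<zeta>" "FA F u = Ide A (FO F y)"
    using cartesian_lift[OF k(2,1) \<zeta> I e] .
  obtain u' where u': "u' \<in> hom X y w" "k \<cdot>\<^bsub>X\<^esub> u' = \<zeta>'" "FA F u' = Ide A (FO F y)"
    using cartesian_lift[OF k(2,1) \<zeta>' I] e Feq by metis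
  have "FA P u = FA P u'"
  proof (rule cartesian_unique[OF functor_G P_cartesian[OF k(2)] functor_hom[OF functor_P k(1)] functor_hom[OF functor_P u(1)] functor_hom[OF functor_P u'(1)]])
    show "FA P k \<cdot>\<^bsub>M\<^esub> FA P u = FA P k \<cdot>\<^bsub>M\<^esub> FA P u'"
      using functor_comp[OF functor_P u(1) k(1)] functor_comp[OF functor_P u'(1) k(1)] u u' eq by simp
    show "FA G (FA P u) = FA G (FA P u')"
      using func_eq_arr[OF GP u(1)] func_eq_arr[OF GP u'(1)] u u' by simp
  qed
  then have "u = u'" by (rule lift_unique[OF u(1) u'(1) _ u(3)])
  then show ?thesis using u u' by simp
qed

text \<open>
  Write \<open>\<mu> = P k \<cdot> v\<close> with \<open>k : z \<rightarrow> y'\<close> cartesian and \<open>v\<close> vertical. Lifting \<open>v\<close> at \<open>y\<close> and composing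
  with \<open>\<nu>\<close>, or factoring \<open>\<nu>' \<cdot> \<xi>\<close> through \<open>k\<close>, are two ways of lifting one vertical arrow at \<open>x\<close>. So they
  coincide, which shows both that the lifting of \<open>v\<close> ends at \<open>z\<close> and that the square commutes.
\<close>

lemma square_lift:
  assumes \<nu>: "\<nu> \<in> hom X x y" "FA F \<nu> = Ide A (FO F x)"
    and \<nu>': "\<nu>' \<in> hom X x' y'" and \<xi>: "\<xi> \<in> hom X x x'"
    and \<mu>: "\<mu> \<in> hom M (FO P y) (FO P y')"
    and sq: "FA P \<nu>' \<cdot>\<^bsub>M\<^esub> FA P \<xi> = \<mu> \<cdot>\<^bsub>M\<^esub> FA P \<nu>"
  obtains \<zeta> where "\<zeta> \<in> hom X y y'" "FA P \<zeta> = \<mu>" "\<zeta> \<cdot>\<^bsub>X\<^esub> \<nu> = \<nu>' \<cdot>\<^bsub>X\<^esub> \<xi>"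
proof -
  have xo: "x \<in> Obj X" and yo: "y \<in> Obj X" and y'o: "y' \<in> Obj X"
    using hom_dom[OF category_X \<nu>(1)] hom_cod[OF category_X \<nu>(1)] hom_cod[OF category_X \<nu>'] by simp_all
  have Ix: "Ide A (FO F x) \<in> hom A (FO F x) (FO F x)" using ide_hom[OF category_A functor_obj[OF functor_F xo]] .
  have Fy: "FO F y = FO F x" using functor_hom[OF functor_F \<nu>(1)] \<nu>(2) Ix by (simp add: hom_def)
  let ?g = "\<nu>' \<cdot>\<^bsub>X\<^esub> \<xi>" and ?\<alpha> = "FA G \<mu>"
  have g: "?g \<in> hom X x y'" using comp_hom[OF category_X \<xi> \<nu>'] .
  have \<alpha>: "?\<alpha> \<in> hom A (FO F x) (FO F y')"
    using functor_hom[OF functor_G \<mu>] func_eq_obj[OF GP yo] func_eq_obj[OF GP y'o] Fy by simp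
  have Pg: "FA P ?g = \<mu> \<cdot>\<^bsub>M\<^esub> FA P \<nu>" using functor_comp[OF functor_P \<xi> \<nu>'] sq by simp
  have Fg: "FA F ?g = ?\<alpha>"
    using func_eq_arr[OF GP g] Pg functor_comp[OF functor_G functor_hom[OF functor_P \<nu>(1)] \<mu>]
      func_eq_arr[OF GP \<nu>(1)] \<nu>(2) comp_ide[OF category_A \<alpha>] by simp
  obtain z k where k: "k \<in> hom X z y'" "cartesian X A F k" "FA F k = ?\<alpha>" "FO F z = FO F x"
    using fibration_lift[OF fibX y'o \<alpha>] .
  note zo = hom_dom[OF category_X k(1)] and Pk = functor_hom[OF functor_P k(1)] and P\<nu> = functor_hom[OF functor_P \<nu>(1)]
  obtain u where u: "u \<in> hom X x z" "k \<cdot>\<^bsub>X\<^esub> u = ?g" "FA F u = Ide A (FO F x)"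
    using cartesian_lift[OF k(2,1) g, of "Ide A (FO F x)"] Ix k(3,4) Fg comp_ide[OF category_A \<alpha>] by auto
  have GPk: "FA G (FA P k) = ?\<alpha>" using func_eq_arr[OF GP k(1)] k(3) by simp
  obtain v where v: "v \<in> hom M (FO P y) (FO P z)" "FA P k \<cdot>\<^bsub>M\<^esub> v = \<mu>" "FA G v = Ide A (FO F x)"
    using cartesian_lift[OF P_cartesian[OF k(2)] Pk \<mu>, of "Ide A (FO F x)"] GPk comp_ide[OF category_A \<alpha>]
      func_eq_obj[OF GP yo] func_eq_obj[OF GP zo] Fy k(4) Ix by auto
  have "\<exists>!\<xi>. \<xi> \<in> Arr X \<and> Dom X \<xi> = y \<and> FA P \<xi> = v"
    using unique_lift[OF yo v(1)] v(3) Fy by simp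
  then obtain w where w0: "w \<in> Arr X" "Dom X w = y" "FA P w = v" by blast
  then have w: "w \<in> hom X y (Cod X w)" by (simp add: hom_def)
  have "FA P u = FA P (w \<cdot>\<^bsub>X\<^esub> \<nu>)"
    unfolding functor_comp[OF functor_P \<nu>(1) w] w0(3)
  proof (rule cartesian_unique[OF functor_G P_cartesian[OF k(2)] Pk functor_hom[OF functor_P u(1)] comp_hom[OF category_M P\<nu> v(1)]])
    show "FA P k \<cdot>\<^bsub>M\<^esub> FA P u = FA P k \<cdot>\<^bsub>M\<^esub> (v \<cdot>\<^bsub>M\<^esub> FA P \<nu>)"
      using functor_comp[OF functor_P u(1) k(1)] u(2) Pg v(2) comp_assoc[OF category_M P\<nu> v(1) Pk] by simp
    show "FA G (FA P u) = FA G (v \<cdot>\<^bsub>M\<^esub> FA P \<nu>)"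
      using func_eq_arr[OF GP u(1)] u(3) functor_comp[OF functor_G P\<nu> v(1)] v(3) func_eq_arr[OF GP \<nu>(1)]
        \<nu>(2) comp_ide[OF category_A Ix] by simp
  qed
  then have uw: "u = w \<cdot>\<^bsub>X\<^esub> \<nu>"
    using lift_unique[OF u(1) comp_hom[OF category_X \<nu>(1) w] _ u(3)] by blast
  then have "Cod X w = z" using homD[OF u(1)] homD[OF comp_hom[OF category_X \<nu>(1) w]] by simp
  then have wz: "w \<in> hom X y z" using w by simp
  show thesis
  proof (rule that)
    show "k \<cdot>\<^bsub>X\<^esub> w \<in> hom X y y'" using comp_hom[OF category_X wz k(1)] .
    show "FA P (k \<cdot>\<^bsub>X\<^esub> w) = \<mu>" using functor_comp[OF functor_P wz k(1)] w0(3) v(2) by simp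
    show "(k \<cdot>\<^bsub>X\<^esub> w) \<cdot>\<^bsub>X\<^esub> \<nu> = \<nu>' \<cdot>\<^bsub>X\<^esub> \<xi>"
      using comp_assoc[OF category_X \<nu>(1) wz k(1)] uw u(2) by simp
  qed
qed

abbreviation "XX \<equiv> fib_comma A X F X X F id_func id_func"
abbreviation "PM \<equiv> fib_comma A X F M M G P id_func"

sublocale XX: comma_of_1cells A X F X F X F id_func id_func
  using fib_1cell_id[OF fibX] by unfold_locales

sublocale PM: comma_of_1cells A X F M G M G P id_func
  using fib_1cell_id[OF fibM] P by unfold_locales

lemma id_func_simps [simp]: "FO id_func x = x" "FA id_func f = f"
  by (simp_all add: id_func_def)

definition lift :: "'o \<Rightarrow> 'b \<Rightarrow> 'a" where
  "lift x \<beta> = (THE \<xi>. \<xi> \<in> Arr X \<and> Dom X \<xi> = x \<and> FA P \<xi> = \<beta>)"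

definition lift_sq :: "'o \<times> 'b \<times> 'p \<Rightarrow> 'o \<times> 'b \<times> 'p \<Rightarrow> 'b \<Rightarrow> 'a" where
  "lift_sq s t \<mu> = (case s of (x, \<beta>, y) \<Rightarrow> case t of (x', \<beta>', y') \<Rightarrow>
     (THE \<zeta>. \<zeta> \<in> hom X (Cod X (lift x \<beta>)) (Cod X (lift x' \<beta>')) \<and> FA P \<zeta> = \<mu>))"

definition lift_obj :: "'o \<times> 'b \<times> 'p \<Rightarrow> 'o \<times> 'a \<times> 'o" where
  "lift_obj = (\<lambda>(x, \<beta>, y). (x, lift x \<beta>, Cod X (lift x \<beta>)))"

text \<open>
  The inverse of the canonical comparison between the comma objects.
\<close>

definition lift_func :: "('o \<times> 'b \<times> 'p, ('o \<times> 'b \<times> 'p) \<times> ('a \<times> 'b) \<times> ('o \<times> 'b \<times> 'p),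
    'o \<times> 'a \<times> 'o, ('o \<times> 'a \<times> 'o) \<times> ('a \<times> 'a) \<times> ('o \<times> 'a \<times> 'o)) func" where
  "lift_func = \<lparr>FO = lift_obj, FA = (\<lambda>(s, (\<xi>, \<mu>), t). (lift_obj s, (\<xi>, lift_sq s t \<mu>), lift_obj t))\<rparr>"

lemma lift:
  assumes "(x, \<beta>, m) \<in> Obj PM"
  shows "lift x \<beta> \<in> hom X x (Cod X (lift x \<beta>))" "FA P (lift x \<beta>) = \<beta>"
    "FO P (Cod X (lift x \<beta>)) = m" "FA F (lift x \<beta>) = Ide A (FO F x)"
proof -
  have x: "x \<in> Obj X" and \<beta>: "\<beta> \<in> hom M (FO P x) m" "FA G \<beta> = Ide A (FO F x)"
    using assms by (simp_all add: PM.comma_obj)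
  have *: "lift x \<beta> \<in> Arr X \<and> Dom X (lift x \<beta>) = x \<and> FA P (lift x \<beta>) = \<beta>"
    unfolding lift_def by (rule theI'[OF unique_lift[OF x \<beta>]])
  then show 1: "lift x \<beta> \<in> hom X x (Cod X (lift x \<beta>))" and 2: "FA P (lift x \<beta>) = \<beta>"
    by (simp_all add: hom_def)
  show "FO P (Cod X (lift x \<beta>)) = m" using functor_hom[OF functor_P 1] 2 \<beta>(1) by (simp add: hom_def)
  show "FA F (lift x \<beta>) = Ide A (FO F x)" using func_eq_arr[OF GP 1] 2 \<beta>(2) by simp
qed

lemma lift_sq_eqI:
  assumes "\<zeta> \<in> hom X (Cod X (lift x \<beta>)) (Cod X (lift x' \<beta>'))" "FA P \<zeta> = \<mu>"
  shows "lift_sq (x, \<beta>, m) (x', \<beta>', m') \<mu> = \<zeta>"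
  unfolding lift_sq_def prod.case
proof (rule the_equality)
  fix \<zeta>' assume "\<zeta>' \<in> hom X (Cod X (lift x \<beta>)) (Cod X (lift x' \<beta>')) \<and> FA P \<zeta>' = \<mu>"
  then show "\<zeta>' = \<zeta>" using faithful[OF _ assms(1), of \<zeta>'] assms(2) by simp
qed (use assms in simp)

text \<open>
  The square lifting supplies an arrow that fits the square; faithfulness identifies it with the
  described one.
\<close>

lemma lift_sq:
  assumes "(s, (\<xi>, \<mu>), t) \<in> hom PM (x, \<beta>, m) (x', \<beta>', m')"
  shows "lift_sq (x, \<beta>, m) (x', \<beta>', m') \<mu> \<in> hom X (Cod X (lift x \<beta>)) (Cod X (lift x' \<beta>'))"
    "FA P (lift_sq (x, \<beta>, m) (x', \<beta>', m') \<mu>) = \<mu>"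
    "lift x' \<beta>' \<cdot>\<^bsub>X\<^esub> \<xi> = lift_sq (x, \<beta>, m) (x', \<beta>', m') \<mu> \<cdot>\<^bsub>X\<^esub> lift x \<beta>"
proof -
  have o: "(x, \<beta>, m) \<in> Obj PM" "(x', \<beta>', m') \<in> Obj PM" and \<xi>: "\<xi> \<in> hom X x x'" and \<mu>: "\<mu> \<in> hom M m m'"
    and sq: "\<beta>' \<cdot>\<^bsub>M\<^esub> FA P \<xi> = \<mu> \<cdot>\<^bsub>M\<^esub> \<beta>" using assms by (simp_all add: PM.comma_hom)
  note l = lift[OF o(1)] and l' = lift[OF o(2)]
  obtain \<zeta> where \<zeta>: "\<zeta> \<in> hom X (Cod X (lift x \<beta>)) (Cod X (lift x' \<beta>'))" "FA P \<zeta> = \<mu>"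
    "\<zeta> \<cdot>\<^bsub>X\<^esub> lift x \<beta> = lift x' \<beta>' \<cdot>\<^bsub>X\<^esub> \<xi>"
    using square_lift[OF l(1,4) l'(1) \<xi>, of \<mu>] \<mu> sq l l' by auto
  have "lift_sq (x, \<beta>, m) (x', \<beta>', m') \<mu> = \<zeta>" by (rule lift_sq_eqI[OF \<zeta>(1,2)])
  then show "lift_sq (x, \<beta>, m) (x', \<beta>', m') \<mu> \<in> hom X (Cod X (lift x \<beta>)) (Cod X (lift x' \<beta>'))"
    "FA P (lift_sq (x, \<beta>, m) (x', \<beta>', m') \<mu>) = \<mu>"
    "lift x' \<beta>' \<cdot>\<^bsub>X\<^esub> \<xi> = lift_sq (x, \<beta>, m) (x', \<beta>', m') \<mu> \<cdot>\<^bsub>X\<^esub> lift x \<beta>"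
    using \<zeta> by simp_all
qed

lemma lift_obj: "lift_obj (x, \<beta>, m) = (x, lift x \<beta>, Cod X (lift x \<beta>))"
  by (simp add: lift_obj_def)

lemma lift_func: "FO lift_func s = lift_obj s"
  "FA lift_func (s, (\<xi>, \<mu>), t) = (lift_obj s, (\<xi>, lift_sq s t \<mu>), lift_obj t)"
  by (simp_all add: lift_func_def)

lemma canonical:
  "FO (comma_canonical P) (x, \<nu>, y) = (x, FA P \<nu>, FO P y)"
  "FA (comma_canonical P) ((x, \<nu>, y), (\<xi>, \<zeta>), (x', \<nu>', y')) =
    ((x, FA P \<nu>, FO P y), (\<xi>, FA P \<zeta>), (x', FA P \<nu>', FO P y'))"
  by (simp_all add: comma_canonical_def Let_def)

lemma lift_obj_in: "(x, \<beta>, m) \<in> Obj PM \<Longrightarrow> (x, lift x \<beta>, Cod X (lift x \<beta>)) \<in> Obj XX"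
  using lift[of x \<beta> m] hom_dom[OF category_X] hom_cod[OF category_X] by (simp add: XX.comma_obj)

lemma canonical_obj_in: "(x, \<nu>, y) \<in> Obj XX \<Longrightarrow> (x, FA P \<nu>, FO P y) \<in> Obj PM"
  using functor_hom[OF functor_P, of \<nu> x y] func_eq_arr[OF GP, of \<nu> x y] functor_obj[OF functor_P]
  by (simp add: XX.comma_obj PM.comma_obj)

lemma functor_canonical: "is_functor XX PM (comma_canonical P)"
proof (rule functorI[OF XX.category_comma PM.category_comma])
  fix s assume s: "s \<in> Obj XX"
  obtain x \<nu> y where t: "s = (x, \<nu>, y)" by (metis prod.exhaust)
  show "FO (comma_canonical P) s \<in> Obj PM" using s canonical_obj_in by (simp add: t canonical)
  show "FA (comma_canonical P) (Ide XX s) = Ide PM (FO (comma_canonical P) s)"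
    using s functor_ide[OF functor_P] by (simp add: t canonical XX.comma_ide PM.comma_ide XX.comma_obj)
next
  fix f s t assume f: "f \<in> hom XX s t"
  obtain x \<nu> y where s: "s = (x, \<nu>, y)" by (metis prod.exhaust)
  obtain x' \<nu>' y' where t: "t = (x', \<nu>', y')" by (metis prod.exhaust)
  obtain \<xi> \<zeta> where 1: "f = ((x, \<nu>, y), (\<xi>, \<zeta>), (x', \<nu>', y'))"
    "(x, \<nu>, y) \<in> Obj XX" "(x', \<nu>', y') \<in> Obj XX" "\<xi> \<in> hom X x x'" "\<zeta> \<in> hom X y y'"
    "\<nu>' \<cdot>\<^bsub>X\<^esub> \<xi> = \<zeta> \<cdot>\<^bsub>X\<^esub> \<nu>"
    using XX.comma_homE[OF f[unfolded s t], unfolded id_func_simps] by blast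
  have "\<nu> \<in> hom X x y" "\<nu>' \<in> hom X x' y'" using 1(2,3) by (simp_all add: XX.comma_obj)
  then have "FA P \<nu>' \<cdot>\<^bsub>M\<^esub> FA P \<xi> = FA P \<zeta> \<cdot>\<^bsub>M\<^esub> FA P \<nu>"
    using functor_comp[OF functor_P 1(4), of \<nu>' y'] functor_comp[OF functor_P _ 1(5), of \<nu> x] 1(6) by simp
  then show "FA (comma_canonical P) f \<in> hom PM (FO (comma_canonical P) s) (FO (comma_canonical P) t)"
    using canonical_obj_in[OF 1(2)] canonical_obj_in[OF 1(3)] functor_hom[OF functor_P 1(5)] 1(4)
    by (simp add: 1(1) s t canonical PM.comma_hom)
next
  fix f g s t w assume f: "f \<in> hom XX s t" and g: "g \<in> hom XX t w"
  obtain x \<nu> y where s: "s = (x, \<nu>, y)" by (metis prod.exhaust)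
  obtain x' \<nu>' y' where t: "t = (x', \<nu>', y')" by (metis prod.exhaust)
  obtain x'' \<nu>'' y'' where w: "w = (x'', \<nu>'', y'')" by (metis prod.exhaust)
  obtain \<xi> \<zeta> where 1: "f = ((x, \<nu>, y), (\<xi>, \<zeta>), (x', \<nu>', y'))" "\<zeta> \<in> hom X y y'"
    using XX.comma_homE[OF f[unfolded s t], unfolded id_func_simps] by blast
  obtain \<xi>' \<zeta>' where 2: "g = ((x', \<nu>', y'), (\<xi>', \<zeta>'), (x'', \<nu>'', y''))" "\<zeta>' \<in> hom X y' y''"
    using XX.comma_homE[OF g[unfolded t w], unfolded id_func_simps] by blast
  show "FA (comma_canonical P) (g \<cdot>\<^bsub>XX\<^esub> f) = FA (comma_canonical P) g \<cdot>\<^bsub>PM\<^esub> FA (comma_canonical P) f"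
    using functor_comp[OF functor_P 1(2) 2(2)] by (simp add: 1(1) 2(1) XX.comma_comp PM.comma_comp canonical)
qed

lemma functor_lift: "is_functor PM XX lift_func"
proof (rule functorI[OF PM.category_comma XX.category_comma])
  fix s assume s: "s \<in> Obj PM"
  obtain x \<beta> m where t: "s = (x, \<beta>, m)" by (metis prod.exhaust)
  show "FO lift_func s \<in> Obj XX" using s lift_obj_in by (simp add: t lift_func lift_obj)
  note l = lift[OF s[unfolded t]] and y = hom_cod[OF category_X lift(1)[OF s[unfolded t]]]
  have "lift_sq s s (Ide M m) = Ide X (Cod X (lift x \<beta>))"
    unfolding t by (rule lift_sq_eqI) (use ide_hom[OF category_X y] functor_ide[OF functor_P y] l(3) in simp_all)
  then show "FA lift_func (Ide PM s) = Ide XX (FO lift_func s)"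
    by (simp add: t lift_func lift_obj PM.comma_ide XX.comma_ide)
next
  fix f s t assume f: "f \<in> hom PM s t"
  obtain x \<beta> m where s: "s = (x, \<beta>, m)" by (metis prod.exhaust)
  obtain x' \<beta>' m' where t: "t = (x', \<beta>', m')" by (metis prod.exhaust)
  obtain \<xi> \<mu> where 1: "f = ((x, \<beta>, m), (\<xi>, \<mu>), (x', \<beta>', m'))"
    "(x, \<beta>, m) \<in> Obj PM" "(x', \<beta>', m') \<in> Obj PM" "\<xi> \<in> hom X x x'"
    using PM.comma_homE[OF f[unfolded s t], unfolded id_func_simps] by blast
  note q = lift_sq[OF f[unfolded s t 1(1)]]
  show "FA lift_func f \<in> hom XX (FO lift_func s) (FO lift_func t)"
    using lift_obj_in[OF 1(2)] lift_obj_in[OF 1(3)] 1(4) q by (simp add: 1(1) s t lift_func lift_obj XX.comma_hom)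
next
  fix f g s t w assume f: "f \<in> hom PM s t" and g: "g \<in> hom PM t w"
  obtain x \<beta> m where s: "s = (x, \<beta>, m)" by (metis prod.exhaust)
  obtain x' \<beta>' m' where t: "t = (x', \<beta>', m')" by (metis prod.exhaust)
  obtain x'' \<beta>'' m'' where w: "w = (x'', \<beta>'', m'')" by (metis prod.exhaust)
  obtain \<xi> \<mu> where 1: "f = ((x, \<beta>, m), (\<xi>, \<mu>), (x', \<beta>', m'))"
    using PM.comma_homE[OF f[unfolded s t], unfolded id_func_simps] by blast
  obtain \<xi>' \<mu>' where 2: "g = ((x', \<beta>', m'), (\<xi>', \<mu>'), (x'', \<beta>'', m''))"
    using PM.comma_homE[OF g[unfolded t w], unfolded id_func_simps] by blast
  note q = lift_sq[OF f[unfolded s t 1(1)]] and q' = lift_sq[OF g[unfolded t w 2(1)]]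
  have "lift_sq (x, \<beta>, m) (x'', \<beta>'', m'') (\<mu>' \<cdot>\<^bsub>M\<^esub> \<mu>) =
    lift_sq (x', \<beta>', m') (x'', \<beta>'', m'') \<mu>' \<cdot>\<^bsub>X\<^esub> lift_sq (x, \<beta>, m) (x', \<beta>', m') \<mu>"
    by (rule lift_sq_eqI[OF comp_hom[OF category_X q(1) q'(1)]])
      (use functor_comp[OF functor_P q(1) q'(1)] q(2) q'(2) in simp)
  then show "FA lift_func (g \<cdot>\<^bsub>PM\<^esub> f) = FA lift_func g \<cdot>\<^bsub>XX\<^esub> FA lift_func f"
    by (simp add: 1 2 PM.comma_comp XX.comma_comp lift_func lift_obj)
qed

lemma lift_canonical_obj:
  assumes "(x, \<nu>, y) \<in> Obj XX"
  shows "lift x (FA P \<nu>) = \<nu>" "lift_obj (x, FA P \<nu>, FO P y) = (x, \<nu>, y)"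
proof -
  have \<nu>: "\<nu> \<in> hom X x y" "FA F \<nu> = Ide A (FO F x)" using assms by (simp_all add: XX.comma_obj)
  show 1: "lift x (FA P \<nu>) = \<nu>"
    using lift_unique[OF \<nu>(1) lift(1)[OF canonical_obj_in[OF assms]] _ \<nu>(2)]
      lift(2)[OF canonical_obj_in[OF assms]] by simp
  then show "lift_obj (x, FA P \<nu>, FO P y) = (x, \<nu>, y)" using homD[OF \<nu>(1)] by (simp add: lift_obj)
qed

lemma canonical_lift: "func_eq PM (comma_canonical P \<bullet> lift_func) id_func"
  unfolding func_eq_def
proof (intro conjI ballI)
  fix s assume s: "s \<in> Obj PM"
  obtain x \<beta> m where t: "s = (x, \<beta>, m)" by (metis prod.exhaust)
  show "FO (comma_canonical P \<bullet> lift_func) s = FO id_func s"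
    using lift[OF s[unfolded t]] by (simp add: t comp_func_def lift_func lift_obj canonical)
next
  fix f assume "f \<in> Arr PM"
  then have f: "f \<in> hom PM (Dom PM f) (Cod PM f)" by (rule homI)
  obtain x \<beta> m where s: "Dom PM f = (x, \<beta>, m)" by (metis prod.exhaust)
  obtain x' \<beta>' m' where t: "Cod PM f = (x', \<beta>', m')" by (metis prod.exhaust)
  obtain \<xi> \<mu> where 1: "f = ((x, \<beta>, m), (\<xi>, \<mu>), (x', \<beta>', m'))"
    "(x, \<beta>, m) \<in> Obj PM" "(x', \<beta>', m') \<in> Obj PM"
    using PM.comma_homE[OF f[unfolded s t], unfolded id_func_simps] by blast
  note q = lift_sq[OF f[unfolded s t, unfolded 1(1)]]
  show "FA (comma_canonical P \<bullet> lift_func) f = FA id_func f"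
    using lift[OF 1(2)] lift[OF 1(3)] q by (simp add: 1(1) comp_func_def lift_func lift_obj canonical)
qed

lemma lift_canonical: "func_eq XX (lift_func \<bullet> comma_canonical P) id_func"
  unfolding func_eq_def
proof (intro conjI ballI)
  fix s assume s: "s \<in> Obj XX"
  obtain x \<nu> y where t: "s = (x, \<nu>, y)" by (metis prod.exhaust)
  show "FO (lift_func \<bullet> comma_canonical P) s = FO id_func s"
    using lift_canonical_obj(2)[OF s[unfolded t]] by (simp add: t comp_func_def lift_func canonical)
next
  fix f assume "f \<in> Arr XX"
  then have f: "f \<in> hom XX (Dom XX f) (Cod XX f)" by (rule homI)
  obtain x \<nu> y where s: "Dom XX f = (x, \<nu>, y)" by (metis prod.exhaust)
  obtain x' \<nu>' y' where t: "Cod XX f = (x', \<nu>', y')" by (metis prod.exhaust)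
  obtain \<xi> \<zeta> where 1: "f = ((x, \<nu>, y), (\<xi>, \<zeta>), (x', \<nu>', y'))"
    "(x, \<nu>, y) \<in> Obj XX" "(x', \<nu>', y') \<in> Obj XX" "\<zeta> \<in> hom X y y'"
    using XX.comma_homE[OF f[unfolded s t], unfolded id_func_simps] by blast
  have "\<nu> \<in> hom X x y" "\<nu>' \<in> hom X x' y'" using 1(2,3) by (simp_all add: XX.comma_obj)
  then have "lift_sq (x, FA P \<nu>, FO P y) (x', FA P \<nu>', FO P y') (FA P \<zeta>) = \<zeta>"
    using 1(4) lift_canonical_obj(1)[OF 1(2)] lift_canonical_obj(1)[OF 1(3)]
    by (intro lift_sq_eqI) (simp_all add: hom_def)
  then show "FA (lift_func \<bullet> comma_canonical P) f = FA id_func f"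
    using lift_canonical_obj(2)[OF 1(2)] lift_canonical_obj(2)[OF 1(3)]
    by (simp add: 1(1) comp_func_def lift_func canonical)
qed

lemma canonical_over: "func_eq XX (fib_comma_proj F \<bullet> comma_canonical P) (fib_comma_proj F)"
  by (auto simp: func_eq_def comp_func_def comma_canonical_def fib_comma_proj_def Let_def split: prod.splits)

theorem discrete_opfibration: "fib_discrete_opfibration A X F M G P"
  unfolding fib_discrete_opfibration_def Let_def
  using P isomorphism_adjunction[OF XX.fibration_comma PM.fibration_comma functor_canonical functor_lift
      lift_canonical canonical_lift canonical_over]
  by blast

end

section \<open>Fibers and zig-zags\<close>

lemma fiber_obj: "x \<in> Obj (fiber C A F a) \<longleftrightarrow> x \<in> Obj C \<and> FO F x = a"
  by (simp add: fiber_def)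

lemma fiber_hom: "f \<in> hom (fiber C A F a) x y \<longleftrightarrow> f \<in> hom C x y \<and> FA F f = Ide A a"
  by (auto simp: fiber_def hom_def)

lemma fiber_comp: "g \<cdot>\<^bsub>fiber C A F a\<^esub> f = g \<cdot>\<^bsub>C\<^esub> f"
  by (simp add: fiber_def)

lemma equiv_zigzag: "equiv (Obj C) (zigzag C)"
proof (rule equivI)
  show "zigzag C \<subseteq> Obj C \<times> Obj C" by (auto simp: zigzag_def)
  show "refl_on (Obj C) (zigzag C)" by (auto simp: refl_on_def zigzag_def)
  show "sym (zigzag C)" by (auto simp: sym_def zigzag_def intro: equivclp_sym)
  show "trans (zigzag C)" by (auto simp: trans_def zigzag_def intro: equivclp_trans)
qed

lemma zigzag_invariant:
  assumes "(x, y) \<in> zigzag C" and inv: "\<And>u v h. h \<in> hom C u v \<Longrightarrow> \<phi> u = \<phi> v"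
  shows "\<phi> x = \<phi> y"
proof -
  have "equivclp (\<lambda>u v. hom C u v \<noteq> {}) x y" using assms(1) by (simp add: zigzag_def)
  then show ?thesis
  proof (induction rule: equivclp_induct)
    case (step y z)
    then have "\<phi> y = \<phi> z" using inv by (metis ex_in_conv)
    with step.IH show ?case by simp
  qed simp
qed

lemma cartesian_ide:
  assumes F: "is_functor C A F" and x: "x \<in> Obj C"
  shows "cartesian C A F (Ide C x)"
proof (rule cartesianI)
  note C = functor_cat[OF F, THEN conjunct1] and A = functor_cat[OF F, THEN conjunct2]
  show "Ide C x \<in> hom C x x" using ide_hom[OF C x] .
  fix w g \<alpha>
  assume g: "g \<in> hom C w x" and \<alpha>: "\<alpha> \<in> hom A (FO F w) (FO F x)"
    and "FA F (Ide C x) \<cdot>\<^bsub>A\<^esub> \<alpha> = FA F g"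
  then have "FA F g = \<alpha>" using functor_ide[OF F x] ide_comp[OF A \<alpha>] by simp
  then show "\<exists>h. h \<in> hom C w x \<and> Ide C x \<cdot>\<^bsub>C\<^esub> h = g \<and> FA F h = \<alpha>"
    using g ide_comp[OF C g] by blast
next
  note C = functor_cat[OF F, THEN conjunct1]
  fix w h h'
  assume "h \<in> hom C w x" "h' \<in> hom C w x" "Ide C x \<cdot>\<^bsub>C\<^esub> h = Ide C x \<cdot>\<^bsub>C\<^esub> h'"
  then show "h = h'" using ide_comp[OF C] by metis
qed

section \<open>Liftings along a fiberwise opfibration\<close>

locale component_quotient =
  fixes A :: "('c, 'd) cat"
    and X :: "('o, 'a) cat" and F :: "('o, 'a, 'c, 'd) func"
    and M :: "('p, 'b) cat" and G :: "('p, 'b, 'c, 'd) func"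
    and P :: "('o, 'a, 'p, 'b) func"
    and \<kappa> :: "'p \<Rightarrow> 'd \<Rightarrow> 'b"
  assumes P: "fib_1cell A X F M G P"
    and fiberwise: "fiberwise_opfibration A X F M G P"
    and split: "split_cleavage M A G \<kappa>"
begin

lemmas functor_F = fib_1cellD(1)[OF P] and functor_G = fib_1cellD(2)[OF P] and functor_P = fib_1cellD(3)[OF P]
  and GP = fib_1cellD(4)[OF P] and P_cartesian = fib_1cellD(5)[OF P]
lemmas category_X = functor_cat[OF functor_F, THEN conjunct1] and category_A = functor_cat[OF functor_F, THEN conjunct2]
  and category_M = functor_cat[OF functor_G, THEN conjunct1]

lemma fibX: "fibration X A F" and fibM: "fibration M A G"
  using P by (simp_all add: fib_1cell_def)

text \<open>
  Since \<open>P k\<close> is cartesian, the factorization of \<open>f\<close> through \<open>k\<close> over \<open>G v\<close> lies over \<open>v\<close> itself.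
\<close>

lemma factor:
  assumes f: "f \<in> hom X x z" and k: "k \<in> hom X w z" "cartesian X A F k"
    and v: "v \<in> hom M (FO P x) (FO P w)" and eq: "FA P k \<cdot>\<^bsub>M\<^esub> v = FA P f"
  obtains g where "g \<in> hom X x w" "k \<cdot>\<^bsub>X\<^esub> g = f" "FA P g = v"
proof -
  note Pk = functor_hom[OF functor_P k(1)]
  have 1: "FA G v \<in> hom A (FO F x) (FO F w)"
    using functor_hom[OF functor_G v] func_eq_obj[OF GP hom_dom[OF category_X f]] func_eq_obj[OF GP hom_dom[OF category_X k(1)]] by simp
  have 2: "FA F k \<cdot>\<^bsub>A\<^esub> FA G v = FA F f"
    using func_eq_arr[OF GP k(1)] func_eq_arr[OF GP f] functor_comp[OF functor_G v Pk] eq by simp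
  obtain g where g: "g \<in> hom X x w" "k \<cdot>\<^bsub>X\<^esub> g = f" "FA F g = FA G v"
    using cartesian_lift[OF k(2,1) f 1 2] .
  have "FA P g = v"
  proof (rule cartesian_unique[OF functor_G P_cartesian[OF k(2)] Pk functor_hom[OF functor_P g(1)] v])
    show "FA P k \<cdot>\<^bsub>M\<^esub> FA P g = FA P k \<cdot>\<^bsub>M\<^esub> v" using functor_comp[OF functor_P g(1) k(1)] g(2) eq by simp
    show "FA G (FA P g) = FA G v" using func_eq_arr[OF GP g(1)] g(3) by simp
  qed
  with that g show thesis by blast
qed

text \<open>
  An arrow of \<open>X\<close> lies in a fiber of \<open>F\<close> exactly if its image under \<open>P\<close> is \<open>G\<close>-vertical, because
  \<open>G \<cdot> P = F\<close>. The universal property of an opcartesian lifting in a fiber thus becomes a property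
  of all arrows of \<open>X\<close> with vertical image.
\<close>

lemma vertical_lift:
  assumes x: "x \<in> Obj X" and v: "v \<in> hom M (FO P x) n" "FA G v = Ide A (FO F x)"
  obtains p y where "p \<in> hom X x y" "FA P p = v"
    "\<forall>z. \<forall>g \<in> hom X x z. \<forall>w \<in> hom M n (FO P z). FA G w = Ide A (FO F x) \<longrightarrow>
      w \<cdot>\<^bsub>M\<^esub> v = FA P g \<longrightarrow> (\<exists>!h. h \<in> hom X y z \<and> h \<cdot>\<^bsub>X\<^esub> p = g \<and> FA P h = w)"
proof -
  let ?a = "FO F x" and ?X = "fiber X A F (FO F x)" and ?M = "fiber M A G (FO F x)"
  have a: "?a \<in> Obj A" using functor_obj[OF functor_F x] .
  obtain lft where lft: "opcleavage ?X ?M P lft"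
    using fiberwise a unfolding fiberwise_opfibration_def opfibration_def by blast
  define p where "p = lft x v"
  have "x \<in> Obj ?X" "v \<in> Arr ?M" "Dom ?M v = FO P x"
    using x v by (simp_all add: fiber_def hom_def)
  then have p: "opcartesian ?X ?M P p" "Dom ?X p = x" "FA P p = v"
    using lft unfolding opcleavage_def p_def by blast+
  define y where "y = Cod X p"
  have pX: "p \<in> hom X x y" and Fp: "FA F p = Ide A ?a"
    using p(1,2) by (simp_all add: opcartesian_def fiber_def hom_def y_def)
  have Py: "FO P y = n" using functor_hom[OF functor_P pX] p(3) v(1) by (simp add: hom_def)
  have "\<exists>!h. h \<in> hom X y z \<and> h \<cdot>\<^bsub>X\<^esub> p = g \<and> FA P h = w"
    if g: "g \<in> hom X x z" and w: "w \<in> hom M n (FO P z)" "FA G w = Ide A ?a" "w \<cdot>\<^bsub>M\<^esub> v = FA P g" for z g w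
  proof -
    have I: "Ide A ?a \<in> hom A ?a ?a" using ide_hom[OF category_A a] .
    have Fg: "FA F g = Ide A ?a"
      using func_eq_arr[OF GP g] functor_comp[OF functor_G v(1) w(1)] v(2) w(2,3) comp_ide[OF category_A I] by simp
    have "g \<in> Arr ?X" "w \<in> hom ?M (FO P (Cod ?X p)) (FO P (Cod ?X g))" "Dom ?X g = Dom ?X p"
      using g Fg w(1,2) Py pX by (auto simp: fiber_def hom_def y_def)
    moreover have "w \<cdot>\<^bsub>?M\<^esub> FA P p = FA P g" using w(3) p(3) by (simp add: fiber_comp)
    ultimately have "\<exists>!h. h \<in> hom ?X (Cod ?X p) (Cod ?X g) \<and> h \<cdot>\<^bsub>?X\<^esub> p = g \<and> FA P h = w"
      using p(1) unfolding opcartesian_def by blast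
    then have ex: "\<exists>!h. h \<in> hom ?X y z \<and> h \<cdot>\<^bsub>X\<^esub> p = g \<and> FA P h = w"
      using g by (simp add: fiber_def hom_def y_def)
    have "h \<in> hom ?X y z \<longleftrightarrow> h \<in> hom X y z" if "FA P h = w" for h
      using func_eq_arr[OF GP, of h y z] that w(2) by (auto simp: fiber_hom)
    with ex show ?thesis by metis
  qed
  then show thesis by (intro that[OF pX p(3)]) blast
qed

lemma vertical_lift_ex:
  assumes "x \<in> Obj X" "v \<in> hom M (FO P x) n" "FA G v = Ide A (FO F x)"
  obtains p y where "p \<in> hom X x y" "FA P p = v"
  by (rule vertical_lift[OF assms]) (rule that)

text \<open>
  A cartesian lifting in \<open>X\<close> of \<open>G k\<close> is sent by \<open>P\<close> to a cartesian arrow that differs from \<open>k\<close> by a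
  vertical isomorphism. Lifting this isomorphism with the opfibration on the fiber corrects the
  difference, so cartesian arrows lift along \<open>P\<close> strictly.
\<close>

lemma cartesian_lift_over:
  assumes y: "y \<in> Obj X" and k: "k \<in> hom M m (FO P y)" "cartesian M A G k"
  obtains x f where "f \<in> hom X x y" "cartesian X A F f" "FA P f = k" "FO P x = m"
proof -
  have Gk: "FA G k \<in> hom A (FO G m) (FO F y)"
    using functor_hom[OF functor_G k(1)] func_eq_obj[OF GP y] by simp
  obtain z f where f: "f \<in> hom X z y" "cartesian X A F f" "FA F f = FA G k" "FO F z = FO G m"
    using fibration_lift[OF fibX y Gk] .
  note Pf = functor_hom[OF functor_P f(1)] and z = hom_dom[OF category_X f(1)]
  have Gkf: "FA G k = FA G (FA P f)" using func_eq_arr[OF GP f(1)] f(3) by simp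
  obtain i j where i: "i \<in> hom M (FO P z) m" and j: "j \<in> hom M m (FO P z)"
    and ij: "i \<cdot>\<^bsub>M\<^esub> j = Ide M m" and ji: "j \<cdot>\<^bsub>M\<^esub> i = Ide M (FO P z)" and kj: "FA P f \<cdot>\<^bsub>M\<^esub> j = k"
    and Gi: "FA G i = Ide A (FO F z)" and Gj: "FA G j = Ide A (FO F z)"
    using cartesian_comparison[OF functor_G k(2,1) P_cartesian[OF f(2)] Pf Gkf] f(4) by metis
  \<comment> \<open>An opcartesian lifting of an isomorphism is an isomorphism.\<close>
  obtain p x where p: "p \<in> hom X z x" "FA P p = i"
    and op: "\<forall>z'. \<forall>g \<in> hom X z z'. \<forall>w \<in> hom M m (FO P z'). FA G w = Ide A (FO F z) \<longrightarrow>
      w \<cdot>\<^bsub>M\<^esub> i = FA P g \<longrightarrow> (\<exists>!h. h \<in> hom X x z' \<and> h \<cdot>\<^bsub>X\<^esub> p = g \<and> FA P h = w)"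
    using vertical_lift[OF z i Gi] .
  note x = hom_cod[OF category_X p(1)] and Iz = ide_hom[OF category_X z]
  have Px: "FO P x = m" using functor_hom[OF functor_P p(1)] p(2) i by (simp add: hom_def)
  have m: "m \<in> Obj M" using hom_dom[OF category_M k(1)] .
  have "\<exists>!h. h \<in> hom X x z \<and> h \<cdot>\<^bsub>X\<^esub> p = Ide X z \<and> FA P h = j"
    using op[rule_format, OF Iz j Gj] ji functor_ide[OF functor_P z] by simp
  then obtain q where q: "q \<in> hom X x z" "q \<cdot>\<^bsub>X\<^esub> p = Ide X z" "FA P q = j" by blast
  note pq = comp_hom[OF category_X q(1) p(1)] and Ix = ide_hom[OF category_X x]
  have "Ide M m \<in> hom M m (FO P x)" using ide_hom[OF category_M m] Px by simp
  moreover have "FA G (Ide M m) = Ide A (FO F z)" using functor_ide[OF functor_G m] f(4) by simp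
  moreover have "Ide M m \<cdot>\<^bsub>M\<^esub> i = FA P p" using p(2) ide_comp[OF category_M i] by simp
  ultimately have "\<exists>!h. h \<in> hom X x x \<and> h \<cdot>\<^bsub>X\<^esub> p = p \<and> FA P h = Ide M m"
    by (rule op[rule_format, OF p(1)])
  moreover have "(p \<cdot>\<^bsub>X\<^esub> q) \<cdot>\<^bsub>X\<^esub> p = p"
    using comp_assoc[OF category_X p(1) q(1) p(1)] q(2) comp_ide[OF category_X p(1)] by simp
  moreover have "FA P (p \<cdot>\<^bsub>X\<^esub> q) = Ide M m" using functor_comp[OF functor_P q(1) p(1)] p(2) q(3) ij by simp
  moreover have "Ide X x \<cdot>\<^bsub>X\<^esub> p = p" "FA P (Ide X x) = Ide M m"
    using ide_comp[OF category_X p(1)] functor_ide[OF functor_P x] Px by simp_all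
  ultimately have "p \<cdot>\<^bsub>X\<^esub> q = Ide X x" using pq Ix by blast
  then have "cartesian X A F (f \<cdot>\<^bsub>X\<^esub> q)"
    using cartesian_comp_iso[OF functor_F f(2,1) q(1) p(1)] q(2) by simp
  moreover have "FA P (f \<cdot>\<^bsub>X\<^esub> q) = k" using functor_comp[OF functor_P q(1) f(1)] q(3) kj by simp
  ultimately show thesis using that[OF comp_hom[OF category_X q(1) f(1)]] Px by blast
qed

section \<open>Transport of connected components\<close>

definition comps :: "'p \<Rightarrow> 'o set set" where
  "comps m = components (fiber X M P m)"

definition cls :: "'o \<Rightarrow> 'o set" where
  "cls x = component (fiber X M P (FO P x)) x"

lemma mem_cls: "y \<in> cls x \<longleftrightarrow> (x, y) \<in> zigzag (fiber X M P (FO P x))"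
  by (simp add: cls_def component_def)

lemma cls_eq_iff:
  assumes "x \<in> Obj X" "y \<in> Obj X" "FO P x = FO P y"
  shows "cls x = cls y \<longleftrightarrow> (x, y) \<in> zigzag (fiber X M P (FO P x))"
  using assms eq_equiv_class_iff[OF equiv_zigzag, of x "fiber X M P (FO P x)" y]
  by (simp add: cls_def component_def fiber_obj)

lemma cls_self: "x \<in> Obj X \<Longrightarrow> x \<in> cls x"
  using cls_eq_iff[of x x] by (simp add: mem_cls)

lemma mem_clsD:
  assumes "y \<in> cls x"
  shows "x \<in> Obj X" "y \<in> Obj X" "FO P y = FO P x" "cls y = cls x"
proof -
  have "(x, y) \<in> zigzag (fiber X M P (FO P x))" using assms by (simp add: mem_cls)
  then show x: "x \<in> Obj X" and y: "y \<in> Obj X" and eq: "FO P y = FO P x"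
    by (auto simp: zigzag_def fiber_obj)
  then show "cls y = cls x" using cls_eq_iff[OF x y] assms by (simp add: mem_cls)
qed

lemma comps_iff: "C \<in> comps m \<longleftrightarrow> (\<exists>x \<in> Obj X. FO P x = m \<and> C = cls x)"
  by (auto simp: comps_def components_def quotient_def cls_def component_def fiber_obj)

lemma cls_comps: "x \<in> Obj X \<Longrightarrow> cls x \<in> comps (FO P x)"
  by (auto simp: comps_iff)

lemma cls_arrow:
  assumes h: "h \<in> hom X u v" and Ph: "FA P h = Ide M m" and m: "m \<in> Obj M"
  shows "cls u = cls v"
proof -
  have "FO P u = m" "FO P v = m"
    using functor_hom[OF functor_P h] Ph ide_hom[OF category_M m] by (simp_all add: hom_def)
  moreover have "u \<in> Obj X" "v \<in> Obj X" using hom_dom[OF category_X h] hom_cod[OF category_X h] by simp_all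
  moreover have "h \<in> hom (fiber X M P m) u v" using h Ph by (simp add: fiber_hom)
  then have "equivclp (\<lambda>u v. hom (fiber X M P m) u v \<noteq> {}) u v"
    by (metis empty_iff r_into_equivclp)
  ultimately show ?thesis by (simp add: cls_eq_iff zigzag_def fiber_obj)
qed

lemma cls_invariant:
  assumes y: "y \<in> cls x"
    and inv: "\<And>u v h. h \<in> hom X u v \<Longrightarrow> FO P u = FO P x \<Longrightarrow> FO P v = FO P x \<Longrightarrow>
      FA P h = Ide M (FO P x) \<Longrightarrow> \<phi> u = \<phi> v"
  shows "\<phi> y = \<phi> x"
proof -
  note x = mem_clsD(1)[OF y]
  have "\<phi> x = \<phi> y"
  proof (rule zigzag_invariant[where C = "fiber X M P (FO P x)"])
    show "(x, y) \<in> zigzag (fiber X M P (FO P x))" using y by (simp add: mem_cls)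
    fix u v h assume "h \<in> hom (fiber X M P (FO P x)) u v"
    then have h: "h \<in> hom X u v" "FA P h = Ide M (FO P x)" by (simp_all add: fiber_hom)
    have "FO P u = FO P x" "FO P v = FO P x"
      using functor_hom[OF functor_P h(1)] h(2) ide_hom[OF category_M functor_obj[OF functor_P x]] by (simp_all add: hom_def)
    with inv h show "\<phi> u = \<phi> v" by blast
  qed
  then show ?thesis ..
qed

text \<open>
  The sets in the union turn out to be equal to each other when \<open>v\<close> is vertical and \<open>C\<close> a component,
  so that neither a representative nor a lifting has to be chosen; likewise below for a cartesian
  arrow.
\<close>

definition push :: "'b \<Rightarrow> 'o set \<Rightarrow> 'o set" where
  "push v C = \<Union> {cls (Cod X f) | f. f \<in> Arr X \<and> Dom X f \<in> C \<and> FA P f = v}"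

definition pull :: "'b \<Rightarrow> 'o set \<Rightarrow> 'o set" where
  "pull k C = \<Union> {cls (Dom X f) | f. cartesian X A F f \<and> Cod X f \<in> C \<and> FA P f = k}"

text \<open>
  Both arrows factor through one opcartesian lifting by arrows over an identity.
\<close>

lemma vertical_arrows_same_cls:
  assumes f: "f \<in> hom X x y" and g: "g \<in> hom X x z" and eq: "FA P f = FA P g"
    and v: "FA F f = Ide A (FO F x)"
  shows "cls y = cls z"
proof -
  note x = hom_dom[OF category_X f] and y = hom_cod[OF category_X f] and Pf = functor_hom[OF functor_P f]
  have Gv: "FA G (FA P f) = Ide A (FO F x)" using v func_eq_arr[OF GP f] by simp
  have "FO F y = FO F x"
    using functor_hom[OF functor_F f] v ide_hom[OF category_A functor_obj[OF functor_F x]] by (simp add: hom_def)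
  then have GI: "FA G (Ide M (FO P y)) = Ide A (FO F x)"
    using functor_ide[OF functor_G functor_obj[OF functor_P y]] func_eq_obj[OF GP y] by simp
  note I = ide_hom[OF category_M functor_obj[OF functor_P y]]
  obtain p w where "p \<in> hom X x w"
    and op: "\<forall>z. \<forall>g \<in> hom X x z. \<forall>u \<in> hom M (FO P y) (FO P z). FA G u = Ide A (FO F x) \<longrightarrow>
      u \<cdot>\<^bsub>M\<^esub> FA P f = FA P g \<longrightarrow> (\<exists>!h. h \<in> hom X w z \<and> h \<cdot>\<^bsub>X\<^esub> p = g \<and> FA P h = u)"
    using vertical_lift[OF x Pf Gv] .
  have *: "cls w = cls y'" if g': "g' \<in> hom X x y'" "FA P g' = FA P f" for g' y'
  proof -
    have "FO P y' = FO P y" using functor_hom[OF functor_P g'(1)] g'(2) Pf by (simp add: hom_def)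
    then have "\<exists>!h. h \<in> hom X w y' \<and> h \<cdot>\<^bsub>X\<^esub> p = g' \<and> FA P h = Ide M (FO P y)"
      by (intro op[rule_format, OF g'(1) _ GI]) (simp_all add: I g'(2) ide_comp[OF category_M Pf])
    then obtain h where "h \<in> hom X w y'" "FA P h = Ide M (FO P y)" by blast
    then show ?thesis by (rule cls_arrow[OF _ _ functor_obj[OF functor_P y]])
  qed
  from *[OF f refl] *[OF g eq[symmetric]] show ?thesis by simp
qed

text \<open>
  Precomposing with an arrow \<open>u \<rightarrow> w\<close> of the fiber turns a lifting at \<open>w\<close> into one at \<open>u\<close> with the same
  codomain. So the component that is reached stays constant along zig-zags.
\<close>

lemma push_cls:
  assumes f: "f \<in> hom X x y" and v: "FA F f = Ide A (FO F x)"
  shows "push (FA P f) (cls x) = cls y"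
proof -
  note x = hom_dom[OF category_X f]
  define \<phi> where "\<phi> u = {cls (Cod X g) | g. g \<in> Arr X \<and> Dom X g = u \<and> FA P g = FA P f}" for u
  have Gv: "FA G (FA P f) = Ide A (FO F x)" using v func_eq_arr[OF GP f] by simp
  have \<phi>I: "\<phi> u = {cls z}" if g: "g \<in> hom X u z" and eq: "FA P g = FA P f" for u g z
  proof -
    have Pu: "FO P u = FO P x" using functor_hom[OF functor_P g] functor_hom[OF functor_P f] eq by (simp add: hom_def)
    have "FO F u = FO F x"
      using func_eq_obj[OF GP hom_dom[OF category_X g]] func_eq_obj[OF GP x] Pu by simp
    then have Fg: "FA F g = Ide A (FO F u)" using func_eq_arr[OF GP g] eq Gv by simp
    have "cls (Cod X g') = cls z" if "g' \<in> Arr X" "Dom X g' = u" "FA P g' = FA P f" for g'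
      using vertical_arrows_same_cls[OF g _ _ Fg, of g' "Cod X g'"] that eq by (simp add: hom_def)
    then show ?thesis using g eq by (auto simp: \<phi>_def hom_def)
  qed
  have "\<phi> u = \<phi> x" if u: "u \<in> cls x" for u
  proof (rule cls_invariant[OF u])
    fix u w h
    assume h: "h \<in> hom X u w" and Pu: "FO P u = FO P x" and Pw: "FO P w = FO P x"
      and Ph: "FA P h = Ide M (FO P x)"
    note w = hom_cod[OF category_X h]
    have "FA P f \<in> hom M (FO P w) (FO P y)" using functor_hom[OF functor_P f] Pw by simp
    moreover have "FA G (FA P f) = Ide A (FO F w)"
      using Gv func_eq_obj[OF GP w] func_eq_obj[OF GP x] Pw by simp
    ultimately obtain g z where g: "g \<in> hom X w z" "FA P g = FA P f"
      using vertical_lift_ex[OF w] by blast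
    have "FA P (g \<cdot>\<^bsub>X\<^esub> h) = FA P f"
      using functor_comp[OF functor_P h g(1)] g(2) Ph comp_ide[OF category_M functor_hom[OF functor_P f]] by simp
    then show "\<phi> u = \<phi> w" using \<phi>I[OF g] \<phi>I[OF comp_hom[OF category_X h g(1)]] by simp
  qed
  then have "cls (Cod X g) = cls y" if "g \<in> Arr X" "Dom X g \<in> cls x" "FA P g = FA P f" for g
    using \<phi>I[OF f refl] \<phi>I[OF homI that(3)] that by simp
  then show ?thesis using f cls_self[OF x] unfolding push_def hom_def by blast
qed

text \<open>
  The arrow \<open>h \<cdot> f\<close> factors through \<open>g\<close> by an arrow over an identity.
\<close>

lemma cartesian_arrows_same_cls:
  assumes f: "f \<in> hom X x y" and g: "g \<in> hom X x' y'" "cartesian X A F g" and eq: "FA P f = FA P g"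
    and h: "h \<in> hom X y y'" "FA P h = Ide M (FO P y)"
  shows "cls x = cls x'"
proof -
  note x = hom_dom[OF category_X f] and Pf = functor_hom[OF functor_P f]
  have Px: "FO P x = FO P x'" using Pf functor_hom[OF functor_P g(1)] eq by (simp add: hom_def)
  have I: "Ide M (FO P x) \<in> hom M (FO P x) (FO P x')"
    using ide_hom[OF category_M functor_obj[OF functor_P x]] Px by simp
  have "FA P g \<cdot>\<^bsub>M\<^esub> Ide M (FO P x) = FA P (h \<cdot>\<^bsub>X\<^esub> f)"
    using eq comp_ide[OF category_M Pf] functor_comp[OF functor_P f h(1)] h(2) ide_comp[OF category_M Pf] by simp
  then obtain u where "u \<in> hom X x x'" "FA P u = Ide M (FO P x)"
    using factor[OF comp_hom[OF category_X f h(1)] g I] by blast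
  then show ?thesis using cls_arrow[OF _ _ functor_obj[OF functor_P x]] by blast
qed

lemma pull_cls:
  assumes f: "f \<in> hom X x y" and c: "cartesian X A F f"
  shows "pull (FA P f) (cls y) = cls x"
proof -
  note y = hom_cod[OF category_X f]
  define \<phi> where "\<phi> u = {cls (Dom X g) | g. cartesian X A F g \<and> Cod X g = u \<and> FA P g = FA P f}" for u
  have \<phi>I: "\<phi> u = {cls z}" if g: "g \<in> hom X z u" "cartesian X A F g" and eq: "FA P g = FA P f" for u g z
  proof -
    note u = hom_cod[OF category_X g(1)]
    have "cls (Dom X g') = cls z" if "cartesian X A F g'" "Cod X g' = u" "FA P g' = FA P f" for g'
      using cartesian_arrows_same_cls[OF _ g, of g' "Dom X g'" u "Ide X u"] that eq cartesian_arr[OF that(1)]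
        ide_hom[OF category_X u] functor_ide[OF functor_P u] by simp
    then show ?thesis using g eq by (auto simp: \<phi>_def hom_def)
  qed
  have "\<phi> u = \<phi> y" if u: "u \<in> cls y" for u
  proof (rule cls_invariant[OF u])
    fix u w h
    assume h: "h \<in> hom X u w" and Pu: "FO P u = FO P y" and Pw: "FO P w = FO P y"
      and Ph: "FA P h = Ide M (FO P y)"
    obtain a g where g: "g \<in> hom X a u" "cartesian X A F g" "FA P g = FA P f"
      using cartesian_lift_over[OF hom_dom[OF category_X h]] functor_hom[OF functor_P f] P_cartesian[OF c] Pu by metis
    obtain b g' where g': "g' \<in> hom X b w" "cartesian X A F g'" "FA P g' = FA P f"
      using cartesian_lift_over[OF hom_cod[OF category_X h]] functor_hom[OF functor_P f] P_cartesian[OF c] Pw by metis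
    have "cls a = cls b"
      using cartesian_arrows_same_cls[OF g(1) g'(1,2) _ h] g(3) g'(3) Ph Pu by simp
    then show "\<phi> u = \<phi> w" using \<phi>I[OF g] \<phi>I[OF g'] by simp
  qed
  then have "cls (Dom X g) = cls x" if "cartesian X A F g" "Cod X g \<in> cls y" "FA P g = FA P f" for g
    using \<phi>I[OF f c refl] \<phi>I[OF cartesian_arr[OF that(1)] that(1,3)] that by simp
  then show ?thesis using f c cls_self[OF y] unfolding pull_def hom_def by blast
qed

lemma push_rep:
  assumes C: "C \<in> comps m" and v: "v \<in> hom M m n" "FA G v = Ide A (FO G m)"
  obtains f x y where "f \<in> hom X x y" "FA P f = v" "FA F f = Ide A (FO F x)"
    "C = cls x" "push v C = cls y" "FO P x = m" "FO P y = n"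
proof -
  obtain x where x: "x \<in> Obj X" "FO P x = m" "C = cls x" using C by (auto simp: comps_iff)
  have Gm: "FO G m = FO F x" using func_eq_obj[OF GP x(1)] x(2) by simp
  obtain f y where f: "f \<in> hom X x y" "FA P f = v"
    using vertical_lift_ex[OF x(1), of v n] v x(2) Gm by metis
  have "FA F f = Ide A (FO F x)" using func_eq_arr[OF GP f(1)] f(2) v(2) Gm by simp
  moreover have "FO P y = n" using functor_hom[OF functor_P f(1)] f(2) v(1) by (simp add: hom_def)
  ultimately show thesis using that[OF f] x push_cls[OF f(1)] f(2) by simp
qed

lemma pull_rep:
  assumes C: "C \<in> comps n" and k: "k \<in> hom M m n" "cartesian M A G k"
  obtains f x y where "f \<in> hom X x y" "FA P f = k" "cartesian X A F f"
    "C = cls y" "pull k C = cls x" "FO P x = m" "FO P y = n"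
proof -
  obtain y where y: "y \<in> Obj X" "FO P y = n" "C = cls y" using C by (auto simp: comps_iff)
  obtain x f where f: "f \<in> hom X x y" "cartesian X A F f" "FA P f = k" "FO P x = m"
    using cartesian_lift_over[OF y(1), of k m] k y(2) by metis
  show thesis using that[OF f(1,3,2)] y pull_cls[OF f(1,2)] f by simp
qed

lemma push_comps:
  assumes C: "C \<in> comps m" and v: "v \<in> hom M m n" "FA G v = Ide A (FO G m)"
  shows "push v C \<in> comps n"
proof -
  obtain f x y where "f \<in> hom X x y" "push v C = cls y" "FO P y = n"
    using push_rep[OF assms] by metis
  then show ?thesis using cls_comps hom_cod[OF category_X] by metis
qed

lemma pull_comps:
  assumes C: "C \<in> comps n" and k: "k \<in> hom M m n" "cartesian M A G k"
  shows "pull k C \<in> comps m"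
proof -
  obtain f x y where "f \<in> hom X x y" "pull k C = cls x" "FO P x = m"
    using pull_rep[OF assms] by metis
  then show ?thesis using cls_comps hom_dom[OF category_X] by metis
qed

lemma push_ide: assumes C: "C \<in> comps m" shows "push (Ide M m) C = C"
proof -
  obtain x where x: "x \<in> Obj X" "FO P x = m" "C = cls x" using C by (auto simp: comps_iff)
  show ?thesis
    using push_cls[OF ide_hom[OF category_X x(1)]] functor_ide[OF functor_F x(1)] functor_ide[OF functor_P x(1)] x by simp
qed

lemma pull_ide: assumes C: "C \<in> comps m" shows "pull (Ide M m) C = C"
proof -
  obtain x where x: "x \<in> Obj X" "FO P x = m" "C = cls x" using C by (auto simp: comps_iff)
  show ?thesis
    using pull_cls[OF ide_hom[OF category_X x(1)] cartesian_ide[OF functor_F x(1)]] functor_ide[OF functor_P x(1)] x by simp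
qed

lemma push_comp:
  assumes C: "C \<in> comps l" and v: "v \<in> hom M l m" "FA G v = Ide A (FO G l)"
    and w: "w \<in> hom M m n" "FA G w = Ide A (FO G m)"
  shows "push (w \<cdot>\<^bsub>M\<^esub> v) C = push w (push v C)"
proof -
  obtain f x y where f: "f \<in> hom X x y" "FA P f = v" "FA F f = Ide A (FO F x)"
    "C = cls x" "push v C = cls y" "FO P x = l" "FO P y = m"
    using push_rep[OF C v] .
  note y = hom_cod[OF category_X f(1)] and x = hom_dom[OF category_X f(1)]
  have I: "Ide A (FO F x) \<in> hom A (FO F x) (FO F x)" using ide_hom[OF category_A functor_obj[OF functor_F x]] .
  have Fy: "FO F y = FO F x" using functor_hom[OF functor_F f(1)] f(3) I by (simp add: hom_def)
  have Gm: "FO G m = FO F y" using func_eq_obj[OF GP y] f(7) by simp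
  obtain g z where g: "g \<in> hom X y z" "FA P g = w"
    using vertical_lift_ex[OF y, of w n] w f(7) Gm by metis
  have Fg: "FA F g = Ide A (FO F y)" using func_eq_arr[OF GP g(1)] g(2) w(2) Gm by simp
  have "FA F (g \<cdot>\<^bsub>X\<^esub> f) = Ide A (FO F x)"
    using functor_comp[OF functor_F f(1) g(1)] f(3) Fg Fy comp_ide[OF category_A I] by simp
  then have "push (w \<cdot>\<^bsub>M\<^esub> v) C = cls z"
    using push_cls[OF comp_hom[OF category_X f(1) g(1)]] functor_comp[OF functor_P f(1) g(1)] f g by simp
  moreover have "push w (push v C) = cls z" using push_cls[OF g(1) Fg] f(5) g(2) by simp
  ultimately show ?thesis by simp
qed

lemma pull_comp:
  assumes C: "C \<in> comps n" and k: "k \<in> hom M m n" "cartesian M A G k"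
    and k': "k' \<in> hom M l m" "cartesian M A G k'"
  shows "pull (k \<cdot>\<^bsub>M\<^esub> k') C = pull k' (pull k C)"
proof -
  obtain f x y where f: "f \<in> hom X x y" "FA P f = k" "cartesian X A F f"
    "C = cls y" "pull k C = cls x" "FO P x = m" "FO P y = n"
    using pull_rep[OF C k] .
  obtain w g where g: "g \<in> hom X w x" "cartesian X A F g" "FA P g = k'"
    using cartesian_lift_over[OF hom_dom[OF category_X f(1)], of k' l] k' f(6) by metis
  have "pull (k \<cdot>\<^bsub>M\<^esub> k') C = cls w"
    using pull_cls[OF comp_hom[OF category_X g(1) f(1)] cartesian_comp[OF functor_F f(3,1) g(2,1)]]
      functor_comp[OF functor_P g(1) f(1)] f g by simp
  moreover have "pull k' (pull k C) = cls w" using pull_cls[OF g(1,2)] f(5) g(3) by simp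
  ultimately show ?thesis by simp
qed

text \<open>
  Represent \<open>C\<close> by \<open>x\<close>, and lift \<open>k\<close> to \<open>y \<rightarrow> x\<close>, \<open>v\<close> to \<open>x \<rightarrow> z\<close> and \<open>k'\<close> to a cartesian \<open>w \<rightarrow> z\<close>.
  The composite \<open>y \<rightarrow> x \<rightarrow> z\<close> factors through \<open>w \<rightarrow> z\<close>, and the factor \<open>y \<rightarrow> w\<close> lies over \<open>v'\<close>. So it
  shows that pushing the component of \<open>y\<close> along \<open>v'\<close> gives the component of \<open>w\<close>.
\<close>

lemma beck_chevalley:
  assumes C: "C \<in> comps n" and k: "k \<in> hom M l n" "cartesian M A G k"
    and v: "v \<in> hom M n p" "FA G v = Ide A (FO G n)"
    and k': "k' \<in> hom M q p" "cartesian M A G k'"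
    and v': "v' \<in> hom M l q" "FA G v' = Ide A (FO G l)"
    and sq: "k' \<cdot>\<^bsub>M\<^esub> v' = v \<cdot>\<^bsub>M\<^esub> k"
  shows "push v' (pull k C) = pull k' (push v C)"
proof -
  obtain f y x where f: "f \<in> hom X y x" "FA P f = k" "cartesian X A F f"
    "C = cls x" "pull k C = cls y" "FO P y = l" "FO P x = n"
    using pull_rep[OF C k] .
  note x = hom_cod[OF category_X f(1)]
  have Gn: "FO G n = FO F x" using func_eq_obj[OF GP x] f(7) by simp
  obtain g z where g: "g \<in> hom X x z" "FA P g = v"
    using vertical_lift_ex[OF x, of v p] v f(7) Gn by metis
  have Fg: "FA F g = Ide A (FO F x)" using func_eq_arr[OF GP g(1)] g(2) v(2) Gn by simp
  have pz: "push v C = cls z" using push_cls[OF g(1) Fg] f(4) g(2) by simp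
  have Pz: "FO P z = p" using functor_hom[OF functor_P g(1)] g(2) v(1) by (simp add: hom_def)
  obtain w h where h: "h \<in> hom X w z" "cartesian X A F h" "FA P h = k'" "FO P w = q"
    using cartesian_lift_over[OF hom_cod[OF category_X g(1)], of k' q] k' Pz by metis
  have pw: "pull k' (push v C) = cls w" using pull_cls[OF h(1,2)] h(3) pz by simp
  have "FA P h \<cdot>\<^bsub>M\<^esub> v' = FA P (g \<cdot>\<^bsub>X\<^esub> f)"
    using functor_comp[OF functor_P f(1) g(1)] f(2) g(2) h(3) sq by simp
  then obtain u where u: "u \<in> hom X y w" "FA P u = v'"
    using factor[OF comp_hom[OF category_X f(1) g(1)] h(1,2), of v'] v'(1) f(6) h(4) by metis
  have "FA F u = Ide A (FO F y)"
    using func_eq_arr[OF GP u(1)] u(2) v'(2) func_eq_obj[OF GP hom_dom[OF category_X f(1)]] f(6) by simp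
  from push_cls[OF u(1) this] show ?thesis using u(2) f(5) pw by simp
qed

section \<open>Arrows between components\<close>

text \<open>
  Every arrow of \<open>M\<close> is a vertical arrow followed by a lifting of the given split cleavage; these are
  the two factors.
\<close>

definition cart_part :: "'b \<Rightarrow> 'b" where
  "cart_part \<beta> = \<kappa> (Cod M \<beta>) (FA G \<beta>)"

definition vert_part :: "'b \<Rightarrow> 'b" where
  "vert_part \<beta> = (THE v. v \<in> hom M (Dom M \<beta>) (Dom M (cart_part \<beta>)) \<and> cart_part \<beta> \<cdot>\<^bsub>M\<^esub> v = \<beta> \<and>
     FA G v = Ide A (FO G (Dom M \<beta>)))"

lemma chosen:
  assumes n: "n \<in> Obj M" and \<alpha>: "\<alpha> \<in> hom A a (FO G n)"
  shows "\<kappa> n \<alpha> \<in> hom M (Dom M (\<kappa> n \<alpha>)) n" "cartesian M A G (\<kappa> n \<alpha>)" "FA G (\<kappa> n \<alpha>) = \<alpha>"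
    "FO G (Dom M (\<kappa> n \<alpha>)) = a"
proof -
  have "cleavage M A G \<kappa>" using split by (simp add: split_cleavage_def)
  then have c: "cartesian M A G (\<kappa> n \<alpha>)" "Cod M (\<kappa> n \<alpha>) = n" "FA G (\<kappa> n \<alpha>) = \<alpha>"
    using n \<alpha> by (simp_all add: cleavage_def hom_def)
  then show h: "\<kappa> n \<alpha> \<in> hom M (Dom M (\<kappa> n \<alpha>)) n" and "cartesian M A G (\<kappa> n \<alpha>)" "FA G (\<kappa> n \<alpha>) = \<alpha>"
    using cartesian_arr[OF c(1)] by simp_all
  show "FO G (Dom M (\<kappa> n \<alpha>)) = a" using functor_hom[OF functor_G h] c(3) \<alpha> by (simp add: hom_def)
qed

lemma chosen_ide: "n \<in> Obj M \<Longrightarrow> \<kappa> n (Ide A (FO G n)) = Ide M n"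
  using split by (simp add: split_cleavage_def)

lemma chosen_comp:
  "n \<in> Obj M \<Longrightarrow> \<alpha>' \<in> hom A b (FO G n) \<Longrightarrow> \<alpha> \<in> hom A a b \<Longrightarrow>
    \<kappa> n (\<alpha>' \<cdot>\<^bsub>A\<^esub> \<alpha>) = \<kappa> n \<alpha>' \<cdot>\<^bsub>M\<^esub> \<kappa> (Dom M (\<kappa> n \<alpha>')) \<alpha>"
  using split by (simp add: split_cleavage_def hom_def)

lemma cart_part:
  assumes \<beta>: "\<beta> \<in> hom M m n"
  shows "cart_part \<beta> \<in> hom M (Dom M (cart_part \<beta>)) n" "cartesian M A G (cart_part \<beta>)" "FA G (cart_part \<beta>) = FA G \<beta>"
    "FO G (Dom M (cart_part \<beta>)) = FO G m"
  using chosen[OF hom_cod[OF category_M \<beta>] functor_hom[OF functor_G \<beta>]] homD[OF \<beta>] by (simp_all add: cart_part_def)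

lemma vert_part_ex1:
  assumes \<beta>: "\<beta> \<in> hom M m n"
  shows "\<exists>!v. v \<in> hom M m (Dom M (cart_part \<beta>)) \<and> cart_part \<beta> \<cdot>\<^bsub>M\<^esub> v = \<beta> \<and> FA G v = Ide A (FO G m)"
proof (rule cartesian_ex1[OF cart_part(2)[OF \<beta>] cart_part(1)[OF \<beta>] \<beta>])
  show "Ide A (FO G m) \<in> hom A (FO G m) (FO G (Dom M (cart_part \<beta>)))"
    using ide_hom[OF category_A functor_obj[OF functor_G hom_dom[OF category_M \<beta>]]] cart_part(4)[OF \<beta>] by simp
  show "FA G (cart_part \<beta>) \<cdot>\<^bsub>A\<^esub> Ide A (FO G m) = FA G \<beta>"
    using cart_part(3)[OF \<beta>] comp_ide[OF category_A functor_hom[OF functor_G \<beta>]] by simp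
qed

lemma vert_part:
  assumes \<beta>: "\<beta> \<in> hom M m n"
  shows "vert_part \<beta> \<in> hom M m (Dom M (cart_part \<beta>))" "cart_part \<beta> \<cdot>\<^bsub>M\<^esub> vert_part \<beta> = \<beta>"
    "FA G (vert_part \<beta>) = Ide A (FO G m)"
  using theI'[OF vert_part_ex1[OF \<beta>]] homD[OF \<beta>] by (simp_all add: vert_part_def)

lemma vert_part_eqI:
  assumes \<beta>: "\<beta> \<in> hom M m n" and v: "v \<in> hom M m (Dom M (cart_part \<beta>))" "cart_part \<beta> \<cdot>\<^bsub>M\<^esub> v = \<beta>"
    "FA G v = Ide A (FO G m)"
  shows "vert_part \<beta> = v"
  using vert_part_ex1[OF \<beta>] vert_part[OF \<beta>] v by blast

lemma cart_part_vertical: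
  assumes v: "v \<in> hom M m n" "FA G v = Ide A (FO G m)"
  shows "cart_part v = Ide M n" "vert_part v = v"
proof -
  note n = hom_cod[OF category_M v(1)]
  have "FO G n = FO G m"
    using functor_hom[OF functor_G v(1)] v(2) ide_hom[OF category_A functor_obj[OF functor_G hom_dom[OF category_M v(1)]]]
    by (simp add: hom_def)
  then show h: "cart_part v = Ide M n" using chosen_ide[OF n] v(2) homD[OF v(1)] by (simp add: cart_part_def)
  show "vert_part v = v"
    by (rule vert_part_eqI[OF v(1)]) (use h v ide_comp[OF category_M v(1)] homD[OF ide_hom[OF category_M n]] in simp_all)
qed

text \<open>
  The condition under which the category of components has an arrow over \<open>\<beta>\<close> from \<open>C\<close> to \<open>D\<close>: both
  components are transported into the fiber over the object through which \<open>\<beta>\<close> factors.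
\<close>

definition link :: "'b \<Rightarrow> 'o set \<Rightarrow> 'o set \<Rightarrow> bool" where
  "link \<beta> C D \<longleftrightarrow> push (vert_part \<beta>) C = pull (cart_part \<beta>) D"

lemma link_vertical:
  assumes v: "v \<in> hom M m n" "FA G v = Ide A (FO G m)" and D: "D \<in> comps n"
  shows "link v C D \<longleftrightarrow> push v C = D"
  using cart_part_vertical[OF v] pull_ide[OF D] by (simp add: link_def)

lemma ide_over:
  assumes m: "m \<in> Obj M"
  shows "Ide M m \<in> hom M m m" "FA G (Ide M m) = Ide A (FO G m)"
  using ide_hom[OF category_M m] functor_ide[OF functor_G m] by simp_all

lemma link_ide: "m \<in> Obj M \<Longrightarrow> C \<in> comps m \<Longrightarrow> D \<in> comps m \<Longrightarrow> link (Ide M m) C D \<longleftrightarrow> C = D"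
  using link_vertical[OF ide_over] push_ide by simp

text \<open>
  As the cleavage is split, the cartesian part of \<open>\<gamma> \<cdot> \<beta>\<close> is the cartesian part of \<open>\<gamma>\<close> after the
  chosen lifting \<open>k\<close> of \<open>G \<beta>\<close>. The Beck-Chevalley condition for the square formed by \<open>k\<close>, the vertical
  part of \<open>\<gamma>\<close> and the cartesian part of \<open>\<beta>\<close> exchanges the two inner transports.
\<close>

lemma link_comp:
  assumes \<beta>: "\<beta> \<in> hom M l m" and \<gamma>: "\<gamma> \<in> hom M m n"
    and C: "C \<in> comps l" and D: "D \<in> comps m" and E: "E \<in> comps n"
    and CD: "link \<beta> C D" and DE: "link \<gamma> D E"
  shows "link (\<gamma> \<cdot>\<^bsub>M\<^esub> \<beta>) C E"
proof -
  let ?b = "Dom M (cart_part \<beta>)" and ?c = "Dom M (cart_part \<gamma>)"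
  note h\<beta> = cart_part[OF \<beta>] and h\<gamma> = cart_part[OF \<gamma>] and v\<beta> = vert_part[OF \<beta>] and v\<gamma> = vert_part[OF \<gamma>]
  have \<gamma>\<beta>: "\<gamma> \<cdot>\<^bsub>M\<^esub> \<beta> \<in> hom M l n" using comp_hom[OF category_M \<beta> \<gamma>] .
  have G\<beta>: "FA G \<beta> \<in> hom A (FO G l) (FO G m)" using functor_hom[OF functor_G \<beta>] .
  have G\<beta>': "FA G \<beta> \<in> hom A (FO G l) (FO G ?c)" using G\<beta> h\<gamma>(4) by simp
  define k where "k = \<kappa> ?c (FA G \<beta>)"
  define q where "q = Dom M k"
  note k = chosen[OF hom_dom[OF category_M h\<gamma>(1)] G\<beta>', folded k_def, folded q_def]
  \<comment> \<open>\<open>v\<close> is the vertical part of \<open>vert_part \<gamma> \<cdot> cart_part \<beta>\<close>.\<close>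
  note vh = comp_hom[OF category_M h\<beta>(1) v\<gamma>(1)]
  have I: "Ide A (FO G l) \<in> hom A (FO G ?b) (FO G q)"
    using ide_hom[OF category_A hom_dom[OF category_A G\<beta>]] h\<beta>(4) k(4) by simp
  have "FA G k \<cdot>\<^bsub>A\<^esub> Ide A (FO G l) = FA G (vert_part \<gamma> \<cdot>\<^bsub>M\<^esub> cart_part \<beta>)"
    using functor_comp[OF functor_G h\<beta>(1) v\<gamma>(1)] v\<gamma>(3) h\<beta>(3) k(3) comp_ide[OF category_A G\<beta>] ide_comp[OF category_A G\<beta>] by simp
  then obtain v where v: "v \<in> hom M ?b q" "k \<cdot>\<^bsub>M\<^esub> v = vert_part \<gamma> \<cdot>\<^bsub>M\<^esub> cart_part \<beta>" "FA G v = Ide A (FO G ?b)"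
    using cartesian_lift[OF k(2,1) vh I] h\<beta>(4) by metis
  have hc: "cart_part (\<gamma> \<cdot>\<^bsub>M\<^esub> \<beta>) = cart_part \<gamma> \<cdot>\<^bsub>M\<^esub> k"
    using chosen_comp[OF hom_cod[OF category_M \<gamma>] functor_hom[OF functor_G \<gamma>] G\<beta>] functor_comp[OF functor_G \<beta> \<gamma>]
      homD[OF \<gamma>] homD[OF \<gamma>\<beta>] by (simp add: cart_part_def k_def)
  have vc: "vert_part (\<gamma> \<cdot>\<^bsub>M\<^esub> \<beta>) = v \<cdot>\<^bsub>M\<^esub> vert_part \<beta>"
  proof (rule vert_part_eqI[OF \<gamma>\<beta>])
    show "v \<cdot>\<^bsub>M\<^esub> vert_part \<beta> \<in> hom M l (Dom M (cart_part (\<gamma> \<cdot>\<^bsub>M\<^esub> \<beta>)))"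
      unfolding hc using comp_hom[OF category_M v\<beta>(1) v(1)] homD[OF comp_hom[OF category_M k(1) h\<gamma>(1)]] by simp
    have "(cart_part \<gamma> \<cdot>\<^bsub>M\<^esub> k) \<cdot>\<^bsub>M\<^esub> (v \<cdot>\<^bsub>M\<^esub> vert_part \<beta>) = cart_part \<gamma> \<cdot>\<^bsub>M\<^esub> ((vert_part \<gamma> \<cdot>\<^bsub>M\<^esub> cart_part \<beta>) \<cdot>\<^bsub>M\<^esub> vert_part \<beta>)"
      using comp_assoc[OF category_M comp_hom[OF category_M v\<beta>(1) v(1)] k(1) h\<gamma>(1)] comp_assoc[OF category_M v\<beta>(1) v(1) k(1)] v(2)
      by simp
    also have "\<dots> = \<gamma> \<cdot>\<^bsub>M\<^esub> \<beta>"
      using comp_assoc[OF category_M v\<beta>(1) h\<beta>(1) v\<gamma>(1)] v\<beta>(2) v\<gamma>(2) comp_assoc[OF category_M \<beta> v\<gamma>(1) h\<gamma>(1)] by simp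
    finally show "cart_part (\<gamma> \<cdot>\<^bsub>M\<^esub> \<beta>) \<cdot>\<^bsub>M\<^esub> (v \<cdot>\<^bsub>M\<^esub> vert_part \<beta>) = \<gamma> \<cdot>\<^bsub>M\<^esub> \<beta>" unfolding hc .
    show "FA G (v \<cdot>\<^bsub>M\<^esub> vert_part \<beta>) = Ide A (FO G l)"
      using functor_comp[OF functor_G v\<beta>(1) v(1)] v(3) v\<beta>(3) h\<beta>(4) comp_ide[OF category_A ide_hom[OF category_A hom_dom[OF category_A G\<beta>]]]
      by simp
  qed
  have "push (vert_part (\<gamma> \<cdot>\<^bsub>M\<^esub> \<beta>)) C = push v (push (vert_part \<beta>) C)"
    unfolding vc by (rule push_comp[OF C v\<beta>(1,3) v(1,3)])
  also have "\<dots> = push v (pull (cart_part \<beta>) D)" using CD by (simp add: link_def)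
  also have "\<dots> = pull k (push (vert_part \<gamma>) D)"
    by (rule beck_chevalley[OF D h\<beta>(1,2) v\<gamma>(1,3) k(1,2) v(1,3,2)])
  also have "\<dots> = pull k (pull (cart_part \<gamma>) E)" using DE by (simp add: link_def)
  also have "\<dots> = pull (cart_part (\<gamma> \<cdot>\<^bsub>M\<^esub> \<beta>)) E"
    unfolding hc by (rule pull_comp[OF E h\<gamma>(1,2) k(1,2), symmetric])
  finally show ?thesis by (simp add: link_def)
qed

text \<open>
  Factor \<open>f\<close> through a cartesian arrow over the cartesian part of \<open>P f\<close>; the first factor then lies
  over the vertical part.
\<close>

lemma link_image:
  assumes f: "f \<in> hom X x y"
  shows "link (FA P f) (cls x) (cls y)"
proof -
  note Pf = functor_hom[OF functor_P f] and y = hom_cod[OF category_X f] and x = hom_dom[OF category_X f]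
  note h = cart_part[OF Pf] and v = vert_part[OF Pf]
  obtain w k where k: "k \<in> hom X w y" "cartesian X A F k" "FA P k = cart_part (FA P f)"
    "FO P w = Dom M (cart_part (FA P f))"
    using cartesian_lift_over[OF y h(1,2)] .
  obtain g where g: "g \<in> hom X x w" "FA P g = vert_part (FA P f)"
    using factor[OF f k(1,2), of "vert_part (FA P f)"] v(1,2) k(3,4) by metis
  have "FA F g = Ide A (FO F x)"
    using func_eq_arr[OF GP g(1)] g(2) v(3) func_eq_obj[OF GP x] by simp
  then show ?thesis using push_cls[OF g(1)] pull_cls[OF k(1,2)] g(2) k(3) by (simp add: link_def)
qed

text \<open>
  Composing with a chosen lifting leaves the vertical part of \<open>\<delta>\<close> unchanged and, the cleavage being
  split, composes its cartesian part with that lifting.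
\<close>

lemma link_cancel:
  assumes D: "D \<in> comps n" and \<alpha>: "\<alpha> \<in> hom A a (FO G n)"
    and \<delta>: "\<delta> \<in> hom M l (Dom M (\<kappa> n \<alpha>))" and n: "n \<in> Obj M"
    and lk: "link (\<kappa> n \<alpha> \<cdot>\<^bsub>M\<^esub> \<delta>) C D"
  shows "link \<delta> C (pull (\<kappa> n \<alpha>) D)"
proof -
  note k = chosen[OF n \<alpha>] and h = cart_part[OF \<delta>] and v = vert_part[OF \<delta>]
  have \<gamma>: "\<kappa> n \<alpha> \<cdot>\<^bsub>M\<^esub> \<delta> \<in> hom M l n" using comp_hom[OF category_M \<delta> k(1)] .
  have G\<delta>: "FA G \<delta> \<in> hom A (FO G l) a" using functor_hom[OF functor_G \<delta>] k(4) by simp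
  have hc: "cart_part (\<kappa> n \<alpha> \<cdot>\<^bsub>M\<^esub> \<delta>) = \<kappa> n \<alpha> \<cdot>\<^bsub>M\<^esub> cart_part \<delta>"
    using chosen_comp[OF n \<alpha> G\<delta>] functor_comp[OF functor_G \<delta> k(1)] k(3) homD[OF \<gamma>] homD[OF \<delta>]
    by (simp add: cart_part_def)
  have "vert_part (\<kappa> n \<alpha> \<cdot>\<^bsub>M\<^esub> \<delta>) = vert_part \<delta>"
    by (rule vert_part_eqI[OF \<gamma>], unfold hc)
      (use v homD[OF comp_hom[OF category_M h(1) k(1)]] comp_assoc[OF category_M v(1) h(1) k(1)] in simp_all)
  then show ?thesis
    using lk pull_comp[OF D k(1,2) h(1,2)] hc by (simp add: link_def)
qed

section \<open>The category of components\<close>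

text \<open>
  The object of \<open>M\<close> below a component, which any element of the component determines.
\<close>

definition pt :: "'o set \<Rightarrow> 'p" where
  "pt C = FO P (SOME x. x \<in> C)"

lemma pt:
  assumes "C \<in> comps m"
  shows "pt C = m" "m \<in> Obj M"
proof -
  obtain x where x: "x \<in> Obj X" "FO P x = m" "C = cls x" using assms by (auto simp: comps_iff)
  have "(SOME x. x \<in> C) \<in> C" using someI[of "\<lambda>y. y \<in> C" x] cls_self[OF x(1)] x(3) by simp
  then show "pt C = m" using mem_clsD(3) x by (simp add: pt_def)
  show "m \<in> Obj M" using functor_obj[OF functor_P x(1)] x(2) by simp
qed

lemma pt_cls: "x \<in> Obj X \<Longrightarrow> pt (cls x) = FO P x"
  using pt(1)[OF cls_comps] .

definition Xb :: "('o set, 'o set \<times> 'b \<times> 'o set) cat" where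
  "Xb = \<lparr>Obj = (\<Union>m \<in> Obj M. comps m),
     Arr = {(C, \<beta>, D). \<exists>m n. C \<in> comps m \<and> D \<in> comps n \<and> \<beta> \<in> hom M m n \<and> link \<beta> C D},
     Dom = (\<lambda>(C, _, _). C),
     Cod = (\<lambda>(_, _, D). D),
     Ide = (\<lambda>C. (C, Ide M (pt C), C)),
     Comp = (\<lambda>(_, \<gamma>, E) (C, \<beta>, _). (C, \<gamma> \<cdot>\<^bsub>M\<^esub> \<beta>, E))\<rparr>"

definition Pb :: "('o set, 'o set \<times> 'b \<times> 'o set, 'p, 'b) func" where
  "Pb = \<lparr>FO = pt, FA = (\<lambda>(_, \<beta>, _). \<beta>)\<rparr>"

definition Q :: "('o, 'a, 'o set, 'o set \<times> 'b \<times> 'o set) func" where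
  "Q = \<lparr>FO = cls, FA = (\<lambda>f. (cls (Dom X f), FA P f, cls (Cod X f)))\<rparr>"

abbreviation "Fb \<equiv> G \<bullet> Pb"

lemma Xb_obj: "C \<in> Obj Xb \<longleftrightarrow> C \<in> comps (pt C)"
proof
  assume "C \<in> Obj Xb"
  then obtain m where "C \<in> comps m" by (auto simp: Xb_def)
  with pt(1)[OF this] show "C \<in> comps (pt C)" by simp
next
  assume "C \<in> comps (pt C)"
  with pt(2)[OF this] show "C \<in> Obj Xb" by (auto simp: Xb_def)
qed

lemma Xb_hom:
  "f \<in> hom Xb C D \<longleftrightarrow> (\<exists>\<beta>. f = (C, \<beta>, D) \<and> C \<in> comps (pt C) \<and> D \<in> comps (pt D) \<and>
     \<beta> \<in> hom M (pt C) (pt D) \<and> link \<beta> C D)"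
proof
  assume "f \<in> hom Xb C D"
  then obtain \<beta> m n where *: "f = (C, \<beta>, D)" "C \<in> comps m" "D \<in> comps n" "\<beta> \<in> hom M m n" "link \<beta> C D"
    by (auto simp: Xb_def hom_def)
  with pt(1)[OF *(2)] pt(1)[OF *(3)] show "\<exists>\<beta>. f = (C, \<beta>, D) \<and> C \<in> comps (pt C) \<and> D \<in> comps (pt D) \<and>
     \<beta> \<in> hom M (pt C) (pt D) \<and> link \<beta> C D" by simp
qed (auto simp: Xb_def hom_def)

lemma Xb_comp: "(D', \<gamma>, E) \<cdot>\<^bsub>Xb\<^esub> (C, \<beta>, D) = (C, \<gamma> \<cdot>\<^bsub>M\<^esub> \<beta>, E)"
  by (simp add: Xb_def)

lemma Xb_ide: "Ide Xb C = (C, Ide M (pt C), C)"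
  by (simp add: Xb_def)

lemma Pb_simps [simp]: "FO Pb C = pt C" "FA Pb (C, \<beta>, D) = \<beta>"
  by (simp_all add: Pb_def)

lemma Q_simps [simp]: "FO Q x = cls x" "FA Q f = (cls (Dom X f), FA P f, cls (Cod X f))"
  by (simp_all add: Q_def)

lemma category_Xb: "category Xb"
proof (rule categoryI)
  fix f assume "f \<in> Arr Xb"
  then have "f \<in> hom Xb (Dom Xb f) (Cod Xb f)" by (rule homI)
  then show "Dom Xb f \<in> Obj Xb \<and> Cod Xb f \<in> Obj Xb" by (auto simp: Xb_hom Xb_obj)
next
  fix C assume "C \<in> Obj Xb"
  then have C: "C \<in> comps (pt C)" by (simp add: Xb_obj)
  then show "Ide Xb C \<in> hom Xb C C"
    using ide_over(1) link_ide pt(2) by (simp add: Xb_hom Xb_ide)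
next
  fix f g C D E assume "f \<in> hom Xb C D" "g \<in> hom Xb D E"
  then show "g \<cdot>\<^bsub>Xb\<^esub> f \<in> hom Xb C E"
    using link_comp comp_hom[OF category_M] by (auto simp: Xb_hom Xb_comp)
next
  fix f C D assume "f \<in> hom Xb C D"
  then show "f \<cdot>\<^bsub>Xb\<^esub> Ide Xb C = f \<and> Ide Xb D \<cdot>\<^bsub>Xb\<^esub> f = f"
    using comp_ide[OF category_M] ide_comp[OF category_M] by (auto simp: Xb_hom Xb_comp Xb_ide)
next
  fix f g h C D E E'
  assume "f \<in> hom Xb C D" "g \<in> hom Xb D E" "h \<in> hom Xb E E'"
  then show "h \<cdot>\<^bsub>Xb\<^esub> (g \<cdot>\<^bsub>Xb\<^esub> f) = (h \<cdot>\<^bsub>Xb\<^esub> g) \<cdot>\<^bsub>Xb\<^esub> f"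
    using comp_assoc[OF category_M] by (auto simp: Xb_hom Xb_comp)
qed

lemma functor_Pb: "is_functor Xb M Pb"
  by (rule functorI[OF category_Xb category_M]) (auto simp: Xb_hom Xb_obj Xb_comp Xb_ide pt(2))

lemma functor_Fb: "is_functor Xb A Fb"
  using is_functor_comp[OF functor_Pb functor_G] .

lemma functor_Q: "is_functor X Xb Q"
proof (rule functorI[OF category_X category_Xb])
  fix x assume x: "x \<in> Obj X"
  show "FO Q x \<in> Obj Xb" using cls_comps[OF x] pt_cls[OF x] by (simp add: Xb_obj)
  show "FA Q (Ide X x) = Ide Xb (FO Q x)"
    using homD[OF ide_hom[OF category_X x]] functor_ide[OF functor_P x] pt_cls[OF x] by (simp add: Xb_ide)
next
  fix f x y assume f: "f \<in> hom X x y"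
  note x = hom_dom[OF category_X f] and y = hom_cod[OF category_X f]
  show "FA Q f \<in> hom Xb (FO Q x) (FO Q y)"
    using homD[OF f] link_image[OF f] cls_comps[OF x] cls_comps[OF y] functor_hom[OF functor_P f]
    by (simp add: Xb_hom pt_cls x y)
next
  fix f g x y z assume f: "f \<in> hom X x y" and g: "g \<in> hom X y z"
  show "FA Q (g \<cdot>\<^bsub>X\<^esub> f) = FA Q g \<cdot>\<^bsub>Xb\<^esub> FA Q f"
    using homD[OF comp_hom[OF category_X f g]] homD[OF f] homD[OF g] functor_comp[OF functor_P f g] by (simp add: Xb_comp)
qed

text \<open>
  Factorizations through \<open>\<kappa> n \<alpha>\<close> exist uniquely in \<open>M\<close>, and by cancellation they are arrows between
  components.
\<close>

lemma chosen_cartesian: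
  assumes D: "D \<in> comps n" and \<alpha>: "\<alpha> \<in> hom A a (FO G n)"
  shows "(pull (\<kappa> n \<alpha>) D, \<kappa> n \<alpha>, D) \<in> hom Xb (pull (\<kappa> n \<alpha>) D) D"
    "cartesian Xb A Fb (pull (\<kappa> n \<alpha>) D, \<kappa> n \<alpha>, D)"
proof -
  let ?k = "\<kappa> n \<alpha>" and ?C = "pull (\<kappa> n \<alpha>) D"
  note n = pt(2)[OF D] and k = chosen[OF pt(2)[OF D] \<alpha>]
  have C: "?C \<in> comps (Dom M ?k)" using pull_comps[OF D k(1,2)] .
  have ptC: "pt ?C = Dom M ?k" and ptD: "pt D = n" using pt(1)[OF C] pt(1)[OF D] by simp_all
  have hk: "cart_part ?k = ?k" using k(3) homD[OF k(1)] by (simp add: cart_part_def)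
  have "vert_part ?k = Ide M (Dom M ?k)"
    by (rule vert_part_eqI[OF k(1)]) (use hk ide_over[OF hom_dom[OF category_M k(1)]] comp_ide[OF category_M k(1)] in simp_all)
  then have "link ?k ?C D" using push_ide[OF C] hk by (simp add: link_def)
  then show hom: "(?C, ?k, D) \<in> hom Xb ?C D" using C D k(1) ptC ptD by (simp add: Xb_hom)
  show "cartesian Xb A Fb (?C, ?k, D)"
  proof (rule cartesianI[OF hom])
    fix E g \<delta>0
    assume g: "g \<in> hom Xb E D" and \<delta>0: "\<delta>0 \<in> hom A (FO Fb E) (FO Fb ?C)"
      and eq: "FA Fb (?C, ?k, D) \<cdot>\<^bsub>A\<^esub> \<delta>0 = FA Fb g"
    obtain \<gamma> where \<gamma>: "g = (E, \<gamma>, D)" "E \<in> comps (pt E)" "\<gamma> \<in> hom M (pt E) n" "link \<gamma> E D"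
      using g ptD by (auto simp: Xb_hom)
    have "\<delta>0 \<in> hom A (FO G (pt E)) (FO G (Dom M ?k))" "FA G ?k \<cdot>\<^bsub>A\<^esub> \<delta>0 = FA G \<gamma>"
      using \<delta>0 eq ptC \<gamma>(1) by (simp_all add: comp_func_def)
    then obtain \<delta> where \<delta>: "\<delta> \<in> hom M (pt E) (Dom M ?k)" "?k \<cdot>\<^bsub>M\<^esub> \<delta> = \<gamma>" "FA G \<delta> = \<delta>0"
      using cartesian_lift[OF k(2,1) \<gamma>(3)] by blast
    have "link \<delta> E ?C" using link_cancel[OF D \<alpha> \<delta>(1) n] \<delta>(2) \<gamma>(4) by simp
    then have "(E, \<delta>, ?C) \<in> hom Xb E ?C" using \<gamma>(2) C ptC \<delta>(1) by (simp add: Xb_hom)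
    then show "\<exists>h. h \<in> hom Xb E ?C \<and> (?C, ?k, D) \<cdot>\<^bsub>Xb\<^esub> h = g \<and> FA Fb h = \<delta>0"
      using \<delta> \<gamma>(1) by (intro exI[of _ "(E, \<delta>, ?C)"]) (simp add: Xb_comp comp_func_def)
  next
    fix E h h'
    assume h: "h \<in> hom Xb E ?C" and h': "h' \<in> hom Xb E ?C"
      and eq: "(?C, ?k, D) \<cdot>\<^bsub>Xb\<^esub> h = (?C, ?k, D) \<cdot>\<^bsub>Xb\<^esub> h'" "FA Fb h = FA Fb h'"
    obtain \<delta> where \<delta>: "h = (E, \<delta>, ?C)" "\<delta> \<in> hom M (pt E) (Dom M ?k)"
      using h ptC by (auto simp: Xb_hom)
    obtain \<delta>' where \<delta>': "h' = (E, \<delta>', ?C)" "\<delta>' \<in> hom M (pt E) (Dom M ?k)"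
      using h' ptC by (auto simp: Xb_hom)
    have "?k \<cdot>\<^bsub>M\<^esub> \<delta> = ?k \<cdot>\<^bsub>M\<^esub> \<delta>'" "FA G \<delta> = FA G \<delta>'"
      using eq by (simp_all add: \<delta>(1) \<delta>'(1) Xb_comp comp_func_def)
    then have "\<delta> = \<delta>'" by (rule cartesian_unique[OF functor_G k(2,1) \<delta>(2) \<delta>'(2)])
    then show "h = h'" using \<delta>(1) \<delta>'(1) by simp
  qed
qed

lemma lifting_exists:
  assumes D: "D \<in> Obj Xb" and \<alpha>: "\<alpha> \<in> Arr A" "Cod A \<alpha> = FO Fb D"
  shows "\<exists>C. \<exists>k \<in> hom Xb C D. cartesian Xb A Fb k \<and> FA Fb k = \<alpha> \<and> cartesian M A G (FA Pb k)"
proof -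
  have D': "D \<in> comps (pt D)" using D by (simp add: Xb_obj)
  have \<alpha>': "\<alpha> \<in> hom A (Dom A \<alpha>) (FO G (pt D))" using \<alpha> by (simp add: hom_def comp_func_def)
  from chosen[OF pt(2)[OF D'] \<alpha>'] chosen_cartesian[OF D' \<alpha>'] show ?thesis
    by (intro exI bexI[of _ "(pull (\<kappa> (pt D) \<alpha>) D, \<kappa> (pt D) \<alpha>, D)"]) (simp_all add: comp_func_def)
qed

lemma fibration_Fb: "fibration Xb A Fb"
  using lifting_exists by (intro fibrationI[OF functor_Fb]) blast

lemma fib_1cell_Pb: "fib_1cell A Xb Fb M G Pb"
  unfolding fib_1cell_def
proof (intro conjI allI impI)
  show "func_eq Xb Fb Fb" by (simp add: func_eq_def)
  fix f assume "cartesian Xb A Fb f"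
  then show "cartesian M A G (FA Pb f)"
    using preserves_cartesian_if_cleavage[OF functor_Fb functor_G functor_Pb lifting_exists] by blast
qed (fact fibration_Fb fibM functor_Pb)+

lemma fib_1cell_Q: "fib_1cell A X F Xb Fb Q"
  unfolding fib_1cell_def
proof (intro conjI allI impI)
  show "func_eq X (Fb \<bullet> Q) F"
    using GP pt_cls by (simp add: func_eq_def comp_func_def)
  fix f assume f: "cartesian X A F f"
  show "cartesian Xb A Fb (FA Q f)"
  proof (rule preserves_cartesian_if_cleavage[OF functor_F functor_Fb functor_Q _ f])
    fix x \<alpha> assume x: "x \<in> Obj X" and "\<alpha> \<in> Arr A" "Cod A \<alpha> = FO F x"
    then have \<alpha>: "\<alpha> \<in> hom A (Dom A \<alpha>) (FO G (FO P x))" using func_eq_obj[OF GP x] by (simp add: hom_def)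
    note k = chosen[OF functor_obj[OF functor_P x] \<alpha>]
    obtain y g where g: "g \<in> hom X y x" "cartesian X A F g" "FA P g = \<kappa> (FO P x) \<alpha>"
      using cartesian_lift_over[OF x k(1,2)] .
    have "FA F g = \<alpha>" using func_eq_arr[OF GP g(1)] g(3) k(3) by simp
    moreover have "cartesian Xb A Fb (FA Q g)"
      using chosen_cartesian(2)[OF cls_comps[OF x] \<alpha>] pull_cls[OF g(1,2)] g(3) homD[OF g(1)] by simp
    ultimately show "\<exists>y. \<exists>k \<in> hom X y x. cartesian X A F k \<and> FA F k = \<alpha> \<and> cartesian Xb A Fb (FA Q k)"
      using g by blast
  qed
qed (fact fibX fibration_Fb functor_Q)+

lemma factorization: "func_eq X P (Pb \<bullet> Q)"
  using pt_cls by (simp add: func_eq_def comp_func_def)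

text \<open>
  Over a vertical arrow \<open>\<beta>\<close> the condition on an arrow from \<open>C\<close> to \<open>D\<close> reads \<open>push \<beta> C = D\<close>, so the
  codomain of a lifting is forced.
\<close>

sublocale Pb: unique_vertical_lifting A Xb Fb M G Pb
proof
  show "fib_1cell A Xb Fb M G Pb" by (rule fib_1cell_Pb)
  fix C m \<beta>
  assume C: "C \<in> Obj Xb" and "\<beta> \<in> hom M (FO Pb C) m" "FA G \<beta> = Ide A (FO Fb C)"
  then have \<beta>: "\<beta> \<in> hom M (pt C) m" "FA G \<beta> = Ide A (FO G (pt C))" by (simp_all add: comp_func_def)
  have C': "C \<in> comps (pt C)" using C by (simp add: Xb_obj)
  let ?D = "push \<beta> C"
  have D: "?D \<in> comps m" using push_comps[OF C' \<beta>] .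
  show "\<exists>!\<xi>. \<xi> \<in> Arr Xb \<and> Dom Xb \<xi> = C \<and> FA Pb \<xi> = \<beta>"
  proof (intro ex1I[of _ "(C, \<beta>, ?D)"])
    have "(C, \<beta>, ?D) \<in> hom Xb C ?D"
      using C' D pt(1)[OF D] \<beta>(1) link_vertical[OF \<beta> D] by (simp add: Xb_hom)
    from homD[OF this] show "(C, \<beta>, ?D) \<in> Arr Xb \<and> Dom Xb (C, \<beta>, ?D) = C \<and> FA Pb (C, \<beta>, ?D) = \<beta>"
      by simp
    fix \<xi> assume "\<xi> \<in> Arr Xb \<and> Dom Xb \<xi> = C \<and> FA Pb \<xi> = \<beta>"
    then obtain E where "\<xi> \<in> hom Xb C E" "FA Pb \<xi> = \<beta>" by (auto simp: hom_def)
    then have E: "\<xi> = (C, \<beta>, E)" "E \<in> comps (pt E)" "\<beta> \<in> hom M (pt C) (pt E)" "link \<beta> C E"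
      by (auto simp: Xb_hom)
    then show "\<xi> = (C, \<beta>, ?D)" using link_vertical[OF E(3) \<beta>(2) E(2)] by simp
  qed
qed

lemma fiber_Pb:
  assumes m: "m \<in> Obj M"
  shows "Obj (fiber Xb M Pb m) = comps m" "Arr (fiber Xb M Pb m) = Ide Xb ` comps m"
proof -
  show "Obj (fiber Xb M Pb m) = comps m"
  proof (intro set_eqI iffI)
    fix C assume C: "C \<in> comps m"
    with pt(1)[OF C] show "C \<in> Obj (fiber Xb M Pb m)" by (simp add: fiber_obj Xb_obj)
  qed (auto simp: fiber_obj Xb_obj)
  show "Arr (fiber Xb M Pb m) = Ide Xb ` comps m"
  proof (intro set_eqI iffI)
    fix f assume "f \<in> Arr (fiber Xb M Pb m)"
    then obtain C D where f: "f \<in> hom Xb C D" "FA Pb f = Ide M m"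
      by (simp add: fiber_def hom_def)
    then have 1: "f = (C, Ide M m, D)" "C \<in> comps (pt C)" "D \<in> comps (pt D)"
      "Ide M m \<in> hom M (pt C) (pt D)" "link (Ide M m) C D"
      by (auto simp: Xb_hom)
    have "pt C = m" "pt D = m" using homD[OF 1(4)] homD[OF ide_over(1)[OF m]] by auto
    then have "C \<in> comps m" "f = Ide Xb C"
      using 1 link_ide[OF m] by (simp_all add: Xb_ide)
    then show "f \<in> Ide Xb ` comps m" by blast
  next
    fix f assume "f \<in> Ide Xb ` comps m"
    then obtain C where C: "C \<in> comps m" "f = Ide Xb C" by blast
    with pt(1)[OF C(1)] have "C \<in> Obj Xb" "pt C = m" by (simp_all add: Xb_obj)
    then show "f \<in> Arr (fiber Xb M Pb m)"
      using homD[OF ide_hom[OF category_Xb, of C]] C(2) by (simp add: fiber_def Xb_ide)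
  qed
qed

end

section \<open>The factorization\<close>

theorem theorem3p2:
  fixes A :: "('c, 'd) cat"
    and X :: "('o, 'a) cat" and F :: "('o, 'a, 'c, 'd) func"
    and M :: "('p, 'b) cat" and G :: "('p, 'b, 'c, 'd) func"
    and P :: "('o, 'a, 'p, 'b) func"
  assumes "fib_1cell A X F M G P"
    and "fiberwise_opfibration A X F M G P"
    and "split_fibration M A G"
  shows "\<exists>(Xb :: ('o set, 'o set \<times> 'b \<times> 'o set) cat) Fb Q Pb.
     fib_1cell A X F Xb Fb Q \<and>
     fib_1cell A Xb Fb M G Pb \<and>
     func_eq X P (Pb \<bullet> Q) \<and>
     fib_discrete_opfibration A Xb Fb M G Pb \<and>
     (\<forall>m\<in>Obj M.
        Obj (fiber Xb M Pb m) = components (fiber X M P m) \<and>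
        Arr (fiber Xb M Pb m) = Ide Xb ` components (fiber X M P m) \<and>
        (\<forall>x\<in>Obj (fiber X M P m). FO Q x = component (fiber X M P m) x))"
proof -
  obtain \<kappa> where "split_cleavage M A G \<kappa>" using assms(3) unfolding split_fibration_def by blast
  then interpret component_quotient A X F M G P \<kappa> using assms(1,2) by unfold_locales
  show ?thesis
  proof (intro exI conjI ballI)
    show "fib_1cell A X F Xb Fb Q" by (rule fib_1cell_Q)
    show "fib_1cell A Xb Fb M G Pb" by (rule fib_1cell_Pb)
    show "func_eq X P (Pb \<bullet> Q)" by (rule factorization)
    show "fib_discrete_opfibration A Xb Fb M G Pb" by (rule Pb.discrete_opfibration)
    fix m assume m: "m \<in> Obj M"
    show "Obj (fiber Xb M Pb m) = components (fiber X M P m)"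
      "Arr (fiber Xb M Pb m) = Ide Xb ` components (fiber X M P m)"
      using fiber_Pb[OF m] by (simp_all add: comps_def)
    fix x assume "x \<in> Obj (fiber X M P m)"
    then show "FO Q x = component (fiber X M P m) x" by (simp add: fiber_obj cls_def)
  qed
qed

end
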